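(* Let $G$ be a graph with exactly one end, and suppose that this end has finite vertex degree. Then the automorphism group $\operatorname{Aut}(G)$ is either finite or has at least $2^{\aleph_0}$ elements.
   Context: A ray is a one-way infinite path. Two rays of $G$ are in the same end if for every finite vertex set $S$ they have tails in the same component of $G-S$; ends are the equivalence classes. The vertex degree of an end is the maximal cardinality of a family of pairwise disjoint rays belonging to the end; it is finite if this is a natural number. *)

theory Defs
  imports "HOL-Algebra.Bij" "HOL-Library.Equipollence"
begin

section \<open>Simple graphs, possibly infinite\<close>

record 'a ugraph =
  verts :: "'a set"
  edges :: "'a set set"

definition simple_graph :: "'a ugraph \<Rightarrow> bool" where
  "simple_graph G \<longleftrightarrow> (\<forall>e\<in>edges G. e \<subseteq> verts G \<and> card e = 2)"

definition del_verts :: "'a ugraph \<Rightarrow> 'a set \<Rightarrow> 'a ugraph" where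
  "del_verts G S = \<lparr>verts = verts G - S, edges = {e \<in> edges G. e \<inter> S = {}}\<rparr>"

definition connected_rel :: "'a ugraph \<Rightarrow> 'a rel" where
  "connected_rel G =
     {(u, v). u \<in> verts G \<and> v \<in> verts G \<and> (u, v) \<in> {(x, y). {x, y} \<in> edges G}\<^sup>*}"

text \<open>Components are represented by their vertex sets.\<close>

definition components_of_graph :: "'a ugraph \<Rightarrow> 'a set set" where
  "components_of_graph G = verts G // connected_rel G"


section \<open>Rays and ends\<close>

text \<open>A ray is represented by the enumeration of its vertices from its initial vertex; it is
  determined by the subgraph and determines it.\<close>

definition ray :: "'a ugraph \<Rightarrow> (nat \<Rightarrow> 'a) \<Rightarrow> bool" where
  "ray G r \<longleftrightarrow> inj r \<and> range r \<subseteq> verts G \<and> (\<forall>n. {r n, r (Suc n)} \<in> edges G)"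

definition same_end :: "'a ugraph \<Rightarrow> (nat \<Rightarrow> 'a) \<Rightarrow> (nat \<Rightarrow> 'a) \<Rightarrow> bool" where
  "same_end G r s \<longleftrightarrow>
     (\<forall>S. finite S \<and> S \<subseteq> verts G \<longrightarrow>
        (\<exists>C\<in>components_of_graph (del_verts G S). \<exists>m n. r ` {m..} \<subseteq> C \<and> s ` {n..} \<subseteq> C))"

definition end_rel :: "'a ugraph \<Rightarrow> (nat \<Rightarrow> 'a) rel" where
  "end_rel G = {(r, s). ray G r \<and> ray G s \<and> same_end G r s}"

definition ends :: "'a ugraph \<Rightarrow> (nat \<Rightarrow> 'a) set set" where
  "ends G = {r. ray G r} // end_rel G"

definition disjoint_rays :: "(nat \<Rightarrow> 'a) set \<Rightarrow> bool" where
  "disjoint_rays F \<longleftrightarrow> pairwise (\<lambda>r s. disjnt (range r) (range s)) F"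

text \<open>The set \<open>K\<close> stands for its cardinality.\<close>

definition has_vertex_degree :: "(nat \<Rightarrow> 'a) set \<Rightarrow> 'k set \<Rightarrow> bool" where
  "has_vertex_degree \<omega> K \<longleftrightarrow>
     (\<exists>F. F \<subseteq> \<omega> \<and> disjoint_rays F \<and> F \<approx> K) \<and>
     (\<forall>F. F \<subseteq> \<omega> \<and> disjoint_rays F \<longrightarrow> F \<lesssim> K)"

definition finite_vertex_degree :: "(nat \<Rightarrow> 'a) set \<Rightarrow> bool" where
  "finite_vertex_degree \<omega> \<longleftrightarrow> (\<exists>k::nat. has_vertex_degree \<omega> {..<k})"


section \<open>The automorphism group\<close>

definition automorphisms :: "'a ugraph \<Rightarrow> ('a \<Rightarrow> 'a) set" where
  "automorphisms G =
     {f \<in> Bij (verts G). \<forall>u\<in>verts G. \<forall>v\<in>verts G. {u, v} \<in> edges G \<longleftrightarrow> {f u, f v} \<in> edges G}"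

definition Aut :: "'a ugraph \<Rightarrow> ('a \<Rightarrow> 'a) monoid" where
  "Aut G = BijGroup (verts G) \<lparr>carrier := automorphisms G\<rparr>"


section \<open>Well-definedness\<close>

lemma equiv_connected_rel: "equiv (verts G) (connected_rel G)"
proof (rule equivI)
  let ?A = "{(x, y). {x, y} \<in> edges G}"
  show "connected_rel G \<subseteq> verts G \<times> verts G"
    by (auto simp: connected_rel_def)
  show "refl_on (verts G) (connected_rel G)"
    by (auto simp: connected_rel_def refl_on_def)
  have "sym (?A\<^sup>*)"
    by (rule sym_rtrancl) (auto simp: sym_def insert_commute)
  then show "sym (connected_rel G)"
    by (auto simp: connected_rel_def sym_def)
  show "trans (connected_rel G)"
    by (auto simp: connected_rel_def trans_def)
qed

lemma ray_tail_in_component: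
  assumes "ray G r" "finite S"
  shows "\<exists>C\<in>components_of_graph (del_verts G S). \<exists>m. r ` {m..} \<subseteq> C"
proof -
  let ?H = "del_verts G S"
  have "finite (r -` S)"
    using assms by (simp add: ray_def finite_vimageI)
  then obtain m where m: "\<And>n. r n \<in> S \<Longrightarrow> n < m"
    unfolding finite_nat_set_iff_bounded by blast
  have avoid: "r n \<notin> S" if "m \<le> n" for n
    using m that by (meson not_le)
  have V: "r n \<in> verts ?H" if "m \<le> n" for n
    using avoid[OF that] assms(1) by (auto simp: del_verts_def ray_def)
  have E: "{r n, r (Suc n)} \<in> edges ?H" if "m \<le> n" for n
    using avoid[of n] avoid[of "Suc n"] that assms(1) by (auto simp: del_verts_def ray_def)
  have path: "(r m, r n) \<in> {(x, y). {x, y} \<in> edges ?H}\<^sup>*" if "m \<le> n" for n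
    using that
  proof (induction rule: dec_induct)
    case (step n)
    then show ?case using E by (auto intro: rtrancl.rtrancl_into_rtrancl)
  qed auto
  have "r ` {m..} \<subseteq> connected_rel ?H `` {r m}"
    using path V by (auto simp: connected_rel_def)
  moreover have "connected_rel ?H `` {r m} \<in> components_of_graph ?H"
    using V[of m] by (simp add: components_of_graph_def quotientI)
  ultimately show ?thesis by blast
qed

lemma equiv_end_rel: "equiv {r. ray G r} (end_rel G)"
proof (rule equivI)
  show "end_rel G \<subseteq> {r. ray G r} \<times> {r. ray G r}"
    by (auto simp: end_rel_def)
  show "refl_on {r. ray G r} (end_rel G)"
  proof (rule refl_onI)
    fix r assume "r \<in> {r. ray G r}"
    then have r: "ray G r" by simp
    have "same_end G r r"
      unfolding same_end_def
    proof (intro allI impI)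
      fix S assume "finite S \<and> S \<subseteq> verts G"
      then obtain C m where "C \<in> components_of_graph (del_verts G S)" "r ` {m..} \<subseteq> C"
        using ray_tail_in_component[OF r, of S] by blast
      then show "\<exists>C\<in>components_of_graph (del_verts G S). \<exists>m n. r ` {m..} \<subseteq> C \<and> r ` {n..} \<subseteq> C"
        by blast
    qed
    with r show "(r, r) \<in> end_rel G" by (simp add: end_rel_def)
  qed
  show "sym (end_rel G)"
  proof (rule symI)
    fix r s assume "(r, s) \<in> end_rel G"
    then have rs: "ray G r" "ray G s" "same_end G r s" by (auto simp: end_rel_def)
    have "same_end G s r"
      unfolding same_end_def
    proof (intro allI impI)
      fix S assume "finite S \<and> S \<subseteq> verts G"
      then obtain C m n where "C \<in> components_of_graph (del_verts G S)" "r ` {m..} \<subseteq> C" "s ` {n..} \<subseteq> C"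
        using rs(3) unfolding same_end_def by meson
      then show "\<exists>C\<in>components_of_graph (del_verts G S). \<exists>m n. s ` {m..} \<subseteq> C \<and> r ` {n..} \<subseteq> C"
        by meson
    qed
    with rs show "(s, r) \<in> end_rel G" by (simp add: end_rel_def)
  qed
  show "trans (end_rel G)"
  proof (rule transI)
    fix r s t assume rs: "(r, s) \<in> end_rel G" and st: "(s, t) \<in> end_rel G"
    have "same_end G r t"
      unfolding same_end_def
    proof (intro allI impI)
      fix S assume S: "finite S \<and> S \<subseteq> verts G"
      let ?H = "del_verts G S"
      obtain C k l where C: "C \<in> components_of_graph ?H" "r ` {k..} \<subseteq> C" "s ` {l..} \<subseteq> C"
        using rs S unfolding end_rel_def same_end_def mem_Collect_eq case_prod_conv by meson
      obtain D m n where D: "D \<in> components_of_graph ?H" "s ` {m..} \<subseteq> D" "t ` {n..} \<subseteq> D"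
        using st S unfolding end_rel_def same_end_def mem_Collect_eq case_prod_conv by meson
      have "s (max l m) \<in> C \<inter> D"
        using C(3) D(2) by auto
      then have "C = D"
        using quotient_disj[OF equiv_connected_rel] C(1) D(1)
        unfolding components_of_graph_def by (metis empty_iff)
      then show "\<exists>C\<in>components_of_graph ?H. \<exists>m n. r ` {m..} \<subseteq> C \<and> t ` {n..} \<subseteq> C"
        using C(1,2) D(3) by meson
    qed
    then show "(r, t) \<in> end_rel G"
      using rs st by (auto simp: end_rel_def)
  qed
qed

lemma subgroup_automorphisms: "subgroup (automorphisms G) (BijGroup (verts G))"
proof (rule group.subgroupI[OF group_BijGroup])
  show "automorphisms G \<subseteq> carrier (BijGroup (verts G))"
    by (auto simp: automorphisms_def BijGroup_def)
  show "automorphisms G \<noteq> {}"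
    using id_Bij[of "verts G"] by (auto simp: automorphisms_def)
next
  fix f assume f: "f \<in> automorphisms G"
  let ?V = "verts G"
  let ?g = "restrict (inv_into ?V f) ?V"
  have fB: "f \<in> Bij ?V" using f by (simp add: automorphisms_def)
  have bij: "bij_betw f ?V ?V" using fB by (simp add: Bij_def)
  have "{u, v} \<in> edges G \<longleftrightarrow> {?g u, ?g v} \<in> edges G" if "u \<in> ?V" "v \<in> ?V" for u v
  proof -
    have "inv_into ?V f u \<in> ?V" "inv_into ?V f v \<in> ?V"
      using bij that by (metis bij_betw_def inv_into_into)+
    moreover have "f (inv_into ?V f u) = u" "f (inv_into ?V f v) = v"
      using bij that by (auto simp: bij_betw_def f_inv_into_f)
    ultimately show ?thesis
      using f that by (auto simp: automorphisms_def)
  qed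
  then have "?g \<in> automorphisms G"
    using restrict_inv_into_Bij[OF fB] by (simp add: automorphisms_def)
  then show "inv\<^bsub>BijGroup ?V\<^esub> f \<in> automorphisms G"
    using inv_BijGroup[OF fB] by simp
next
  fix f g assume fg: "f \<in> automorphisms G" "g \<in> automorphisms G"
  have "g v \<in> verts G" if "v \<in> verts G" for v
    using fg(2) that Bij_imp_funcset[of g "verts G"] by (auto simp: automorphisms_def)
  with fg show "f \<otimes>\<^bsub>BijGroup (verts G)\<^esub> g \<in> automorphisms G"
    by (auto simp: automorphisms_def BijGroup_def compose_Bij compose_eq)
qed

lemma group_Aut: "group (Aut G)"
  unfolding Aut_def
  using subgroup_automorphisms group_BijGroup by (rule subgroup.subgroup_is_group)

end

theory Submission
  imports Defs
begin

text \<open>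
  Call a vertex set with finite boundary \<open>nb C\<close> a region if it contains a tail of every ray. Boundary
  size is submodular. By a Menger type theorem, and since infinitely many vertices dominating the end
  would give infinitely many disjoint rays, the regions inside any given region have boundaries of
  bounded size; so far enough out the smallest boundaries have a constant size \<open>c\<close>, and they exhaust
  the graph by rayless pieces. A rayless piece is handled by induction on its rank.

  Suppose that there are fewer than continuum many automorphisms. Then a Baire category argument
  together with the rayless case gives a finite set \<open>F\<close> whose pointwise stabiliser is trivial. If
  the group is infinite, let \<open>L\<close> be the stabiliser of a maximal \<open>F' \<subseteq> F\<close> for which it is infinite. By
  submodularity, a canonical region \<open>P\<close> far out has at most \<open>c\<close> translates under a given finite subset
  of \<open>L\<close>, so some \<open>u \<noteq> id\<close> in \<open>L\<close> fixes \<open>P\<close> pointwise. Only finitely many elements of an \<open>L\<close>-orbit of a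
  vertex in \<open>F - F'\<close> lie outside \<open>P\<close>: otherwise two isomorphic components could be exchanged without
  moving \<open>F\<close>. Hence some conjugate of \<open>u\<close> fixes \<open>F\<close>, a contradiction.
\<close>

text \<open>Vertices may have infinite degree, so the complement of a region can be infinite. It
  contains no ray, however, and there the rank induction and the star-comb lemma take the place of
  finiteness. The regions of an exhaustion are arbitrary choices that automorphisms need not
  respect. The canonical ones are determined by \<open>X0\<close> and one vertex \<open>v n\<close>,
  and an inclusion between two translates of one of them is an equality. Only finite subsets of
  \<open>L\<close> are treated because \<open>X0\<close> is not invariant either and is replaced by
  a finite union of its images. Besides the \<open>c\<close> translates there are
  \<open>c ^ c\<close> maps between their boundaries, so two elements \<open>g\<close>,
  \<open>h\<close> of \<open>L\<close> agree on \<open>P\<close> as a set and on every vertex of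
  \<open>nb P\<close>. Then \<open>u = inv g \<circ> h\<close> preserves \<open>P\<close> and fixes
  \<open>nb P\<close>; acting by \<open>u\<close> on \<open>P\<close> alone is an automorphism that
  fixes \<open>F\<close>, hence trivial. Maximality of \<open>F'\<close> makes the stabiliser in
  \<open>L\<close> of any vertex of \<open>F - F'\<close> finite. With few orbit points outside
  \<open>P\<close>, only finitely many elements of \<open>L\<close> send such a vertex outside
  \<open>P\<close>, and some \<open>f\<close> in \<open>L\<close> sends all of \<open>F - F'\<close>
  into \<open>P\<close>.\<close>

unbundle no m_inv_syntax

section \<open>Boundaries and components\<close>

text \<open>The whole type is taken as the vertex set: points outside \<open>V\<close> play no role, since automorphisms
  are required to fix them.\<close>

locale sym_rel =
  fixes adj :: "'a \<Rightarrow> 'a \<Rightarrow> bool" and V :: "'a set"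
  assumes adj_sym: "adj x y \<Longrightarrow> adj y x"
begin

definition nb :: "'a set \<Rightarrow> 'a set" where
  "nb C = {v. v \<notin> C \<and> (\<exists>c\<in>C. adj v c)}"

text \<open>Connectedness is expressed without paths.\<close>

definition conn :: "'a set \<Rightarrow> bool" where
  "conn C \<longleftrightarrow> (\<forall>D. nb D \<inter> C = {} \<longrightarrow> C \<subseteq> D \<or> C \<inter> D = {})"

text \<open>For \<open>x\<close> outside \<open>Y\<close> the family is empty and the value is
  \<open>UNIV\<close>.\<close>

definition component :: "'a set \<Rightarrow> 'a \<Rightarrow> 'a set" where
  "component Y x = \<Inter>{D. x \<in> D \<and> D \<subseteq> Y \<and> nb D \<inter> Y = {}}"

definition is_ray :: "(nat \<Rightarrow> 'a) \<Rightarrow> bool" where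
  "is_ray r \<longleftrightarrow> inj r \<and> (\<forall>n. adj (r n) (r (Suc n)))"

lemma nbI: "v \<notin> C \<Longrightarrow> c \<in> C \<Longrightarrow> adj v c \<Longrightarrow> v \<in> nb C"
  by (auto simp: nb_def)

lemma nb_disjoint: "nb C \<inter> C = {}"
  by (auto simp: nb_def)

lemma nb_Int: "nb (C \<inter> D) \<subseteq> (nb C \<inter> D) \<union> (nb C \<inter> nb D) \<union> (C \<inter> nb D)"
  by (auto simp: nb_def)

lemma nb_Un: "nb (C \<union> D) \<subseteq> (nb C - D) \<union> (nb D - C)"
  by (auto simp: nb_def)

lemma nb_closure_mono: "C \<subseteq> D \<Longrightarrow> C \<union> nb C \<subseteq> D \<union> nb D"
  by (auto simp: nb_def)

lemma nb_Compl_closure: "nb (- (C \<union> nb C)) \<subseteq> nb C"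
  by (auto simp: nb_def dest: adj_sym)

lemma connD: "conn C \<Longrightarrow> nb D \<inter> C = {} \<Longrightarrow> x \<in> C \<Longrightarrow> x \<in> D \<Longrightarrow> C \<subseteq> D"
  by (auto simp: conn_def)

lemma conn_eqI:
  assumes "conn C" "conn D" "nb C \<inter> D = {}" "nb D \<inter> C = {}" "x \<in> C" "x \<in> D"
  shows "C = D"
  using connD[OF assms(1,4)] connD[OF assms(2,3)] assms(5,6) by blast

lemma component_self: "x \<in> component Y x"
  by (auto simp: component_def)

lemma component_subset: "x \<in> Y \<Longrightarrow> component Y x \<subseteq> Y"
  using nb_disjoint[of Y] by (auto simp: component_def)

lemma nb_component: "nb (component Y x) \<inter> Y = {}"
proof (rule ccontr)
  assume "nb (component Y x) \<inter> Y \<noteq> {}"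
  then obtain z y where z: "z \<in> Y" "z \<notin> component Y x" "y \<in> component Y x" "adj z y"
    by (auto simp: nb_def)
  then obtain D where "z \<notin> D" "x \<in> D" "D \<subseteq> Y" "nb D \<inter> Y = {}" "y \<in> D"
    by (auto simp: component_def)
  then show False using z nbI by blast
qed

lemma component_leI: "x \<in> D \<Longrightarrow> D \<subseteq> Y \<Longrightarrow> nb D \<inter> Y = {} \<Longrightarrow> component Y x \<subseteq> D"
  by (auto simp: component_def)

text \<open>The part of the component inside \<open>D\<close> and the part outside it both have
  boundaries disjoint from \<open>Y\<close>. By minimality the part that contains \<open>x\<close>
  is everything.\<close>

lemma conn_component:
  assumes "x \<in> Y" shows "conn (component Y x)"
  unfolding conn_def
proof (intro allI impI)
  fix D assume D: "nb D \<inter> component Y x = {}"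
  let ?K = "component Y x"
  have sub: "?K \<subseteq> Y" using assms component_subset by auto
  have cl: "z \<in> ?K" if "z \<in> Y" "y \<in> ?K" "adj z y" for z y
    using nb_component[of Y x] that nbI by blast
  show "?K \<subseteq> D \<or> ?K \<inter> D = {}"
  proof (cases "x \<in> D")
    case True
    have "nb (D \<inter> ?K) \<inter> Y = {}"
      using cl D by (auto simp: nb_def)
    then have "?K \<subseteq> D \<inter> ?K"
      using True sub component_self by (intro component_leI) auto
    then show ?thesis by auto
  next
    case False
    have "nb (?K - D) \<inter> Y = {}"
      using cl D adj_sym unfolding nb_def by blast
    then have "?K \<subseteq> ?K - D"
      using False sub component_self by (intro component_leI) auto
    then show ?thesis by auto
  qed
qed

lemma component_eq:
  assumes "x \<in> Y" "y \<in> component Y x" shows "component Y y = component Y x"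
proof (rule conn_eqI)
  have y: "y \<in> Y" using assms component_subset by blast
  show "conn (component Y y)" "conn (component Y x)" using y assms conn_component by auto
  show "nb (component Y y) \<inter> component Y x = {}" using nb_component[of Y y] component_subset[OF assms(1)] by blast
  show "nb (component Y x) \<inter> component Y y = {}" using nb_component[of Y x] component_subset[OF y] by blast
  show "y \<in> component Y y" by (rule component_self)
  show "y \<in> component Y x" by (rule assms)
qed

lemma nb_component_subset:
  assumes "x \<in> X - S" shows "nb (component (X - S) x) \<subseteq> S \<union> nb X"
proof
  fix z assume z: "z \<in> nb (component (X - S) x)"
  have "component (X - S) x \<subseteq> X - S" using assms by (rule component_subset)
  then have "z \<in> X \<or> z \<in> nb X" using z by (auto simp: nb_def)
  moreover have "z \<notin> X - S" using z nb_component[of "X - S" x] by blast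
  ultimately show "z \<in> S \<union> nb X" by auto
qed

section \<open>Rayless sets\<close>

text \<open>Schmidt's ranking of rayless graphs, as an inductive predicate instead of an ordinal.\<close>

inductive ranked :: "'a set \<Rightarrow> bool" where
  "finite S \<Longrightarrow> (\<And>x. x \<in> X - S \<Longrightarrow> ranked (component (X - S) x)) \<Longrightarrow> ranked X"

text \<open>With \<open>S = {v}\<close> some component of \<open>Y - {v}\<close> is unranked, and
  \<open>v\<close> must be adjacent to it, since otherwise it would be all of the connected set
  \<open>Y\<close>.\<close>

lemma not_ranked_step:
  assumes "\<not> ranked Y" "conn Y" "v \<in> Y"
  shows "\<exists>Y' v'. \<not> ranked Y' \<and> conn Y' \<and> v' \<in> Y' \<and> adj v v' \<and> Y' \<subseteq> Y - {v}"
proof -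
  obtain x where x: "x \<in> Y - {v}" "\<not> ranked (component (Y - {v}) x)"
    using ranked.intros[of "{v}" Y] assms(1) by auto
  let ?Y = "component (Y - {v}) x"
  have c: "conn ?Y" using x by (intro conn_component)
  have sub: "?Y \<subseteq> Y - {v}" using x by (intro component_subset)
  have "nb ?Y \<inter> Y \<noteq> {}"
  proof
    assume "nb ?Y \<inter> Y = {}"
    then have "Y \<subseteq> ?Y" using assms(2) x component_self[of x "Y - {v}"] by (intro connD[of Y _ x]) auto
    then show False using sub assms(3) by auto
  qed
  then have "v \<in> nb ?Y" using nb_component[of "Y - {v}" x] by auto
  then obtain v' where "v' \<in> ?Y" "adj v v'" by (auto simp: nb_def)
  then show ?thesis using x(2) c sub by blast
qed

text \<open>Iterating \<open>not_ranked_step\<close> in an unranked set yields a ray: each vertex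
  lies in a set from which all its predecessors have been deleted.\<close>

lemma rayless_ranked:
  assumes "\<And>r. is_ray r \<Longrightarrow> range r \<subseteq> X \<Longrightarrow> False"
  shows "ranked X"
proof (rule ccontr)
  assume "\<not> ranked X"
  then obtain x where x: "x \<in> X" "\<not> ranked (component X x)"
    using ranked.intros[of "{}" X] by auto
  define P where "P = (\<lambda>p. \<not> ranked (fst p) \<and> conn (fst p) \<and> snd p \<in> fst p \<and> fst p \<subseteq> X)"
  define R where "R = (\<lambda>p q. adj (snd p) (snd q) \<and> fst q \<subseteq> fst p - {snd p})"
  have "\<exists>f. \<forall>n. P (f n) \<and> R (f n) (f (Suc n))"
  proof (rule dependent_nat_choice)
    show "\<exists>p. P p" using x conn_component component_self component_subset by (intro exI[of _ "(component X x, x)"]) (auto simp: P_def)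
  next
    fix p n assume "P p"
    then obtain Y' v' where "\<not> ranked Y'" "conn Y'" "v' \<in> Y'" "adj (snd p) v'" "Y' \<subseteq> fst p - {snd p}"
      using not_ranked_step[of "fst p" "snd p"] by (auto simp: P_def)
    then show "\<exists>q. P q \<and> R p q"
      using \<open>P p\<close> by (intro exI[of _ "(Y', v')"]) (auto simp: P_def R_def)
  qed
  then obtain f where f: "\<And>n. P (f n)" "\<And>n. R (f n) (f (Suc n))" by auto
  have dec: "fst (f (Suc n + m)) \<subseteq> fst (f n) - {snd (f n)}" for n m
    by (induction m) (use f(2) in \<open>auto simp: R_def\<close>)
  have "snd (f i) \<noteq> snd (f j)" if "i < j" for i j
    using dec[of i "j - Suc i"] that f(1)[of j] by (auto simp: P_def)
  then have "inj (\<lambda>n. snd (f n))"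
    by (metis linorder_neqE_nat injI)
  then have "is_ray (\<lambda>n. snd (f n))" using f(2) by (auto simp: is_ray_def R_def)
  moreover have "range (\<lambda>n. snd (f n)) \<subseteq> X" using f(1) by (auto simp: P_def)
  ultimately show False using assms by blast
qed

text \<open>The path-free form of the star--comb lemma: no comb fits into a rayless set.\<close>

lemma ranked_star:
  assumes "ranked X" "finite (nb X)" "infinite (X \<inter> A)"
  shows "\<exists>T \<D>. finite T \<and> infinite \<D> \<and>
    (\<forall>D\<in>\<D>. conn D \<and> nb D = T \<and> D \<subseteq> X \<and> finite (D \<inter> A) \<and> D \<inter> A \<noteq> {})"
  using assms
proof (induction rule: ranked.induct)
  case (1 S X)
  have fin: "finite (nb (component (X - S) x))" if "x \<in> X - S" for x
    using finite_subset[OF nb_component_subset[OF that]] 1 by simp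
  show ?case
  proof (cases "\<exists>x\<in>X - S. infinite (component (X - S) x \<inter> A)")
    case True
    then obtain x where x: "x \<in> X - S" "infinite (component (X - S) x \<inter> A)" by auto
    from 1(3)[OF x(1) fin[OF x(1)] x(2)] obtain T \<D> where "finite T" "infinite \<D>"
      "\<forall>D\<in>\<D>. conn D \<and> nb D = T \<and> D \<subseteq> component (X - S) x \<and> finite (D \<inter> A) \<and> D \<inter> A \<noteq> {}"
      by auto
    then show ?thesis
      using component_subset[OF x(1)] by (intro exI[of _ T] exI[of _ \<D>]) blast
  next
    case False
    \<comment> \<open>Each component now holds finitely many points of \<open>A\<close>, so
      infinitely many components meet \<open>A\<close>. Their boundaries are subsets of the finite
      set \<open>S \<union> nb X\<close>, and infinitely many coincide.\<close>
    let ?c = "component (X - S)"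
    define \<D>0 where "\<D>0 = ?c ` ((X - S) \<inter> A)"
    have "(X - S) \<inter> A \<subseteq> (\<Union>D\<in>\<D>0. D \<inter> A)" using component_self by (auto simp: \<D>0_def)
    moreover have "infinite ((X - S) \<inter> A)"
    proof -
      have "X \<inter> A \<subseteq> ((X - S) \<inter> A) \<union> S" by auto
      then show ?thesis using 1 by (meson finite_UnI finite_subset)
    qed
    moreover have "finite (\<Union>D\<in>\<D>0. D \<inter> A)" if "finite \<D>0"
      using that False by (intro finite_UN_I) (auto simp: \<D>0_def)
    ultimately have inf: "infinite \<D>0" by (meson finite_subset)
    have "nb ` \<D>0 \<subseteq> Pow (S \<union> nb X)" using nb_component_subset by (auto simp: \<D>0_def)
    then have "finite (nb ` \<D>0)" using 1 by (meson finite_Pow_iff finite_UnI finite_subset)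
    from pigeonhole_infinite[OF inf this] obtain D0 where D0: "D0 \<in> \<D>0" "infinite {D\<in>\<D>0. nb D = nb D0}"
      by auto
    have "finite (nb D0)" using D0 fin by (auto simp: \<D>0_def)
    moreover have "conn D \<and> D \<subseteq> X \<and> finite (D \<inter> A) \<and> D \<inter> A \<noteq> {}" if DD: "D \<in> \<D>0" for D
    proof -
      obtain x where "x \<in> X - S" "x \<in> A" "D = ?c x" using DD unfolding \<D>0_def by blast
      then show ?thesis using False conn_component component_subset[of x "X - S"] component_self[of x "X - S"] by auto
    qed
    ultimately show ?thesis using D0 by (intro exI[of _ "nb D0"] exI[of _ "{D\<in>\<D>0. nb D = nb D0}"]) auto
  qed
qed

section \<open>Automorphisms\<close>

definition autos :: "('a \<Rightarrow> 'a) set" where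
  "autos = {g. bij g \<and> (\<forall>x y. adj (g x) (g y) \<longleftrightarrow> adj x y) \<and> (\<forall>x. x \<notin> V \<longrightarrow> g x = x)}"

lemma autos_bij: "g \<in> autos \<Longrightarrow> bij g"
  and autos_adj: "g \<in> autos \<Longrightarrow> adj (g x) (g y) \<longleftrightarrow> adj x y"
  and autos_outside: "g \<in> autos \<Longrightarrow> x \<notin> V \<Longrightarrow> g x = x"
  by (auto simp: autos_def)

lemma autos_inj: "g \<in> autos \<Longrightarrow> g x = g y \<longleftrightarrow> x = y"
  using autos_bij bij_is_inj inj_eq by metis

lemma autos_inv: "g \<in> autos \<Longrightarrow> g (inv g x) = x" "g \<in> autos \<Longrightarrow> inv g (g x) = x"
  using autos_bij bij_is_inj bij_is_surj surj_f_inv_f inv_f_f by metis+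

lemma id_autos: "id \<in> autos"
  by (auto simp: autos_def)

lemma comp_autos: "g \<in> autos \<Longrightarrow> h \<in> autos \<Longrightarrow> g \<circ> h \<in> autos"
  by (auto simp: autos_def bij_comp)

lemma inv_autos:
  assumes "g \<in> autos" shows "inv g \<in> autos"
  unfolding autos_def
proof (intro CollectI conjI allI impI)
  show "bij (inv g)" using assms autos_bij bij_imp_bij_inv by auto
  show "adj (inv g x) (inv g y) \<longleftrightarrow> adj x y" for x y
    using autos_adj[OF assms, of "inv g x" "inv g y"] autos_inv[OF assms] by auto
  show "inv g x = x" if "x \<notin> V" for x
    using autos_outside[OF assms that] autos_inv(2)[OF assms, of x] by simp
qed

lemma inv_eqI: "g \<in> autos \<Longrightarrow> g x = y \<Longrightarrow> inv g y = x"
  using autos_inv by auto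

lemma mem_image_autos: "g \<in> autos \<Longrightarrow> g x \<in> g ` C \<longleftrightarrow> x \<in> C"
  using autos_inj by (auto simp: image_iff)

lemma image_inv_autos: "g \<in> autos \<Longrightarrow> g ` (inv g ` C) = C" "g \<in> autos \<Longrightarrow> inv g ` (g ` C) = C"
  by (auto simp: image_image autos_inv)

lemma image_autos_subset_iff: "g \<in> autos \<Longrightarrow> g ` C \<subseteq> D \<longleftrightarrow> C \<subseteq> inv g ` D"
  using image_inv_autos image_mono by metis

lemma image_Int_autos: "g \<in> autos \<Longrightarrow> g ` (C \<inter> D) = g ` C \<inter> g ` D"
  using autos_bij bij_is_inj image_Int by blast

lemma nb_image:
  assumes g: "g \<in> autos" shows "nb (g ` C) = g ` nb C"
proof (intro equalityI subsetI)
  fix v assume "v \<in> nb (g ` C)"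
  then obtain c where c: "v \<notin> g ` C" "c \<in> C" "adj v (g c)" by (auto simp: nb_def)
  have v: "v = g (inv g v)" using autos_inv[OF g] by simp
  have "inv g v \<notin> C" using c(1) v by (metis imageI)
  moreover have "adj (inv g v) c" using c(3) v autos_adj[OF g] by metis
  ultimately show "v \<in> g ` nb C" using c(2) v nbI by (metis imageI)
next
  fix v assume "v \<in> g ` nb C"
  then obtain w c where "v = g w" "w \<notin> C" "c \<in> C" "adj w c" by (auto simp: nb_def)
  then show "v \<in> nb (g ` C)"
    using mem_image_autos[OF g] autos_adj[OF g] by (intro nbI[of _ _ "g c"]) auto
qed

lemma conn_image:
  assumes g: "g \<in> autos" and C: "conn C" shows "conn (g ` C)"
  unfolding conn_def
proof (intro allI impI)
  fix D assume "nb D \<inter> g ` C = {}"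
  then have "nb (inv g ` D) \<inter> C = {}"
    using nb_image[OF inv_autos[OF g], of D] image_Int_autos[OF inv_autos[OF g], of "nb D" "g ` C"]
      image_inv_autos[OF g] by auto
  then have "C \<subseteq> inv g ` D \<or> C \<inter> inv g ` D = {}" using C by (auto simp: conn_def)
  then show "g ` C \<subseteq> D \<or> g ` C \<inter> D = {}"
  proof
    assume "C \<subseteq> inv g ` D"
    then show ?thesis using image_autos_subset_iff[OF g] by simp
  next
    assume "C \<inter> inv g ` D = {}"
    then have "g ` C \<inter> D = {}"
      using image_Int_autos[OF g, of C "inv g ` D"] image_inv_autos(1)[OF g, of D] by simp
    then show ?thesis ..
  qed
qed

lemma component_image:
  assumes g: "g \<in> autos" and Y: "g ` Y = Y" and x: "x \<in> Y"
  shows "g ` component Y x = component Y (g x)"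
proof (rule conn_eqI)
  have gx: "g x \<in> Y" using x Y by blast
  have sub: "g ` component Y x \<subseteq> Y" using component_subset[OF x] Y by blast
  show "conn (g ` component Y x)" using conn_image[OF g conn_component[OF x]] .
  show "conn (component Y (g x))" using conn_component[OF gx] .
  have "nb (g ` component Y x) \<inter> Y = {}"
    using nb_image[OF g] image_Int_autos[OF g, of "nb (component Y x)" Y] Y nb_component[of Y x] by auto
  then show "nb (g ` component Y x) \<inter> component Y (g x) = {}" using component_subset[OF gx] by blast
  show "nb (component Y (g x)) \<inter> g ` component Y x = {}" using nb_component[of Y "g x"] sub by blast
  show "g x \<in> g ` component Y x" "g x \<in> component Y (g x)" using component_self by auto
qed

section \<open>Infinite products of automorphisms\<close>

text \<open>The new factor acts first. If the later factors fix a vertex, the value there no longer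
  changes with \<open>n\<close>, which makes the infinite product meaningful.\<close>

fun pprod :: "(nat \<Rightarrow> 'a \<Rightarrow> 'a) \<Rightarrow> nat set \<Rightarrow> nat \<Rightarrow> 'a \<Rightarrow> 'a" where
  "pprod u I 0 = id"
| "pprod u I (Suc n) = pprod u I n \<circ> (if n \<in> I then u n else id)"

lemma pprod_autos: "(\<And>n. u n \<in> autos) \<Longrightarrow> pprod u I n \<in> autos"
  by (induction n) (auto simp: id_autos comp_autos simp del: comp_apply)

lemma pprod_cong: "(\<And>m. m < n \<Longrightarrow> m \<in> I \<longleftrightarrow> m \<in> J) \<Longrightarrow> pprod u I n = pprod u J n"
  by (induction n) auto

text \<open>\<open>h I\<close> is the infinite product of the \<open>u n\<close> with
  \<open>n\<close> in \<open>I\<close>; on \<open>W n\<close> it agrees with the partial product of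
  length \<open>n\<close>. Injectivity and preservation of edges concern two vertices at a time and
  pass to the limit. Surjectivity may get lost in the limit: \<open>pull\<close> keeps the preimages
  of \<open>B n\<close> inside \<open>W n\<close>, where the product has already settled. Two index
  sets are told apart at their first difference \<open>n\<close> by the vertex from
  \<open>moves\<close>.\<close>

lemma continuum_many_autos:
  assumes u: "\<And>n. u n \<in> autos"
    and mono: "\<And>n. W n \<subseteq> W (Suc n)" and exh: "\<And>x. \<exists>n. x \<in> W n"
    and fixes_W: "\<And>n x. x \<in> W n \<Longrightarrow> u n x = x"
    and moves: "\<And>n. \<exists>x\<in>W (Suc n). u n x \<noteq> x"
    and exh': "\<And>x. \<exists>n. x \<in> B n"
    and pull: "\<And>I n x. x \<in> B n \<Longrightarrow> inv (pprod u I n) x \<in> W n"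
  shows "(UNIV :: nat set set) \<lesssim> autos"
proof -
  have W: "W m \<subseteq> W n" if "m \<le> n" for m n
    using mono that by (rule lift_Suc_mono_le)
  define h where "h I x = pprod u I (LEAST n. x \<in> W n) x" for I x
  have stable: "pprod u I n x = pprod u I m x" if "x \<in> W m" "m \<le> n" for I x m n
    using that(2)
  proof (induction rule: dec_induct)
    case (step n)
    then show ?case using fixes_W[of x n] W[of m n] that(1) by auto
  qed auto
  have h: "h I x = pprod u I n x" if "x \<in> W n" for I x n
    unfolding h_def using stable[of x "LEAST n. x \<in> W n" n I] LeastI[of "\<lambda>n. x \<in> W n" n] Least_le[of "\<lambda>n. x \<in> W n" n] that
    by simp
  have both: "\<exists>n. x \<in> W n \<and> y \<in> W n" for x y
  proof -
    obtain m n where "x \<in> W m" "y \<in> W n" using exh by blast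
    then show ?thesis using W[of m "max m n"] W[of n "max m n"] by (intro exI[of _ "max m n"]) auto
  qed
  note p = pprod_autos[of u, OF u]
  have "h I \<in> autos" for I
    unfolding autos_def
  proof (intro CollectI conjI allI impI bijI)
    show "inj (h I)"
    proof (rule injI)
      fix x y assume "h I x = h I y"
      moreover obtain n where "x \<in> W n" "y \<in> W n" using both by blast
      ultimately show "x = y" using h[of x n] h[of y n] autos_inj[OF p[of I n]] by simp
    qed
    show "surj (h I)"
    proof (rule surjI)
      fix y
      define n where "n = (LEAST n. y \<in> B n)"
      have "y \<in> B n" unfolding n_def by (rule LeastI_ex) (rule exh')
      then have "h I (inv (pprod u I n) y) = pprod u I n (inv (pprod u I n) y)" by (intro h pull)
      then show "h I (inv (pprod u I (LEAST n. y \<in> B n)) y) = y" unfolding n_def[symmetric] autos_inv(1)[OF p] .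
    qed
    show "adj (h I x) (h I y) \<longleftrightarrow> adj x y" for x y
    proof -
      obtain n where "x \<in> W n" "y \<in> W n" using both by blast
      then show ?thesis using h autos_adj[OF p] by simp
    qed
    show "h I x = x" if "x \<notin> V" for x
      unfolding h_def using autos_outside[OF p that] by simp
  qed
  moreover have "inj h"
  proof (rule injI, rule ccontr)
    fix I J assume eq: "h I = h J" and "I \<noteq> J"
    define n where "n = (LEAST n. (n \<in> I) \<noteq> (n \<in> J))"
    have n: "(n \<in> I) \<noteq> (n \<in> J)"
    proof -
      have "\<exists>n. (n \<in> I) \<noteq> (n \<in> J)" using \<open>I \<noteq> J\<close> by blast
      then show ?thesis unfolding n_def by (rule LeastI_ex)
    qed
    have less: "m \<in> I \<longleftrightarrow> m \<in> J" if "m < n" for m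
      using not_less_Least[of m "\<lambda>n. (n \<in> I) \<noteq> (n \<in> J)"] that unfolding n_def by blast
    obtain x where x: "x \<in> W (Suc n)" "u n x \<noteq> x" using moves by blast
    have "pprod u I (Suc n) x = pprod u J (Suc n) x" using eq h[OF x(1), of I] h[OF x(1), of J] by simp
    then have "u n x = x"
      using n pprod_cong[of n I J u, OF less] autos_inj[OF p[of J n]] by (auto split: if_splits)
    then show False using x by simp
  qed
  ultimately show ?thesis by (auto simp: lepoll_def)
qed

text \<open>No compatibility with edges is needed here: the infinite products agree on any two vertices with a finite product.\<close>

lemma disjoint_supports_continuum:
  fixes u :: "nat \<Rightarrow> 'a \<Rightarrow> 'a"
  assumes u: "\<And>n. u n \<in> autos" and nontriv: "\<And>n. u n \<noteq> id"
    and disj: "\<And>m n x. m \<noteq> n \<Longrightarrow> u m x \<noteq> x \<Longrightarrow> u n x = x"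
  shows "(UNIV :: nat set set) \<lesssim> autos"
proof -
  define W where "W n = {x. \<forall>m\<ge>n. u m x = x}" for n
  have fixp: "pprod u I n x = x" if "\<And>m. m < n \<Longrightarrow> u m x = x" for I n x
    using that by (induction n) auto
  show ?thesis
  proof (rule continuum_many_autos[of u W W])
    show "W n \<subseteq> W (Suc n)" for n by (auto simp: W_def)
    show "\<exists>n. x \<in> W n" for x
    proof (cases "\<exists>m. u m x \<noteq> x")
      case True
      then obtain m where "u m x \<noteq> x" by auto
      then have "x \<in> W (Suc m)" using disj[of m _ x] by (auto simp: W_def)
      then show ?thesis by auto
    qed (auto simp: W_def)
    then show "\<exists>n. x \<in> W n" for x .
    show "\<exists>x\<in>W (Suc n). u n x \<noteq> x" for n
    proof -
      obtain x where "u n x \<noteq> x" using nontriv[of n] by (auto simp: fun_eq_iff)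
      moreover have "x \<in> W (Suc n)" using disj[of n _ x] \<open>u n x \<noteq> x\<close> by (auto simp: W_def)
      ultimately show ?thesis by auto
    qed
    \<comment> \<open>A preimage outside \<open>W n\<close> is moved by some \<open>u m\<close> with
      \<open>m \<ge> n\<close>, hence by none of the factors before \<open>n\<close>. So the product
      fixes it, and it is \<open>x\<close> itself.\<close>
    show "inv (pprod u I n) x \<in> W n" if x: "x \<in> W n" for I n x
    proof (rule ccontr)
      note p = pprod_autos[of u I n, OF u]
      let ?y = "inv (pprod u I n) x"
      assume "?y \<notin> W n"
      then obtain m where m: "m \<ge> n" "u m ?y \<noteq> ?y" by (auto simp: W_def)
      then have "pprod u I n ?y = ?y" using disj[of m _ ?y] by (intro fixp) auto
      then have "?y = x" using autos_inv(1)[OF p, of x] by simp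
      then show False using m x by (auto simp: W_def)
    qed
  qed (use u in \<open>auto simp: W_def\<close>)
qed

section \<open>Local modifications of automorphisms\<close>

text \<open>Edges between \<open>D\<close> and the rest end in \<open>nb D\<close>, where
  \<open>g\<close> is the identity. The same argument for \<open>inv g\<close> gives the converse
  direction, which is why \<open>pres\<close> quantifies over \<open>g\<close> again.\<close>

lemma restrict_autos:
  assumes g: "g \<in> autos" and D: "g ` D = D" and fixes_nb: "\<And>x. x \<in> nb D \<Longrightarrow> g x = x"
  shows "(\<lambda>x. if x \<in> D then g x else x) \<in> autos"
proof -
  have pres: "adj (if x \<in> D then g x else x) (if y \<in> D then g y else y)"
    if "adj x y" "g \<in> autos" "g ` D = D" "\<And>x. x \<in> nb D \<Longrightarrow> g x = x" for x y g
  proof -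
    have "adj (g x) (g y)" using that autos_adj by auto
    moreover have "g y = y" if "x \<in> D" "y \<notin> D"
      using \<open>adj x y\<close> adj_sym that by (intro \<open>\<And>x. x \<in> nb D \<Longrightarrow> g x = x\<close> nbI) auto
    moreover have "g x = x" if "x \<notin> D" "y \<in> D"
      using \<open>adj x y\<close> that by (intro \<open>\<And>x. x \<in> nb D \<Longrightarrow> g x = x\<close> nbI) auto
    ultimately show ?thesis using \<open>adj x y\<close> by auto
  qed
  let ?r = "\<lambda>g x. if x \<in> D then g x else x"
  have D': "inv g ` D = D" using image_inv_autos(2)[OF g, of D] D by simp
  have mem: "g x \<in> D" "inv g x \<in> D" if "x \<in> D" for x using D D' that by blast+
  have inv1: "?r g (?r (inv g) x) = x" "?r (inv g) (?r g x) = x" for x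
    using mem autos_inv[OF g] by auto
  have fix': "inv g x = x" if "x \<in> nb D" for x
    using fixes_nb[OF that] inv_eqI[OF g, of x x] by simp
  show ?thesis
    unfolding autos_def
  proof (intro CollectI conjI allI impI)
    show "bij (?r g)" using inv1 by (intro o_bij[of "?r (inv g)"]) (auto simp: fun_eq_iff)
    show "adj (?r g x) (?r g y) \<longleftrightarrow> adj x y" for x y
    proof
      assume "adj x y"
      then show "adj (?r g x) (?r g y)" by (rule pres[OF _ g D fixes_nb])
    next
      assume "adj (?r g x) (?r g y)"
      then have "adj (?r (inv g) (?r g x)) (?r (inv g) (?r g y))" by (rule pres[OF _ inv_autos[OF g] D' fix'])
      then show "adj x y" unfolding inv1(2) .
    qed
    show "?r g x = x" if "x \<notin> V" for x using autos_outside[OF g that] by simp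
  qed
qed

definition swap :: "('a \<Rightarrow> 'a) \<Rightarrow> 'a set \<Rightarrow> 'a \<Rightarrow> 'a" where
  "swap h D x = (if x \<in> D then h x else if x \<in> h ` D then inv h x else x)"

text \<open>\<open>D\<close> and its image under \<open>h\<close> have the same boundary, fixed
  pointwise by \<open>h\<close>, so edges leaving either set are respected. Since
  \<open>swap h D\<close> is an involution, one direction of adjacency is enough.\<close>

lemma swap_autos:
  assumes h: "h \<in> autos" and disj: "D \<inter> h ` D = {}" and fixes_nb: "\<And>x. x \<in> nb D \<Longrightarrow> h x = x"
  shows "swap h D \<in> autos"
proof -
  have nb': "nb (h ` D) = nb D" using nb_image[OF h, of D] fixes_nb by auto
  have inD: "swap h D x = h x" "h x \<in> h ` D" if "x \<in> D" for x using that by (auto simp: swap_def)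
  have inhD: "swap h D (h x) = x" if "x \<in> D" for x
    using that disj autos_inv[OF h] by (auto simp: swap_def)
  have out: "swap h D x = x" if "x \<notin> D" "x \<notin> h ` D" for x using that by (auto simp: swap_def)
  have invol: "swap h D (swap h D x) = x" for x
    using inD inhD out by (cases "x \<in> D"; cases "x \<in> h ` D") auto
  have pres: "adj (swap h D x) (swap h D y)" if a: "adj x y" for x y
  proof -
    have *: "adj (swap h D x) (swap h D y)" if a: "adj x y" and x: "x \<in> D" for x y
    proof -
      have "y \<in> D \<or> y \<in> nb D" using a x adj_sym by (auto simp: nb_def)
      moreover have "y \<notin> h ` D" if "y \<in> nb D" using that nb' nb_disjoint[of "h ` D"] by auto
      moreover have "y \<notin> D" if "y \<in> nb D" using that nb_disjoint[of D] by auto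
      moreover have "adj (h x) (h y)" using a autos_adj[OF h] by simp
      ultimately show ?thesis using inD[OF x] inD[of y] out fixes_nb by metis
    qed
    have **: "adj (swap h D x) (swap h D y)" if a: "adj x y" and x: "x \<in> h ` D" for x y
    proof -
      obtain z where z: "z \<in> D" "x = h z" using x by auto
      have "y \<in> h ` D \<or> y \<in> nb (h ` D)" using a x adj_sym unfolding nb_def by blast
      then have "y \<in> h ` D \<or> y \<in> nb D" using nb' by simp
      then obtain w where w: "y = h w" "w \<in> D \<or> w \<in> nb D \<and> h w = w" using fixes_nb by force
      then have "adj z w" using a z autos_adj[OF h] by simp
      moreover have "w \<notin> D \<and> w \<notin> h ` D" if "w \<in> nb D"
        using that nb' nb_disjoint[of "h ` D"] nb_disjoint[of D] by auto
      ultimately show ?thesis using w z inhD out by metis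
    qed
    show ?thesis
      using a *[of x y] *[of y x] **[of x y] **[of y x] out[of x] out[of y] adj_sym by metis
  qed
  show ?thesis
    unfolding autos_def
  proof (intro CollectI conjI allI impI)
    show "bij (swap h D)" using invol by (intro o_bij[of "swap h D"]) (auto simp: fun_eq_iff)
    show "adj (swap h D x) (swap h D y) \<longleftrightarrow> adj x y" for x y
      using pres invol by metis
    show "swap h D x = x" if "x \<notin> V" for x
      using autos_outside[OF h that] autos_outside[OF inv_autos[OF h] that] by (auto simp: swap_def)
  qed
qed

lemma swap_neq_id:
  assumes "D \<inter> h ` D = {}" "x \<in> D" shows "swap h D \<noteq> id"
proof -
  have "swap h D x \<noteq> x" using assms unfolding swap_def by (metis disjoint_iff imageI)
  then show ?thesis by (metis id_apply)
qed

text \<open>By \<open>disjoint_supports_continuum\<close>, only finitely many components admit a nontrivial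
  automorphism or can be exchanged with another one.\<close>

lemma ranked_base:
  assumes few: "\<not> (UNIV :: nat set set) \<lesssim> autos" and "ranked X" "finite (nb X)"
  shows "\<exists>F. finite F \<and> (\<forall>g\<in>autos. (\<forall>x. x \<notin> X \<longrightarrow> g x = x) \<longrightarrow> (\<forall>x\<in>F. g x = x) \<longrightarrow> g = id)"
  using assms(2,3)
proof (induction rule: ranked.induct)
  case (1 S X)
  let ?c = "component (X - S)"
  define CC where "CC = ?c ` (X - S)"
  have CC: "\<exists>x\<in>X - S. D = ?c x" if "D \<in> CC" for D using that unfolding CC_def by blast
  have fin: "finite (nb (?c x))" if "x \<in> X - S" for x
    using finite_subset[OF nb_component_subset[OF that]] 1 by simp
  have "\<exists>F. \<forall>D\<in>CC. finite (F D) \<and>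
    (\<forall>g\<in>autos. (\<forall>x. x \<notin> D \<longrightarrow> g x = x) \<longrightarrow> (\<forall>x\<in>F D. g x = x) \<longrightarrow> g = id)"
  proof (intro bchoice ballI)
    fix D assume "D \<in> CC"
    then obtain x where x: "x \<in> X - S" "D = ?c x" using CC by blast
    show "\<exists>F. finite F \<and> (\<forall>g\<in>autos. (\<forall>x. x \<notin> D \<longrightarrow> g x = x) \<longrightarrow> (\<forall>x\<in>F. g x = x) \<longrightarrow> g = id)"
      unfolding x(2) by (rule 1(3)[OF x(1) fin[OF x(1)]])
  qed
  then obtain F where F0: "\<forall>D\<in>CC. finite (F D) \<and>
    (\<forall>g\<in>autos. (\<forall>x. x \<notin> D \<longrightarrow> g x = x) \<longrightarrow> (\<forall>x\<in>F D. g x = x) \<longrightarrow> g = id)" ..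
  have F: "finite (F D)" if "D \<in> CC" for D using F0 that by auto
  have F2: "g = id" if "D \<in> CC" "g \<in> autos" "\<And>x. x \<notin> D \<Longrightarrow> g x = x" "\<And>x. x \<in> F D \<Longrightarrow> g x = x" for D g
    using bspec[OF conjunct2[OF bspec[OF F0 that(1)]] that(2)] that(3,4) by blast
  have disj: "D \<inter> D' = {}" if DD: "D \<in> CC" "D' \<in> CC" "D \<noteq> D'" for D D'
  proof (rule ccontr)
    assume "D \<inter> D' \<noteq> {}"
    then obtain y where "y \<in> D" "y \<in> D'" by auto
    moreover obtain x x' where "x \<in> X - S" "x' \<in> X - S" "D = ?c x" "D' = ?c x'" using CC DD(1,2) by meson
    ultimately show False using component_eq[of x "X - S" y] component_eq[of x' "X - S" y] DD(3) by simp
  qed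
  \<comment> \<open>The choice \<open>D = D'\<close> is included, so outside \<open>R\<close> both
    automorphisms of a single component and exchanges of two components are excluded.\<close>
  have "\<exists>R. finite R \<and> R \<subseteq> CC \<and> (\<forall>D\<in>CC - R. \<forall>D'\<in>CC - R. \<forall>u\<in>autos. (\<forall>x. x \<notin> D \<union> D' \<longrightarrow> u x = x) \<longrightarrow> u = id)"
  proof (rule ccontr)
    assume "\<not> ?thesis"
    then have ex: "\<exists>D\<in>CC - R. \<exists>D'\<in>CC - R. \<exists>u\<in>autos. (\<forall>x. x \<notin> D \<union> D' \<longrightarrow> u x = x) \<and> u \<noteq> id"
      if "finite R" "R \<subseteq> CC" for R using that by simp
    \<comment> \<open>A state consists of the components used so far and an automorphism supported
      in them. By \<open>Q\<close> the next automorphism is trivial on all of these components, so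
      the supports become pairwise disjoint.\<close>
    define P where "P = (\<lambda>p. finite (fst p) \<and> fst p \<subseteq> CC \<and> snd p \<in> autos \<and> snd p \<noteq> id \<and>
      (\<forall>x. x \<notin> \<Union>(fst p) \<longrightarrow> snd p x = x))"
    define Q :: "'a set set \<times> ('a \<Rightarrow> 'a) \<Rightarrow> 'a set set \<times> ('a \<Rightarrow> 'a) \<Rightarrow> bool"
      where "Q = (\<lambda>p q. fst p \<subseteq> fst q \<and> (\<forall>x\<in>\<Union>(fst p). snd q x = x))"
    have "\<exists>f. \<forall>n. P (f n) \<and> Q (f n) (f (Suc n))"
    proof (rule dependent_nat_choice)
      show "\<exists>p. P p"
      proof -
        obtain D D' u where "D \<in> CC" "D' \<in> CC" "u \<in> autos" "\<And>x. x \<notin> D \<union> D' \<Longrightarrow> u x = x" "u \<noteq> id"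
          using ex[of "{}"] by auto
        then have "P ({D, D'}, u)" unfolding P_def by simp
        then show ?thesis ..
      qed
    next
      fix p n assume p: "P p"
      obtain D D' u where u: "D \<in> CC - fst p" "D' \<in> CC - fst p" "u \<in> autos" "\<And>x. x \<notin> D \<union> D' \<Longrightarrow> u x = x" "u \<noteq> id"
        using ex[of "fst p"] p unfolding P_def by auto
      have "u x = x" if x: "x \<in> E" "E \<in> fst p" for x E
      proof -
        have "E \<in> CC" "E \<noteq> D" "E \<noteq> D'" using x u p unfolding P_def by auto
        then show ?thesis using disj[of E D] disj[of E D'] u x by blast
      qed
      then have "P (insert D (insert D' (fst p)), u) \<and> Q p (insert D (insert D' (fst p)), u)"
        using u p unfolding P_def Q_def by auto
      then show "\<exists>q. P q \<and> Q p q" by blast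
    qed
    then obtain f where f: "\<And>n. P (f n)" "\<And>n. Q (f n) (f (Suc n))" by blast
    have mono: "fst (f m) \<subseteq> fst (f n)" if "m \<le> n" for m n
      using that by (rule lift_Suc_mono_le[rotated]) (use f(2) in \<open>simp add: Q_def\<close>)
    have less: "snd (f n) x = x" if "m < n" "snd (f m) x \<noteq> x" for m n x
    proof -
      have mn: "m \<le> n - 1" using that(1) by simp
      have "x \<in> \<Union>(fst (f m))" using f(1)[of m] that unfolding P_def by blast
      then have "x \<in> \<Union>(fst (f (n - 1)))" using Union_mono[OF mono[OF mn]] by blast
      then show ?thesis using f(2)[of "n - 1"] that unfolding Q_def by auto
    qed
    have "(UNIV :: nat set set) \<lesssim> autos"
    proof (rule disjoint_supports_continuum[of "\<lambda>n. snd (f n)"])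
      show "snd (f n) x = x" if "m \<noteq> n" "snd (f m) x \<noteq> x" for m n x
        using less[of m n x] less[of n m x] that by (cases m n rule: linorder_cases) auto
    qed (use f(1) in \<open>auto simp: P_def\<close>)
    then show False using few by simp
  qed
  then obtain R where R: "finite R" "R \<subseteq> CC"
    "\<forall>D\<in>CC - R. \<forall>D'\<in>CC - R. \<forall>u\<in>autos. (\<forall>x. x \<notin> D \<union> D' \<longrightarrow> u x = x) \<longrightarrow> u = id"
    by auto
  have R3: "u = id" if "D \<in> CC - R" "D' \<in> CC - R" "u \<in> autos" "\<And>x. x \<notin> D \<union> D' \<Longrightarrow> u x = x" for D D' u
    using bspec[OF bspec[OF bspec[OF R(3) that(1)] that(2)] that(3)] that(4) by blast
  define pt where "pt D = (SOME x. x \<in> D)" for D :: "'a set"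
  have pt: "pt D \<in> D" if "D \<in> CC" for D
    using CC[OF that] component_self unfolding pt_def by (metis (mono_tags, lifting) someI_ex)
  \<comment> \<open>Fixing \<open>S\<close> makes \<open>g\<close> permute the components, the
    points \<open>pt D\<close> keep exceptional components in place, and \<open>F D\<close> controls
    \<open>g\<close> inside them.\<close>
  define F' where "F' = S \<union> pt ` R \<union> (\<Union>D\<in>R. F D)"
  have "finite F'" using 1(1) R(1,2) F by (auto simp: F'_def)
  moreover have "g = id" if g: "g \<in> autos" "\<forall>x. x \<notin> X \<longrightarrow> g x = x" "\<forall>x\<in>F'. g x = x" for g
  proof -
    have mem: "g x \<in> X \<longleftrightarrow> x \<in> X" for x using g(2) autos_inj[OF g(1)] by metis
    have memS: "g x \<in> S \<longleftrightarrow> x \<in> S" for x using g(3) autos_inj[OF g(1)] by (metis F'_def UnI1)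
    have gXS: "g ` (X - S) = X - S"
    proof (intro equalityI subsetI)
      fix x assume "x \<in> X - S"
      then have "inv g x \<in> X - S" using mem[of "inv g x"] memS[of "inv g x"] autos_inv[OF g(1)] by simp
      then show "x \<in> g ` (X - S)" using autos_inv[OF g(1)] by (metis imageI)
    qed (use mem memS in auto)
    have fixnb: "g x = x" if "x \<in> nb D" "D \<in> CC" for x D
    proof -
      have "x \<in> S \<union> nb X" using that CC nb_component_subset by blast
      then show ?thesis using g(2,3) nb_disjoint[of X] by (auto simp: F'_def)
    qed
    have CCg: "g ` D \<in> CC" if DC: "D \<in> CC" for D
    proof -
      obtain x where x: "x \<in> X - S" "D = ?c x" using CC[OF DC] by blast
      then have "g ` D = ?c (g x)" "g x \<in> X - S" using component_image[OF g(1) gXS] gXS by blast+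
      then show ?thesis unfolding CC_def by blast
    qed
    have fixD: "g x = x" if D: "D \<in> CC" and x: "x \<in> D" for D x
    proof -
      have gD: "g ` D = D"
      proof (rule ccontr)
        assume ne: "g ` D \<noteq> D"
        have d: "D \<inter> g ` D = {}" using disj[OF D CCg[OF D]] ne by auto
        have "E \<notin> R" if "E = D \<or> E = g ` D" for E
        proof
          assume E: "E \<in> R"
          then have "g (pt E) = pt E" using g(3) by (auto simp: F'_def)
          moreover have "pt E \<in> E" using pt E R by auto
          ultimately have "pt E \<in> D \<inter> g ` D" using that mem_image_autos[OF g(1)] by (metis IntI)
          then show False using d by auto
        qed
        then have "swap g D = id"
          using D CCg[OF D] swap_autos[OF g(1) d] fixnb[OF _ D]
          by (intro R3[of D "g ` D"]) (auto simp: swap_def)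
        then show False using swap_neq_id[OF d x] by simp
      qed
      let ?r = "\<lambda>x. if x \<in> D then g x else x"
      have r: "?r \<in> autos" using restrict_autos[OF g(1) gD] fixnb D by auto
      have "?r = id"
      proof (cases "D \<in> R")
        case True
        then show ?thesis using g(3) r by (intro F2[OF D]) (auto simp: F'_def)
      next
        case False
        then show ?thesis using r D by (intro R3[of D D]) auto
      qed
      from fun_cong[OF this, of x] show ?thesis using x by simp
    qed
    show "g = id"
    proof
      fix x
      show "g x = id x"
      proof (cases "x \<in> X - S")
        case True
        then show ?thesis using fixD[of "?c x" x] component_self by (auto simp: CC_def)
      next
        case False
        then show ?thesis using g(2,3) by (auto simp: F'_def)
      qed
    qed
  qed
  ultimately show ?case by blast
qed

section \<open>Orbits inside rayless sets\<close>

lemma infinite_disjoint_avoid: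
  assumes "infinite \<D>" "\<And>D E. D \<in> \<D> \<Longrightarrow> E \<in> \<D> \<Longrightarrow> D \<noteq> E \<Longrightarrow> D \<inter> E = {}" "finite S"
  shows "infinite {D\<in>\<D>. D \<inter> S = {}}"
proof
  assume fin: "finite {D\<in>\<D>. D \<inter> S = {}}"
  have "finite {D\<in>\<D>. x \<in> D}" for x
  proof (cases "\<exists>E\<in>\<D>. x \<in> E")
    case True
    then obtain E where "E \<in> \<D>" "x \<in> E" by blast
    then have "{D\<in>\<D>. x \<in> D} \<subseteq> {E}" using assms(2) by blast
    then show ?thesis by (rule finite_subset) simp
  next
    case False
    then have "{D\<in>\<D>. x \<in> D} = {}" by blast
    then show ?thesis by (simp only: finite.emptyI)
  qed
  then have "finite (\<Union>x\<in>S. {D\<in>\<D>. x \<in> D})" using assms(3) by blast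
  moreover have "\<D> \<subseteq> {D\<in>\<D>. D \<inter> S = {}} \<union> (\<Union>x\<in>S. {D\<in>\<D>. x \<in> D})" by blast
  ultimately show False using fin assms(1) by (meson finite_UnI finite_subset)
qed

lemma same_nb_disjoint:
  assumes "conn D" "conn E" "nb D = T" "nb E = T" "D \<noteq> E" shows "D \<inter> E = {}"
  using assms conn_eqI[of D E] nb_disjoint[of D] nb_disjoint[of E] by auto

lemma image_comp_autos: "(g \<circ> h) ` C = g ` (h ` C)"
  by (simp add: image_comp)

lemma id_eq: "(\<And>x. g x = x) \<Longrightarrow> g = id"
  by (simp add: fun_eq_iff)

text \<open>If the orbit were infinite, infinitely many of the components supplied by \<open>ranked_star\<close>
  would be images of a single set, and two of them could be swapped.\<close>

lemma finite_orbit_in_ranked: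
  assumes F: "finite F" "\<And>g. g \<in> autos \<Longrightarrow> (\<And>x. x \<in> F \<Longrightarrow> g x = x) \<Longrightarrow> g = id"
    and L: "L \<subseteq> autos" "\<And>g h. g \<in> L \<Longrightarrow> h \<in> L \<Longrightarrow> g \<circ> h \<in> L" "\<And>g. g \<in> L \<Longrightarrow> inv g \<in> L"
    and X: "ranked X" "finite (nb X)"
  shows "finite (X \<inter> (\<lambda>g. g x) ` L)"
proof (rule ccontr)
  define A where "A = (\<lambda>g. g x) ` L"
  assume "infinite (X \<inter> (\<lambda>g. g x) ` L)"
  then obtain T \<D> where T: "finite T" and inf: "infinite \<D>"
    and \<D>: "\<And>D. D \<in> \<D> \<Longrightarrow> conn D \<and> nb D = T \<and> D \<subseteq> X \<and> finite (D \<inter> A) \<and> D \<inter> A \<noteq> {}"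
    using ranked_star[OF X, of A] unfolding A_def[symmetric] by auto
  have disj: "D \<inter> E = {}" if "D \<in> \<D>" "E \<in> \<D>" "D \<noteq> E" for D E
    using same_nb_disjoint[of D E T] \<D>[OF that(1)] \<D>[OF that(2)] that(3) by blast
  have uA: "u y \<in> A" if "u \<in> L" "y \<in> A" for u y
  proof -
    obtain g where "g \<in> L" "y = g x" using \<open>y \<in> A\<close> by (auto simp: A_def)
    then have "u y = (u \<circ> g) x" by simp
    moreover have "u \<circ> g \<in> L" using \<open>u \<in> L\<close> \<open>g \<in> L\<close> by (rule L(2))
    ultimately show ?thesis unfolding A_def by blast
  qed
  \<comment> \<open>If \<open>u t\<close> were in \<open>D\<close>, then all but finitely many
    images under \<open>u\<close> of members of \<open>\<D>\<close> would avoid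
    \<open>T = nb D\<close>. Being connected and adjacent to \<open>u t\<close>, they would lie in
    \<open>D\<close>, and their disjoint nonempty traces on \<open>A\<close> would not fit into the
    finite set \<open>D \<inter> A\<close>.\<close>
  have key: "u ` T \<inter> D = {}" if u: "u \<in> L" and D: "D \<in> \<D>" for u D
  proof (rule ccontr)
    assume "u ` T \<inter> D \<noteq> {}"
    then obtain t where t: "t \<in> T" "u t \<in> D" by blast
    have ua: "u \<in> autos" using u L(1) by blast
    have inj: "inj_on (\<lambda>E. u ` E) \<D>"
      by (rule inj_onI) (metis image_inv_autos(2)[OF ua])
    have "infinite ((\<lambda>E. u ` E) ` \<D>)" using inf inj by (simp add: finite_image_iff)
    moreover have dj: "E \<inter> E' = {}" if E: "E \<in> (\<lambda>E. u ` E) ` \<D>" "E' \<in> (\<lambda>E. u ` E) ` \<D>" "E \<noteq> E'" for E E'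
    proof -
      obtain E1 E2 where e: "E1 \<in> \<D>" "E = u ` E1" "E2 \<in> \<D>" "E' = u ` E2" using E by blast
      then have "E1 \<inter> E2 = {}" using E(3) disj by blast
      then show ?thesis using e image_Int_autos[OF ua, of E1 E2] by simp
    qed
    ultimately have inf': "infinite {E\<in>(\<lambda>E. u ` E) ` \<D>. E \<inter> T = {}}"
      using T by (intro infinite_disjoint_avoid)
    have sub: "E \<subseteq> D \<and> E \<inter> A \<noteq> {}" if E: "E \<in> (\<lambda>E. u ` E) ` \<D>" "E \<inter> T = {}" for E
    proof -
      obtain E1 where e: "E1 \<in> \<D>" "E = u ` E1" using E by blast
      have "conn E" using e conn_image[OF ua] \<D>[OF e(1)] by simp
      moreover have "nb D \<inter> E = {}" using E(2) \<D>[OF D] by blast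
      moreover have "u t \<in> nb E" using e t nb_image[OF ua, of E1] \<D>[OF e(1)] by simp
      then obtain y where "y \<in> E" "adj (u t) y" by (auto simp: nb_def)
      then have "y \<in> D" using adj_sym t(2) \<D>[OF D] E(2) nbI[of y D "u t"] by blast
      ultimately have "E \<subseteq> D" using \<open>y \<in> E\<close> connD by blast
      moreover obtain y where "y \<in> E1" "y \<in> A" using \<D>[OF e(1)] by blast
      then have "u y \<in> E \<inter> A" using uA[OF u] e by blast
      ultimately show ?thesis by blast
    qed
    define \<E> where "\<E> = {E\<in>(\<lambda>E. u ` E) ` \<D>. E \<inter> T = {}}"
    have "finite (D \<inter> A)" using \<D>[OF D] by blast
    then have "finite (Pow (D \<inter> A))" by (rule finite_Pow_iff[THEN iffD2])
    moreover have "(\<lambda>E. E \<inter> A) ` \<E> \<subseteq> Pow (D \<inter> A)" using sub unfolding \<E>_def by blast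
    moreover have "inj_on (\<lambda>E. E \<inter> A) \<E>"
    proof (rule inj_onI, rule ccontr)
      fix E E' assume E: "E \<in> \<E>" "E' \<in> \<E>" "E \<inter> A = E' \<inter> A" "E \<noteq> E'"
      have E': "E \<in> (\<lambda>E. u ` E) ` \<D>" "E \<inter> T = {}" "E' \<in> (\<lambda>E. u ` E) ` \<D>"
        using E(1,2) unfolding \<E>_def by simp_all
      have "E \<inter> E' = {}" by (rule dj[OF E'(1,3) E(4)])
      moreover have "E \<inter> A \<noteq> {}" using sub[OF E'(1,2)] ..
      ultimately show False using E(3) by blast
    qed
    ultimately have "finite \<E>" by (meson finite_imageD finite_subset)
    then show False using inf' unfolding \<E>_def by blast
  qed
  have "\<exists>g\<in>L. g x \<in> D" if "D \<in> \<D>" for D using \<D>[OF that] unfolding A_def by blast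
  then obtain g where g: "\<And>D. D \<in> \<D> \<Longrightarrow> g D \<in> L" "\<And>D. D \<in> \<D> \<Longrightarrow> g D x \<in> D" by metis
  have ga: "g D \<in> autos" if "D \<in> \<D>" for D using g(1)[OF that] L(1) by blast
  \<comment> \<open>Every \<open>D\<close> is pulled back to a connected set containing
    \<open>x\<close>. By \<open>key\<close> none of these sets meets the boundary of another, so
    they are all equal.\<close>
  define E where "E D = inv (g D) ` D" for D
  have gE: "g D ` E D = D" if "D \<in> \<D>" for D unfolding E_def by (rule image_inv_autos(1)[OF ga[OF that]])
  have xE: "x \<in> E D" if "D \<in> \<D>" for D
    unfolding E_def using g(2)[OF that] autos_inv(2)[OF ga[OF that], of x] by (metis imageI)
  have cE: "conn (E D)" if "D \<in> \<D>" for D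
    unfolding E_def using conn_image[OF inv_autos[OF ga[OF that]]] \<D>[OF that] by blast
  have nE: "nb (E D) = inv (g D) ` T" if "D \<in> \<D>" for D
    unfolding E_def using nb_image[OF inv_autos[OF ga[OF that]], of D] \<D>[OF that] by simp
  have cross: "nb (E D) \<inter> E D' = {}" if "D \<in> \<D>" "D' \<in> \<D>" for D D'
  proof -
    let ?u = "g D' \<circ> inv (g D)"
    have "?u ` T \<inter> D' = {}" by (rule key[OF L(2)[OF g(1)[OF that(2)] L(3)[OF g(1)[OF that(1)]]] that(2)])
    then have "g D' ` (nb (E D)) \<inter> g D' ` (E D') = {}"
      unfolding nE[OF that(1)] gE[OF that(2)] image_comp_autos .
    then show ?thesis using image_Int_autos[OF ga[OF that(2)], of "nb (E D)" "E D'"] by simp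
  qed
  have Eeq: "E D = E D'" if "D \<in> \<D>" "D' \<in> \<D>" for D D'
    using conn_eqI[OF cE[OF that(1)] cE[OF that(2)] cross[OF that] cross[OF that(2,1)] xE[OF that(1)] xE[OF that(2)]] .
  obtain D0 where D0: "D0 \<in> \<D>" using infinite_imp_nonempty[OF inf] by blast
  define T1 where "T1 = nb (E D0)"
  have gT: "g D ` T1 = T" if "D \<in> \<D>" for D
    unfolding T1_def Eeq[OF D0 that] nE[OF that] by (rule image_inv_autos(1)[OF ga[OF that]])
  have "finite T1" unfolding T1_def nE[OF D0] using T by simp
  then have finPi: "finite (T1 \<rightarrow>\<^sub>E T)" using T by (simp add: finite_PiE)
  \<comment> \<open>Members that avoid \<open>F\<close> are swapped, so that the swap fixes
    \<open>F\<close>. There are finitely many maps from \<open>T1\<close> to \<open>T\<close>, hence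
    two members whose elements \<open>g D\<close> agree on \<open>T1\<close>; then \<open>h\<close>
    fixes the common boundary \<open>T\<close>.\<close>
  define \<D>' where "\<D>' = {D\<in>\<D>. D \<inter> F = {}}"
  have inf': "infinite \<D>'" unfolding \<D>'_def by (rule infinite_disjoint_avoid[OF inf disj F(1)])
  have "(\<lambda>D. restrict (g D) T1) ` \<D>' \<subseteq> (T1 \<rightarrow>\<^sub>E T)"
  proof (rule image_subsetI)
    fix D assume "D \<in> \<D>'"
    then have "g D ` T1 = T" using gT unfolding \<D>'_def by blast
    then show "restrict (g D) T1 \<in> T1 \<rightarrow>\<^sub>E T" by auto
  qed
  then have "\<not> inj_on (\<lambda>D. restrict (g D) T1) \<D>'"
    using finPi inf' by (meson finite_imageD finite_subset)
  then obtain D1 D2 where D12: "D1 \<in> \<D>'" "D2 \<in> \<D>'" "D1 \<noteq> D2" "restrict (g D1) T1 = restrict (g D2) T1"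
    unfolding inj_on_def by blast
  have D: "D1 \<in> \<D>" "D2 \<in> \<D>" "D1 \<inter> F = {}" "D2 \<inter> F = {}" using D12 unfolding \<D>'_def by blast+
  define h where "h = g D2 \<circ> inv (g D1)"
  have h: "h \<in> autos" unfolding h_def using ga D inv_autos comp_autos by blast
  have hD: "h ` D1 = D2"
    unfolding h_def image_comp_autos using gE[OF D(2)] Eeq[OF D(1,2)] unfolding E_def by simp
  have "h t = t" if "t \<in> nb D1" for t
  proof -
    have "t \<in> g D1 ` T1" using gT[OF D(1)] \<D>[OF D(1)] that by simp
    then obtain s where s: "s \<in> T1" "t = g D1 s" by blast
    then have "g D1 s = g D2 s" using D12(4) by (metis restrict_apply')
    then show ?thesis unfolding h_def comp_apply s(2) autos_inv(2)[OF ga[OF D(1)]] by simp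
  qed
  moreover have d: "D1 \<inter> h ` D1 = {}" using hD disj[OF D(1,2) D12(3)] by simp
  ultimately have "swap h D1 \<in> autos" using h by (intro swap_autos)
  moreover have "swap h D1 y = y" if "y \<in> F" for y
    using that D(3,4) hD by (auto simp: swap_def)
  ultimately have "swap h D1 = id" using F(2) by blast
  moreover have "D1 \<noteq> {}" using \<D>[OF D(1)] by blast
  ultimately show False using swap_neq_id[OF d] by blast
qed

end

section \<open>Linkages\<close>

lemma rtrancl_distinct_path:
  assumes "(x, y) \<in> R\<^sup>*"
  shows "\<exists>p. p \<noteq> [] \<and> hd p = x \<and> last p = y \<and> distinct p \<and> successively (\<lambda>a b. (a, b) \<in> R) p"
  using assms
proof (induction rule: rtrancl_induct)
  case base
  then show ?case by (intro exI[of _ "[x]"]) auto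
next
  case (step y z)
  then obtain p where p: "p \<noteq> []" "hd p = x" "last p = y" "distinct p" "successively (\<lambda>a b. (a, b) \<in> R) p"
    by auto
  show ?case
  proof (cases "z \<in> set p")
    case True
    then obtain as bs where "p = as @ z # bs" by (auto simp: in_set_conv_decomp)
    then show ?thesis using p
      by (intro exI[of _ "as @ [z]"]) (auto simp: successively_append_iff hd_append split: if_splits)
  next
    case False
    then show ?thesis using p step(2)
      by (intro exI[of _ "p @ [z]"]) (auto simp: successively_append_iff)
  qed
qed

text \<open>Each vertex of \<open>p\<close> takes over the partner of its successor, the last one
  takes \<open>z\<close>, and the partner of the first is released. The induction starts at the end
  of \<open>p\<close>: once the last vertex \<open>x\<close> has moved to \<open>z\<close>, the
  vertex \<open>s x\<close> is free for the rest.\<close>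

lemma augment_matching:
  assumes "inj_on s L" "p \<noteq> []" "distinct p" "set p \<subseteq> L" "successively (\<lambda>a b. s b \<in> N a) p"
    "z \<notin> s ` L" "z \<in> N (last p)"
  shows "\<exists>s'. inj_on s' L \<and> s' ` L = insert z (s ` L - {s (hd p)}) \<and>
    (\<forall>x. x \<notin> set p \<longrightarrow> s' x = s x) \<and> (\<forall>x\<in>set p. s' x \<in> N x)"
  using assms
proof (induction p arbitrary: s z rule: rev_induct)
  case (snoc x q)
  let ?s = "s(x := z)"
  have x: "x \<in> L" using snoc by auto
  have inj: "inj_on ?s L"
    using snoc(2,7) by (auto simp: inj_on_def)
  have img: "?s ` L = insert z (s ` L - {s x})"
    using snoc(2) x by (auto simp: inj_on_def image_iff)
  show ?case
  proof (cases "q = []")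
    case True
    with inj img show ?thesis
      by (intro exI[of _ ?s] conjI) (use snoc(8) True in \<open>simp_all del: fun_upd_apply add: fun_upd_same fun_upd_other\<close>)
  next
    case False
    have xq: "x \<notin> set q" using snoc by auto
    have "s x \<in> N (last q)" and succ: "successively (\<lambda>a b. s b \<in> N a) q"
      using snoc(6) False by (auto simp: successively_append_iff)
    moreover have "successively (\<lambda>a b. ?s b \<in> N a) q"
      using succ by (rule successively_mono) (use xq in auto)
    moreover have "s x \<notin> ?s ` L" using snoc(7) x img by auto
    moreover have "distinct q" "set q \<subseteq> L" using snoc(4,5) by auto
    ultimately obtain s' where "inj_on s' L \<and> s' ` L = insert (s x) (?s ` L - {?s (hd q)}) \<and>
      (\<forall>y. y \<notin> set q \<longrightarrow> s' y = ?s y) \<and> (\<forall>y\<in>set q. s' y \<in> N y)"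
      using snoc.IH[OF inj False] by blast
    then have s': "inj_on s' L" "s' ` L = insert (s x) (?s ` L - {?s (hd q)})"
      "\<And>y. y \<notin> set q \<Longrightarrow> s' y = ?s y" "\<And>y. y \<in> set q \<Longrightarrow> s' y \<in> N y"
      by blast+
    have h: "hd q \<in> L" "hd q \<noteq> x" using False snoc(5) xq by auto
    then have "s (hd q) \<noteq> s x" using snoc(2) x by (auto simp: inj_on_def)
    moreover have "s (hd q) \<noteq> z" using snoc(7) h by auto
    ultimately have "s' ` L = insert z (s ` L - {s (hd (q @ [x]))})"
      using s'(2) img h x False by auto
    moreover have "s' y = s y" if "y \<notin> set (q @ [x])" for y using s'(3)[of y] that by auto
    moreover have "s' y \<in> N y" if "y \<in> set (q @ [x])" for y
      using s'(3)[of y] s'(4)[of y] that snoc(8) xq by auto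
    ultimately show ?thesis using s'(1) by blast
  qed
qed simp

text \<open>\<open>Y\<close> may be infinite, but fixed points of \<open>s\<close> contribute to
  neither difference. On the finite set of moved points of \<open>Y\<close> it is a count.\<close>

lemma card_image_diff_eq:
  assumes inj: "inj_on s L" and "Y \<subseteq> L" and fin: "finite {x\<in>L. s x \<noteq> x}"
  shows "finite (s ` Y - Y)" "card (s ` Y - Y) = card (Y - s ` Y)"
proof -
  define Z where "Z = {x\<in>Y. s x \<noteq> x}"
  have Z: "finite Z" using fin by (rule rev_finite_subset) (use assms(2) in \<open>auto simp: Z_def\<close>)
  have 1: "s ` Y - Y = s ` Z - Z"
  proof (intro equalityI subsetI)
    fix y assume "y \<in> s ` Z - Z"
    then obtain x where x: "x \<in> Y" "s x \<noteq> x" "y = s x" "y \<notin> Z" by (auto simp: Z_def)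
    have "y \<notin> Y"
    proof
      assume "y \<in> Y"
      then have "s y = y" using x by (auto simp: Z_def)
      then show False using x inj assms(2) \<open>y \<in> Y\<close> by (metis inj_onD subsetD)
    qed
    then show "y \<in> s ` Y - Y" using x by auto
  qed (auto simp: Z_def image_iff)
  have 2: "Y - s ` Y = Z - s ` Z" by (force simp: Z_def image_iff)
  have "card (s ` Z) = card Z" using inj assms(2) by (intro card_image) (auto simp: Z_def inj_on_def)
  then have "card (s ` Z - Z) = card (Z - s ` Z)"
    using Z by (simp add: card_Diff_subset_Int Int_commute)
  then show "finite (s ` Y - Y)" "card (s ` Y - Y) = card (Y - s ` Y)" using 1 2 Z by auto
qed

context sym_rel
begin

text \<open>A Menger theorem. A family of disjoint paths is encoded by its successor function, extended by
  the identity off the paths. This turns it into a matching of \<open>M - B\<close> into \<open>M\<close>, to be changed along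
  alternating paths until it misses \<open>A\<close>.\<close>

lemma linking:
  assumes fin: "finite A" and sub: "A \<subseteq> M"
    and sep: "\<And>Y. Y \<subseteq> M \<Longrightarrow> Y \<inter> B = {} \<Longrightarrow> finite (nb Y \<inter> M) \<Longrightarrow> card A \<le> card ((nb Y \<inter> M) \<union> (A - Y))"
  shows "\<exists>s. inj_on s (M - B) \<and> s ` (M - B) \<subseteq> M - A \<and> finite {x\<in>M - B. s x \<noteq> x} \<and>
    (\<forall>x\<in>M - B. s x = x \<or> adj x (s x))"
proof -
  define L where "L = M - B"
  \<comment> \<open>\<open>s x = x\<close> means that \<open>x\<close> lies on no path. Starting
    from \<open>id\<close>, the number of vertices of \<open>A\<close> that are hit is
    minimised.\<close>
  define good where "good s \<longleftrightarrow> inj_on s L \<and> s ` L \<subseteq> M \<and> finite {x\<in>L. s x \<noteq> x} \<and>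
    (\<forall>x\<in>L. s x = x \<or> adj x (s x))" for s
  have "good id" by (auto simp: good_def L_def)
  then obtain s where s: "good s" and least: "\<And>s'. good s' \<Longrightarrow> card (A \<inter> s ` L) \<le> card (A \<inter> s' ` L)"
    using ex_has_least_nat[of good id "\<lambda>s. card (A \<inter> s ` L)"] by blast
  have "A \<inter> s ` L = {}"
  proof (rule ccontr)
    assume "A \<inter> s ` L \<noteq> {}"
    then obtain x0 where x0: "x0 \<in> L" "s x0 \<in> A" by auto
    define N where "N x = {y\<in>M. y = x \<or> adj x y}" for x
    define R where "R = {(x, y). x \<in> L \<and> y \<in> L \<and> s y \<in> N x}"
    \<comment> \<open>Reachability by alternating paths: a step from \<open>x\<close> to
      \<open>y\<close> means that \<open>x\<close> could take over \<open>s y\<close>. If such a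
      path reaches a free vertex outside \<open>A\<close>, augmenting along it releases
      \<open>s x0\<close> and lowers the number of hits.\<close>
    define Y where "Y = {x. (x0, x) \<in> R\<^sup>*}"
    have YL: "Y \<subseteq> L" unfolding Y_def R_def using x0 by (auto elim: rtranclE)
    have x0Y: "x0 \<in> Y" by (simp add: Y_def)
    have sN: "s x \<in> N x" if "x \<in> L" for x using that s adj_sym unfolding good_def N_def by auto
    show False
    proof (cases "\<exists>x\<in>Y. \<exists>z\<in>N x. z \<notin> s ` L \<and> z \<notin> A")
      case True
      then obtain x z where xz: "x \<in> Y" "z \<in> N x" "z \<notin> s ` L" "z \<notin> A" by auto
      then obtain p where p: "p \<noteq> []" "hd p = x0" "last p = x" "distinct p"
        "successively (\<lambda>a b. (a, b) \<in> R) p"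
        using rtrancl_distinct_path[of x0 x R] by (auto simp: Y_def)
      have succ: "successively (\<lambda>a b. s b \<in> N a) p"
        using p(5) by (rule successively_mono) (auto simp: R_def)
      have pL: "set p \<subseteq> L"
        using p(1,2,5) x0(1)
      proof (induction p rule: rev_induct)
        case (snoc y q)
        then show ?case
          by (cases "q = []") (auto simp: successively_append_iff R_def)
      qed simp
      obtain s' where s': "inj_on s' L" "s' ` L = insert z (s ` L - {s x0})"
        "\<And>y. y \<notin> set p \<Longrightarrow> s' y = s y" "\<And>y. y \<in> set p \<Longrightarrow> s' y \<in> N y"
        using augment_matching[of s L p N z] s p pL succ xz unfolding good_def by auto
      have "finite {y\<in>L. s' y \<noteq> y}"
      proof (rule finite_subset)
        show "{y\<in>L. s' y \<noteq> y} \<subseteq> {y\<in>L. s y \<noteq> y} \<union> set p" using s'(3) by auto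
        show "finite ({y\<in>L. s y \<noteq> y} \<union> set p)" using s by (auto simp: good_def)
      qed
      moreover have "s' y = y \<or> adj y (s' y)" if "y \<in> L" for y
        using that s s'(3,4)[of y] by (cases "y \<in> set p") (auto simp: good_def N_def)
      ultimately have "good s'" using s' s xz(2) by (auto simp: good_def N_def)
      moreover have "A \<inter> s' ` L = (A \<inter> s ` L) - {s x0}" using s'(2) xz by auto
      then have "card (A \<inter> s' ` L) < card (A \<inter> s ` L)"
        using card_Diff1_less[of "A \<inter> s ` L" "s x0"] fin x0 by simp
      ultimately show False using least leD by blast
    next
      case False
      \<comment> \<open>All free vertices within reach of \<open>Y\<close> now lie in
        \<open>A\<close>. Hence \<open>s\<close> maps \<open>Y\<close> onto its closed neighbourhood
        in \<open>M\<close> without \<open>A0\<close>, and \<open>Y\<close> violates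
        \<open>sep\<close>.\<close>
      define A0 where "A0 = A - s ` L"
      have sY: "s ` Y = (Y \<union> nb Y) \<inter> M - A0"
      proof (intro equalityI subsetI)
        fix y assume "y \<in> s ` Y"
        then obtain x where x: "x \<in> Y" "y = s x" by auto
        then have "y \<in> N x" "y \<in> s ` L" using sN YL by auto
        then show "y \<in> (Y \<union> nb Y) \<inter> M - A0" using x adj_sym by (auto simp: N_def A0_def nb_def)
      next
        fix y assume y: "y \<in> (Y \<union> nb Y) \<inter> M - A0"
        then obtain x where x: "x \<in> Y" "y \<in> N x" using adj_sym by (auto simp: N_def nb_def)
        then obtain x1 where x1: "x1 \<in> L" "y = s x1" using y False by (auto simp: A0_def)
        then have "(x, x1) \<in> R" using x YL by (auto simp: R_def)
        then have "x1 \<in> Y" using x by (auto simp: Y_def)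
        then show "y \<in> s ` Y" using x1 by auto
      qed
      have YM: "Y \<subseteq> M" using YL by (auto simp: L_def)
      define P where "P = nb Y \<inter> M - A0"
      have PY: "s ` Y - Y = P" using sY nb_disjoint[of Y] by (auto simp: P_def)
      have YA: "Y - s ` Y = Y \<inter> A0" using sY YM by auto
      have P: "finite P" "card P = card (Y \<inter> A0)"
        using card_image_diff_eq[of s L Y] s YL PY YA by (auto simp: good_def)
      have "finite (nb Y \<inter> M)"
        by (rule finite_subset[of _ "P \<union> A"]) (use P fin in \<open>auto simp: P_def A0_def\<close>)
      then have ge: "card A \<le> card ((nb Y \<inter> M) \<union> (A - Y))"
        using YL YM by (intro sep) (auto simp: L_def)
      have cA: "card A = card (A \<inter> Y) + card (A - Y)"
        using fin by (metis card_Int_Diff)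
      have sx0: "s x0 \<in> s ` Y" "s x0 \<notin> A0" using x0Y x0 by (auto simp: A0_def)
      \<comment> \<open>Strictness comes from \<open>s x0\<close>. If it lies in \<open>Y\<close>,
        it belongs to \<open>A \<inter> Y\<close> but not to \<open>A0\<close>; otherwise it is
        counted both in \<open>P\<close> and in \<open>A - Y\<close>.\<close>
      have "card ((nb Y \<inter> M) \<union> (A - Y)) < card A"
      proof (cases "s x0 \<in> Y")
        case True
        have "(nb Y \<inter> M) \<union> (A - Y) = P \<union> (A - Y)" using nb_disjoint[of Y] by (auto simp: P_def A0_def)
        then have "card ((nb Y \<inter> M) \<union> (A - Y)) \<le> card P + card (A - Y)" by (simp add: card_Un_le)
        moreover have "card (Y \<inter> A0) < card (A \<inter> Y)"
          using True x0 sx0 fin by (intro psubset_card_mono) (auto simp: A0_def)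
        ultimately show ?thesis using P cA by simp
      next
        case False
        then have "s x0 \<in> P" using sx0(1) PY by auto
        have "(nb Y \<inter> M) \<union> (A - Y) = (P - {s x0}) \<union> (A - Y)"
          using False x0 nb_disjoint[of Y] by (auto simp: P_def A0_def)
        then have "card ((nb Y \<inter> M) \<union> (A - Y)) \<le> card (P - {s x0}) + card (A - Y)" by (simp add: card_Un_le)
        moreover have "card (P - {s x0}) < card P" using \<open>s x0 \<in> P\<close> P(1) by (rule card_Diff1_less[rotated])
        moreover have "card (Y \<inter> A0) \<le> card (A \<inter> Y)"
          using fin by (intro card_mono) (auto simp: A0_def)
        ultimately show ?thesis using P cA by simp
      qed
      then show False using ge by simp
    qed
  qed
  moreover have g: "inj_on s L" "s ` L \<subseteq> M" "finite {x\<in>L. s x \<noteq> x}" "\<forall>x\<in>L. s x = x \<or> adj x (s x)"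
    using s unfolding good_def by blast+
  ultimately have "s ` L \<subseteq> M - A" by blast
  with g show ?thesis unfolding L_def by (intro exI conjI)
qed

text \<open>\<open>D\<close> consists of the vertices that \<open>s\<close> moves. All of
  \<open>A\<close> is moved because \<open>s\<close> misses \<open>A\<close>, and by injectivity an
  orbit stays among moved vertices until it reaches \<open>B\<close>. Besides the paths from
  \<open>A\<close>, the set \<open>D\<close> may contain further paths and cycles.\<close>

lemma linkage:
  assumes "finite A" "A \<subseteq> M" "A \<inter> B = {}"
    and "\<And>Y. Y \<subseteq> M \<Longrightarrow> Y \<inter> B = {} \<Longrightarrow> finite (nb Y \<inter> M) \<Longrightarrow> card A \<le> card ((nb Y \<inter> M) \<union> (A - Y))"
  shows "\<exists>D s. finite D \<and> A \<subseteq> D \<and> D \<subseteq> M - B \<and> inj_on s D \<and> s ` D \<subseteq> (D - A) \<union> B \<and> (\<forall>x\<in>D. adj x (s x))"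
proof -
  have "\<exists>s. inj_on s (M - B) \<and> s ` (M - B) \<subseteq> M - A \<and> finite {x\<in>M - B. s x \<noteq> x} \<and>
    (\<forall>x\<in>M - B. s x = x \<or> adj x (s x))"
    by (rule linking) (rule assms; assumption)+
  then obtain s where s0: "inj_on s (M - B) \<and> s ` (M - B) \<subseteq> M - A \<and> finite {x\<in>M - B. s x \<noteq> x} \<and>
    (\<forall>x\<in>M - B. s x = x \<or> adj x (s x))" ..
  then have s: "inj_on s (M - B)" "s ` (M - B) \<subseteq> M - A" "finite {x\<in>M - B. s x \<noteq> x}"
    "\<And>x. x \<in> M - B \<Longrightarrow> s x = x \<or> adj x (s x)"
    by blast+
  define D where "D = {x\<in>M - B. s x \<noteq> x}"
  have "A \<subseteq> D" using assms(2,3) s(2) by (force simp: D_def)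
  moreover have "s x \<in> (D - A) \<union> B" if "x \<in> D" for x
  proof -
    have x: "x \<in> M - B" "s x \<noteq> x" using that by (auto simp: D_def)
    then have "s x \<in> M - A" using s(2) by blast
    moreover have "s (s x) \<noteq> s x" if "s x \<in> M - B" using inj_onD[OF s(1), of "s x" x] x that by auto
    ultimately show ?thesis by (auto simp: D_def)
  qed
  moreover have "inj_on s D" using s(1) by (rule inj_on_subset) (auto simp: D_def)
  moreover have "adj x (s x)" if "x \<in> D" for x using s(4)[of x] that by (auto simp: D_def)
  moreover have "finite D" "D \<subseteq> M - B" using s(3) by (auto simp: D_def)
  ultimately show ?thesis by blast
qed

text \<open>Cancelling \<open>s\<close> in a coincidence of two orbits exhibits a point of
  \<open>A\<close> as an iterate of another point, while \<open>A\<close> misses the image of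
  \<open>s\<close>.\<close>

lemma successor_rays:
  assumes s: "\<And>x. x \<in> D \<Longrightarrow> s x \<in> D" "\<And>x. x \<in> D \<Longrightarrow> adj x (s x)" and inj: "inj_on s D"
    and A: "A \<subseteq> D" "A \<inter> s ` D = {}"
  shows "\<And>a. a \<in> A \<Longrightarrow> is_ray (\<lambda>n. (s ^^ n) a)"
    and "\<And>a b m n. a \<in> A \<Longrightarrow> b \<in> A \<Longrightarrow> (s ^^ m) a = (s ^^ n) b \<Longrightarrow> a = b"
proof -
  have inD: "(s ^^ n) a \<in> D" if "a \<in> D" for a n using that by (induction n) (simp_all add: s(1))
  have cancel: "a = (s ^^ d) b" if "a \<in> D" "b \<in> D" "(s ^^ m) a = (s ^^ (m + d)) b" for a b m d
    using that(3)
  proof (induction m)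
    case (Suc m)
    then have "s ((s ^^ m) a) = s ((s ^^ (m + d)) b)" by simp
    then have "(s ^^ m) a = (s ^^ (m + d)) b" using inj_onD[OF inj] inD[OF that(1)] inD[OF that(2)] by blast
    then show ?case by (rule Suc.IH)
  qed simp
  have le: "a = b \<and> m = n" if "a \<in> A" "b \<in> A" "m \<le> n" "(s ^^ m) a = (s ^^ n) b" for a b m n
  proof -
    have "a \<in> D" "b \<in> D" using that A by auto
    moreover have "(s ^^ m) a = (s ^^ (m + (n - m))) b" using that(3,4) by simp
    ultimately have "a = (s ^^ (n - m)) b" by (rule cancel)
    moreover have "a \<noteq> s ((s ^^ d) b)" for d using that(1) A inD[OF \<open>b \<in> D\<close>, of d] by blast
    ultimately show ?thesis using that(3) by (cases "n - m") auto
  qed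
  show "a = b" if "a \<in> A" "b \<in> A" "(s ^^ m) a = (s ^^ n) b" for a b m n
    using le[of a b m n] le[of b a n m] that by (metis nat_le_linear)
  show "is_ray (\<lambda>n. (s ^^ n) a)" if "a \<in> A" for a
    unfolding is_ray_def
  proof
    show "inj (\<lambda>n. (s ^^ n) a)"
    proof (rule injI)
      fix m n assume "(s ^^ m) a = (s ^^ n) a"
      then show "m = n" using le[of a a m n] le[of a a n m] that by (metis nat_le_linear)
    qed
    show "\<forall>n. adj ((s ^^ n) a) ((s ^^ Suc n) a)" using inD[of a] that A s(2) by auto
  qed
qed

text \<open>The linkages from \<open>A n\<close> to \<open>A (Suc n)\<close> are glued to one
  successor function \<open>S\<close>, which is injective because an image reveals the stage it
  comes from.\<close>

lemma chain_rays:
  assumes D: "\<And>m n. m \<noteq> n \<Longrightarrow> D m \<inter> D n = {}" and A: "\<And>n. A n \<subseteq> D n" and inj: "\<And>n. inj_on (s n) (D n)"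
    and s: "\<And>n. s n ` D n \<subseteq> (D n - A n) \<union> A (Suc n)" "\<And>n x. x \<in> D n \<Longrightarrow> adj x (s n x)"
  shows "\<exists>r. (\<forall>a\<in>A 0. is_ray (r a)) \<and> (\<forall>a\<in>A 0. \<forall>b\<in>A 0. \<forall>m n. r a m = r b n \<longrightarrow> a = b)"
proof -
  define i where "i x = (THE n. x \<in> D n)" for x
  have i: "i x = n" if "x \<in> D n" for x n
    unfolding i_def 
  proof (rule the_equality)
    show "m = n" if "x \<in> D m" for m using D[of m n] that \<open>x \<in> D n\<close> by blast
  qed (rule that)
  define S where "S x = s (i x) x" for x
  have S: "S x = s n x" if "x \<in> D n" for x n using i[OF that] by (simp add: S_def)
  have img: "S x \<in> (D n - A n) \<union> A (Suc n)" if "x \<in> D n" for x n using S[OF that] s(1)[of n] that by (metis image_subset_iff)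
  \<comment> \<open>A value in \<open>A (Suc m)\<close> lies in \<open>D (Suc m)\<close> but comes
    from stage \<open>m\<close>. Membership in \<open>A (i y)\<close> decides whether the stage is
    \<open>i y\<close> or one less.\<close>
  have stage: "m = n" if "y \<in> (D m - A m) \<union> A (Suc m)" "y \<in> (D n - A n) \<union> A (Suc n)" for y m n
  proof -
    have st: "i y = m \<and> y \<notin> A (i y) \<or> i y = Suc m \<and> y \<in> A (i y)" if y: "y \<in> (D m - A m) \<union> A (Suc m)" for m
    proof (cases "y \<in> A (Suc m)")
      case True
      then show ?thesis using i[of y "Suc m"] A[of "Suc m"] by auto
    next
      case False
      then show ?thesis using i[of y m] y by auto
    qed
    show ?thesis using st[OF that(1)] st[OF that(2)] by auto
  qed
  have inj': "inj_on S (\<Union>n. D n)"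
  proof (rule inj_onI)
    fix x y assume "x \<in> (\<Union>n. D n)" "y \<in> (\<Union>n. D n)" "S x = S y"
    then obtain m n where mn: "x \<in> D m" "y \<in> D n" by auto
    have "m = n" using img[OF mn(1)] img[OF mn(2)] \<open>S x = S y\<close> by (intro stage[of "S x" m n]) simp_all
    have "x \<in> D n" using mn(1) unfolding \<open>m = n\<close> .
    moreover have "s n x = s n y" using \<open>S x = S y\<close> unfolding S[OF \<open>x \<in> D n\<close>] S[OF mn(2)] .
    ultimately show "x = y" using mn(2) inj_onD[OF inj[of n]] by blast
  qed
  have A0: "A 0 \<inter> S ` (\<Union>n. D n) = {}"
  proof (rule ccontr)
    assume "A 0 \<inter> S ` (\<Union>n. D n) \<noteq> {}"
    then obtain n x where x: "x \<in> D n" "S x \<in> A 0" by blast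
    then have "i (S x) = 0" using i A by blast
    moreover have "i (S x) = n \<and> S x \<notin> A n \<or> i (S x) = Suc n"
      using img[OF x(1)] i[of "S x"] A by blast
    ultimately show False using x(2) by auto
  qed
  have SD: "S x \<in> (\<Union>n. D n)" "adj x (S x)" if x: "x \<in> (\<Union>n. D n)" for x
  proof -
    obtain n where n: "x \<in> D n" using x by auto
    show "S x \<in> (\<Union>n. D n)" using img[OF n] A[of "Suc n"] by blast
    show "adj x (S x)" using S[OF n] s(2)[OF n] by simp
  qed
  have A0': "A 0 \<subseteq> (\<Union>n. D n)" using A by blast
  show ?thesis
    using successor_rays[OF SD inj' A0' A0] by (intro exI[of _ "\<lambda>a n. (S ^^ n) a"]) blast
qed

section \<open>Regions\<close>

definition region :: "'a set \<Rightarrow> bool" where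
  "region C \<longleftrightarrow> finite (nb C) \<and> (\<forall>r. is_ray r \<longrightarrow> (MOST n. r n \<in> C))"

text \<open>The vertices dominating the end: no finite boundary \<open>nb C\<close> separates them
  from the tails in \<open>C\<close>.\<close>

definition dominators :: "'a set" where
  "dominators = {v. \<forall>C. region C \<longrightarrow> v \<in> C \<union> nb C}"

text \<open>Only subregions compete, so boundaries of tight regions may grow as the regions shrink;
  \<open>tight_bound\<close> limits this growth.\<close>

definition tight :: "'a set \<Rightarrow> bool" where
  "tight C \<longleftrightarrow> region C \<and> (\<forall>C'. region C' \<longrightarrow> C' \<subseteq> C \<longrightarrow> card (nb C) \<le> card (nb C'))"

lemma ray_avoids_finite:
  assumes "is_ray r" "finite S" shows "MOST n. r n \<notin> S"
proof -
  have "finite (r -` S)" using assms by (intro finite_vimageI) (auto simp: is_ray_def)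
  then show ?thesis by (simp add: MOST_iff_cofinite vimage_def)
qed

text \<open>Once the ray has left the finite set \<open>nb C\<close> for good, it can neither enter
  nor leave \<open>C\<close>.\<close>

lemma ray_tail_dichotomy:
  assumes r: "is_ray r" and C: "finite (nb C)"
  shows "(MOST n. r n \<in> C) \<or> (MOST n. r n \<notin> C)"
proof -
  obtain m where m: "\<And>n. n \<ge> m \<Longrightarrow> r n \<notin> nb C"
    using ray_avoids_finite[OF r C] by (auto simp: MOST_nat_le)
  have step: "r (Suc n) \<in> C \<longleftrightarrow> r n \<in> C" if "n \<ge> m" for n
  proof -
    have a: "adj (r n) (r (Suc n))" using r by (auto simp: is_ray_def)
    show ?thesis
      using m[of n] m[of "Suc n"] that nbI[OF _ _ a, of C] nbI[OF _ _ adj_sym[OF a], of C] by auto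
  qed
  have "r n \<in> C \<longleftrightarrow> r m \<in> C" if "n \<ge> m" for n
    using that by (induction rule: dec_induct) (auto simp: step)
  then show ?thesis unfolding MOST_nat_le by blast
qed

lemma region_finite: "region C \<Longrightarrow> finite (nb C)"
  by (simp add: region_def)

lemma region_ray: "region C \<Longrightarrow> is_ray r \<Longrightarrow> MOST n. r n \<in> C"
  by (simp add: region_def)

lemma region_Int:
  assumes "region C" "region D" shows "region (C \<inter> D)"
proof -
  have "finite (nb (C \<inter> D))"
    by (rule finite_subset[OF nb_Int]) (use assms in \<open>auto simp: region_finite\<close>)
  then show ?thesis using assms by (auto simp: region_def MOST_conj_distrib)
qed

lemma region_mono:
  assumes "region C" "C \<subseteq> D" "finite (nb D)" shows "region D"
  using assms unfolding region_def by (auto elim!: MOST_mono)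

lemma region_Un:
  assumes "region C" "region D" shows "region (C \<union> D)"
proof (rule region_mono[OF assms(1)])
  show "finite (nb (C \<union> D))"
    by (rule finite_subset[OF nb_Un]) (use assms in \<open>auto simp: region_finite\<close>)
qed auto

lemma region_Diff_finite:
  assumes "region C" "finite S" shows "region (C - S)"
proof -
  have "finite (nb (- S))" using assms(2) by (rule rev_finite_subset) (auto simp: nb_def)
  then have "region (- S)" using assms(2) ray_avoids_finite by (auto simp: region_def)
  then have "region (C \<inter> - S)" using assms(1) region_Int by blast
  then show ?thesis by (simp add: Diff_eq)
qed

lemma region_UNIV: "region UNIV"
  by (auto simp: region_def nb_def)

lemma region_INT:
  assumes "finite I" "I \<noteq> {}" "\<And>i. i \<in> I \<Longrightarrow> region (C i)" shows "region (\<Inter>i\<in>I. C i)"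
  using assms by (induction I rule: finite_ne_induct) (auto intro: region_Int)

lemma is_ray_image:
  assumes "g \<in> autos" "is_ray r" shows "is_ray (g \<circ> r)"
  using assms autos_inj[OF assms(1)] by (auto simp: is_ray_def inj_def autos_adj)

lemma region_image:
  assumes g: "g \<in> autos" and C: "region C" shows "region (g ` C)"
  unfolding region_def
proof (intro conjI allI impI)
  show "finite (nb (g ` C))" using nb_image[OF g] region_finite[OF C] by simp
  fix r assume "is_ray r"
  then have "MOST n. (inv g \<circ> r) n \<in> C" by (intro region_ray C is_ray_image inv_autos g)
  then show "MOST n. r n \<in> g ` C"
    by (rule MOST_mono) (use autos_inv[OF g] in \<open>auto simp: image_iff; metis\<close>)
qed

section \<open>Boundary sizes and submodularity\<close>

lemma card_nb_image: "g \<in> autos \<Longrightarrow> card (nb (g ` C)) = card (nb C)"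
  using nb_image[of g C] card_image[of g "nb C"] autos_inj[of g] by (simp add: inj_on_def)

text \<open>Submodularity with the two upper estimates kept explicit: when nothing is lost,
  \<open>nb (C \<inter> D)\<close> must equal \<open>I\<close>, and \<open>nb_Int_eq\<close>
  extracts this formula.\<close>

lemma card_nb_Int_Un:
  fixes C D
  defines "I \<equiv> (nb C \<inter> D) \<union> (nb C \<inter> nb D) \<union> (C \<inter> nb D)" and "U \<equiv> (nb C - D) \<union> (nb D - C)"
  assumes fin: "finite (nb C)" "finite (nb D)"
  shows "card (nb (C \<inter> D)) \<le> card I" "card (nb (C \<union> D)) \<le> card U" "card I + card U = card (nb C) + card (nb D)"
proof -
  show "card (nb (C \<inter> D)) \<le> card I" unfolding I_def using nb_Int fin by (intro card_mono) auto
  show "card (nb (C \<union> D)) \<le> card U" unfolding U_def using nb_Un fin by (intro card_mono) auto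
  have "I \<union> U = nb C \<union> nb D" "I \<inter> U = nb C \<inter> nb D"
    using nb_disjoint[of C] nb_disjoint[of D] by (auto simp: I_def U_def)
  moreover have "finite I" "finite U" using fin by (auto simp: I_def U_def)
  ultimately show "card I + card U = card (nb C) + card (nb D)"
    using card_Un_Int[of I U] card_Un_Int[of "nb C" "nb D"] fin by simp
qed

lemma nb_Int_eq:
  assumes fin: "finite (nb C)" "finite (nb D)" and "card (nb C) = c" "card (nb D) = c"
    and ge: "c \<le> card (nb (C \<inter> D))" "c \<le> card (nb (C \<union> D))"
  shows "card (nb (C \<inter> D)) = c" "card (nb (C \<union> D)) = c"
    and "nb (C \<inter> D) = (nb C \<inter> D) \<union> (nb C \<inter> nb D) \<union> (C \<inter> nb D)"
proof -
  note l = card_nb_Int_Un[OF fin]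
  show 1: "card (nb (C \<inter> D)) = c" and "card (nb (C \<union> D)) = c" using l assms(3-6) by linarith+
  show "nb (C \<inter> D) = (nb C \<inter> D) \<union> (nb C \<inter> nb D) \<union> (C \<inter> nb D)"
  proof (rule card_subset_eq)
    show "card (nb (C \<inter> D)) = card ((nb C \<inter> D) \<union> (nb C \<inter> nb D) \<union> (C \<inter> nb D))"
      using l assms(3-6) by linarith
  qed (use fin nb_Int in auto)
qed

lemma ex_tight:
  assumes "region E" shows "\<exists>C. tight C \<and> C \<subseteq> E"
  using ex_has_least_nat[of "\<lambda>C. region C \<and> C \<subseteq> E" E "\<lambda>C. card (nb C)"] assms
  unfolding tight_def by auto

end

section \<open>Ends of finite degree\<close>

text \<open>A set \<open>C\<close> with finite \<open>nb C\<close> is closed under adjacency once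
  \<open>nb C\<close> is deleted. Such sets replace finite separators and their components in
  \<open>same_end\<close>.\<close>

locale thin_one_ended = sym_rel adj V for adj :: "'a \<Rightarrow> 'a \<Rightarrow> bool" and V :: "'a set" +
  fixes k :: nat
  assumes same_end: "is_ray r \<Longrightarrow> is_ray s \<Longrightarrow> finite (nb C) \<Longrightarrow> MOST n. r n \<in> C \<Longrightarrow> MOST n. s n \<in> C"
    and ex_ray: "\<exists>r. is_ray r"
    and degree: "F \<subseteq> Collect is_ray \<Longrightarrow> (\<And>r s. r \<in> F \<Longrightarrow> s \<in> F \<Longrightarrow> r \<noteq> s \<Longrightarrow> range r \<inter> range s = {}) \<Longrightarrow>
      finite F \<and> card F \<le> k"
begin

lemma regionI_ray: "finite (nb C) \<Longrightarrow> is_ray r \<Longrightarrow> MOST n. r n \<in> C \<Longrightarrow> region C"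
  using same_end unfolding region_def by blast

lemma region_or_Compl:
  assumes "finite (nb C)" shows "region C \<or> region (- (C \<union> nb C))"
proof -
  obtain r where r: "is_ray r" using ex_ray by blast
  show ?thesis
  proof (rule disjE[OF ray_tail_dichotomy[OF r assms]])
    assume "MOST n. r n \<in> C"
    then show ?thesis using regionI_ray assms r by blast
  next
    assume "MOST n. r n \<notin> C"
    then have "MOST n. r n \<notin> C \<and> r n \<notin> nb C" using ray_avoids_finite[OF r assms] by (rule MOST_conjI)
    then have "MOST n. r n \<in> - (C \<union> nb C)" by simp
    moreover have "finite (nb (- (C \<union> nb C)))" using nb_Compl_closure assms by (rule finite_subset)
    ultimately show ?thesis using regionI_ray r by blast
  qed
qed

lemma region_meets:
  assumes "region C" "region D" shows "C \<inter> D \<noteq> {}"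
proof -
  obtain r where r: "is_ray r" using ex_ray by blast
  have "MOST n. r n \<in> C \<inter> D" using region_ray[OF region_Int[OF assms] r] .
  then show ?thesis by (auto simp: MOST_nat_le)
qed

section \<open>Disjoint rays from dominating vertices and from tight regions\<close>

lemma card_disjoint_rays:
  assumes r: "\<And>a. a \<in> A \<Longrightarrow> is_ray (r a)"
    and disj: "\<And>a b m n. a \<in> A \<Longrightarrow> b \<in> A \<Longrightarrow> r a m = r b n \<Longrightarrow> a = b"
  shows "finite A \<and> card A \<le> k"
proof -
  have inj: "inj_on r A" using disj by (intro inj_onI) (metis)
  have "finite (r ` A) \<and> card (r ` A) \<le> k"
    using r disj by (intro degree) (auto, blast)
  then show ?thesis using inj by (simp add: card_image finite_image_iff)
qed

text \<open>A separator with fewer than \<open>card A\<close> vertices misses some \<open>a\<close>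
  in \<open>A\<close> and some \<open>b\<close> in \<open>B\<close>, which then lie on different
  sides of a set \<open>Y\<close> with finite boundary. One side is a region, so the vertex on the
  other side cannot dominate. \<open>U\<close> collects the vertices used before.\<close>

lemma dominators_step:
  assumes inf: "infinite dominators" and A: "finite A" "A \<subseteq> dominators" "A \<inter> U = {}" and U: "finite U"
  shows "\<exists>B D s. finite B \<and> B \<subseteq> dominators \<and> card B = card A \<and> B \<inter> (U \<union> D) = {} \<and> finite D \<and> A \<subseteq> D \<and> D \<inter> U = {} \<and>
    inj_on s D \<and> s ` D \<subseteq> (D - A) \<union> B \<and> (\<forall>x\<in>D. adj x (s x))"
proof -
  have "infinite (dominators - (U \<union> A))" using inf A U by (intro Diff_infinite_finite) auto
  then obtain B where B: "finite B" "card B = card A" "B \<subseteq> dominators - (U \<union> A)"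
    using infinite_arbitrarily_large by blast
  have "\<exists>D s. finite D \<and> A \<subseteq> D \<and> D \<subseteq> - U - B \<and> inj_on s D \<and> s ` D \<subseteq> (D - A) \<union> B \<and> (\<forall>x\<in>D. adj x (s x))"
  proof (rule linkage)
    show "finite A" "A \<subseteq> - U" "A \<inter> B = {}" using A B by auto
    fix Y assume Y: "Y \<subseteq> - U" "Y \<inter> B = {}" "finite (nb Y \<inter> - U)"
    let ?W = "(nb Y \<inter> - U) \<union> (A - Y)"
    show "card A \<le> card ?W"
    proof (rule ccontr)
      assume less: "\<not> card A \<le> card ?W"
      have W: "finite ?W" using Y A by auto
      obtain a where a: "a \<in> A" "a \<notin> ?W" using less card_mono[OF W] by blast
      obtain b where b: "b \<in> B" "b \<notin> ?W" using less card_mono[OF W] B(2) by (metis subsetI)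
      have fin: "finite (nb Y)" by (rule finite_subset[of _ "?W \<union> U"]) (use W U in auto)
      have "b \<notin> Y \<union> nb Y" using b Y B by auto
      moreover have "b \<in> dominators" using b B by auto
      ultimately have "\<not> region Y" by (auto simp: dominators_def)
      then have "region (- (Y \<union> nb Y))" using region_or_Compl[OF fin] by blast
      moreover have "a \<in> dominators" "a \<in> Y" using a A by auto
      ultimately have "a \<in> nb (- (Y \<union> nb Y))" by (auto simp: dominators_def)
      then have "a \<in> nb Y" using nb_Compl_closure by blast
      then show False using \<open>a \<in> Y\<close> nb_disjoint[of Y] by blast
    qed
  qed
  then obtain D s where "finite D" "A \<subseteq> D" "D \<subseteq> - U - B" "inj_on s D" "s ` D \<subseteq> (D - A) \<union> B" "\<forall>x\<in>D. adj x (s x)"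
    by blast
  then show ?thesis using B by (intro exI[of _ B] exI[of _ D] exI[of _ s]) auto
qed

text \<open>Linking \<open>Suc k\<close> dominating vertices to fresh ones again and again, always
  off the vertices already used, gives \<open>Suc k\<close> disjoint rays.\<close>

lemma finite_dominators: "finite dominators"
proof (rule ccontr)
  assume inf: "infinite dominators"
  obtain A0 where A0: "finite A0" "card A0 = Suc k" "A0 \<subseteq> dominators"
    using infinite_arbitrarily_large[OF inf] by blast
  \<comment> \<open>A state records the used vertices \<open>U\<close>, the starts \<open>A\<close>,
    the targets \<open>B\<close>, and a linkage \<open>s\<close> on the vertex set
    \<open>D\<close>.\<close>
  define P where "P n p \<longleftrightarrow> (case p of (U, A, B, D, s) \<Rightarrow> finite U \<and> finite B \<and> B \<subseteq> dominators \<and> B \<inter> (U \<union> D) = {} \<and> finite D \<and>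
    A \<subseteq> D \<and> D \<inter> U = {} \<and> inj_on s D \<and> s ` D \<subseteq> (D - A) \<union> B \<and> (\<forall>x\<in>D. adj x (s x)) \<and> (n = 0 \<longrightarrow> A = A0))"
    for n :: nat and p :: "'a set \<times> 'a set \<times> 'a set \<times> 'a set \<times> ('a \<Rightarrow> 'a)"
  define Q where "Q n p q \<longleftrightarrow> (case p of (U, A, B, D, s) \<Rightarrow> case q of (U', A', B', D', s') \<Rightarrow> U' = U \<union> D \<and> A' = B)"
    for n :: nat and p q :: "'a set \<times> 'a set \<times> 'a set \<times> 'a set \<times> ('a \<Rightarrow> 'a)"
  have "\<exists>f. \<forall>n. P n (f n) \<and> Q n (f n) (f (Suc n))"
  proof (rule dependent_nat_choice)
    obtain B D s where "finite B \<and> B \<subseteq> dominators \<and> card B = card A0 \<and> B \<inter> ({} \<union> D) = {} \<and> finite D \<and> A0 \<subseteq> D \<and> D \<inter> {} = {} \<and>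
      inj_on s D \<and> s ` D \<subseteq> (D - A0) \<union> B \<and> (\<forall>x\<in>D. adj x (s x))"
      using dominators_step[OF inf A0(1,3), of "{}"] by auto
    then have "P 0 ({}, A0, B, D, s)" by (simp add: P_def)
    then show "\<exists>p. P 0 p" ..
  next
    fix p n assume p: "P n p"
    obtain U A B D s where pe: "p = (U, A, B, D, s)" by (cases p)
    have 1: "finite B" "B \<subseteq> dominators" "B \<inter> (U \<union> D) = {}" "finite (U \<union> D)" using p by (auto simp: P_def pe)
    obtain B' D' s' where "finite B' \<and> B' \<subseteq> dominators \<and> card B' = card B \<and> B' \<inter> ((U \<union> D) \<union> D') = {} \<and> finite D' \<and> B \<subseteq> D' \<and> D' \<inter> (U \<union> D) = {} \<and>
      inj_on s' D' \<and> s' ` D' \<subseteq> (D' - B) \<union> B' \<and> (\<forall>x\<in>D'. adj x (s' x))"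
      using dominators_step[OF inf 1] by auto
    then have "P (Suc n) (U \<union> D, B, B', D', s') \<and> Q n p (U \<union> D, B, B', D', s')"
      using 1 by (simp add: P_def Q_def pe)
    then show "\<exists>q. P (Suc n) q \<and> Q n p q" ..
  qed
  then obtain f where f: "\<And>n. P n (f n)" "\<And>n. Q n (f n) (f (Suc n))" by blast
  define U where "U n = fst (f n)" for n
  define A where "A n = fst (snd (f n))" for n
  define D where "D n = fst (snd (snd (snd (f n))))" for n
  define s where "s n = snd (snd (snd (snd (f n))))" for n
  have B: "fst (snd (snd (f n))) = A (Suc n)" for n
    using f(2)[of n] by (auto simp: Q_def A_def split: prod.splits)
  have U: "U (Suc n) = U n \<union> D n" for n
    using f(2)[of n] by (auto simp: Q_def U_def D_def split: prod.splits)
  have p: "A n \<subseteq> D n" "D n \<inter> U n = {}" "inj_on (s n) (D n)" "s n ` D n \<subseteq> (D n - A n) \<union> A (Suc n)"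
    "\<forall>x\<in>D n. adj x (s n x)" for n
    using f(1)[of n] B[of n] by (auto simp: P_def A_def D_def s_def U_def split: prod.splits)
  have "A 0 = A0" using f(1)[of 0] by (auto simp: P_def A_def split: prod.splits)
  have DU: "D m \<subseteq> U n" if "m < n" for m n
    using that by (induction n) (auto simp: U less_Suc_eq)
  have disj: "D m \<inter> D n = {}" if "m \<noteq> n" for m n
    using that DU[of m n] DU[of n m] p(2)[of m] p(2)[of n] by (cases m n rule: linorder_cases) blast+
  have adj: "adj x (s n x)" if "x \<in> D n" for x n using p(5) that by blast
  obtain r where r: "\<forall>a\<in>A 0. is_ray (r a)" "\<forall>a\<in>A 0. \<forall>b\<in>A 0. \<forall>m n. r a m = r b n \<longrightarrow> a = b"
    using chain_rays[of D A s, OF disj p(1,3,4) adj] by blast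
  then have "card A0 \<le> k" using card_disjoint_rays[of A0 r] \<open>A 0 = A0\<close> by blast
  then show False using A0 by simp
qed

text \<open>For a separator \<open>?W\<close> belonging to \<open>Y\<close>, the set
  \<open>C - (Y \<union> ?W)\<close> still contains \<open>C'\<close>, hence is a region, and its
  boundary lies in \<open>?W \<union> \<Delta>\<close>. Tightness of \<open>C\<close> then bounds
  \<open>?W\<close> from below.\<close>

lemma tight_linkage:
  assumes C: "tight C" and C': "region C'" "C' \<subseteq> C"
    and \<Delta>: "\<Delta> \<inter> C = {}" "\<Delta> \<subseteq> nb C" and disj: "(nb C - \<Delta>) \<inter> (C' \<union> nb C') = {}"
  shows "\<exists>D s. finite D \<and> nb C - \<Delta> \<subseteq> D \<and> D \<subseteq> (C \<union> nb C) - C' - \<Delta> - (nb C' - \<Delta>) \<and> inj_on s D \<and>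
    s ` D \<subseteq> (D - (nb C - \<Delta>)) \<union> (nb C' - \<Delta>) \<and> (\<forall>x\<in>D. adj x (s x))"
proof (rule linkage)
  let ?M = "(C \<union> nb C) - C' - \<Delta>" and ?A = "nb C - \<Delta>"
  have fin: "finite (nb C)" using C by (auto simp: tight_def region_finite)
  show "finite ?A" "?A \<subseteq> ?M" "?A \<inter> (nb C' - \<Delta>) = {}" using fin disj by auto
  fix Y assume Y: "Y \<subseteq> ?M" "Y \<inter> (nb C' - \<Delta>) = {}" "finite (nb Y \<inter> ?M)"
  let ?W = "(nb Y \<inter> ?M) \<union> (?A - Y)"
  have finW: "finite ?W" using Y fin by auto
  have sub: "nb (C - (Y \<union> ?W)) \<subseteq> ?W \<union> \<Delta>"
  proof
    fix z assume "z \<in> nb (C - (Y \<union> ?W))"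
    then obtain c where z: "z \<notin> C - (Y \<union> ?W)" "c \<in> C" "c \<notin> Y" "c \<notin> ?W" "adj z c"
      unfolding nb_def by blast
    show "z \<in> ?W \<union> \<Delta>"
    proof (rule ccontr)
      assume nz: "z \<notin> ?W \<union> \<Delta>"
      have "z \<in> Y"
      proof (rule ccontr)
        assume "z \<notin> Y"
        then have "z \<notin> C" using z nz by auto
        then have "z \<in> nb C" using z nbI by blast
        then show False using nz \<open>z \<notin> Y\<close> by auto
      qed
      then have "c \<in> nb Y" using z adj_sym nbI by blast
      show False
      proof (cases "c \<in> C'")
        case True
        have "z \<notin> C'" using \<open>z \<in> Y\<close> Y(1) by auto
        then have "z \<in> nb C'" using True z(5) nbI by blast
        then show False using \<open>z \<in> Y\<close> Y(2) nz by auto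
      next
        case False
        have "c \<notin> \<Delta>" using z(2) \<Delta>(1) by auto
        then show False using False z(2,4) \<open>c \<in> nb Y\<close> by auto
      qed
    qed
  qed
  have fin\<Delta>: "finite \<Delta>" using \<Delta>(2) fin by (rule finite_subset)
  have C'sub: "C' \<subseteq> C - (Y \<union> ?W)" using C' Y(1) disj by blast
  have "region (C - (Y \<union> ?W))"
    by (rule region_mono[OF C'(1) C'sub]) (rule finite_subset[OF sub], use finW fin\<Delta> in simp)
  then have "card (nb C) \<le> card (nb (C - (Y \<union> ?W)))" using C by (auto simp: tight_def)
  also have "\<dots> \<le> card (?W \<union> \<Delta>)" using sub finW fin\<Delta> by (intro card_mono) auto
  also have "\<dots> \<le> card ?W + card \<Delta>" by (rule card_Un_le)
  finally have "card (nb C) \<le> card ?W + card \<Delta>" .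
  moreover have "card ?A = card (nb C) - card \<Delta>" using \<Delta>(2) fin\<Delta> by (rule card_Diff_subset[rotated])
  ultimately show "card ?A \<le> card ?W" by simp
qed

text \<open>In a nested sequence of tight regions whose boundaries share only dominating vertices,
  the linkages between consecutive boundaries join up to disjoint rays. Their number is at most
  \<open>k\<close>; the dominating vertices, which lie on all these boundaries, are added
  separately.\<close>

lemma tight_bound:
  assumes "tight C" shows "card (nb C) \<le> k + card dominators"
proof -
  let ?\<Delta> = dominators
  note fin = finite_dominators
  \<comment> \<open>Passing to \<open>C0\<close> does not lower the boundary size, since
    \<open>C\<close> is tight. Every region inside \<open>C0\<close> has all dominating vertices on
    its boundary.\<close>
  obtain C0 where C0: "tight C0" "C0 \<subseteq> C - ?\<Delta>"
    using ex_tight[OF region_Diff_finite[OF _ fin, of C]] assms unfolding tight_def by blast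
  have dom: "?\<Delta> \<subseteq> nb C'" if "region C'" "C' \<inter> ?\<Delta> = {}" for C'
    using that by (auto simp: dominators_def)
  define P where "P n C' \<longleftrightarrow> tight C' \<and> C' \<inter> ?\<Delta> = {} \<and> (n = 0 \<longrightarrow> C' = C0)" for n :: nat and C'
  define Q where "Q n C' C'' \<longleftrightarrow> C'' \<subseteq> C' \<and> (nb C' - ?\<Delta>) \<inter> (C'' \<union> nb C'') = {}" for n :: nat and C' C''
  have "\<exists>f. \<forall>n. P n (f n) \<and> Q n (f n) (f (Suc n))"
  proof (rule dependent_nat_choice)
    show "\<exists>C'. P 0 C'" using C0 by (auto simp: P_def)
  next
    fix C' n assume "P n C'"
    then have C': "tight C'" "region C'" "C' \<inter> ?\<Delta> = {}" by (auto simp: P_def tight_def)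
    \<comment> \<open>Each boundary vertex that does not dominate lies off the closure of some
      region; intersecting these finitely many regions leaves all such vertices behind.\<close>
    have "\<exists>E. region E \<and> w \<notin> E \<union> nb E" if "w \<in> nb C' - ?\<Delta>" for w
      using that by (auto simp: dominators_def)
    then obtain E where E: "\<And>w. w \<in> nb C' - ?\<Delta> \<Longrightarrow> region (E w)" "\<And>w. w \<in> nb C' - ?\<Delta> \<Longrightarrow> w \<notin> E w \<union> nb (E w)"
      by metis
    let ?I = "insert C' (E ` (nb C' - ?\<Delta>))"
    have "region (\<Inter>i\<in>?I. i)"
      using C'(2) E(1) region_finite[OF C'(2)] by (intro region_INT) auto
    then obtain C'' where C'': "tight C''" "C'' \<subseteq> (\<Inter>i\<in>?I. i)" using ex_tight by blast
    have "w \<notin> C'' \<union> nb C''" if w: "w \<in> nb C' - ?\<Delta>" for w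
    proof -
      have "C'' \<subseteq> E w" using C''(2) w by auto
      then show ?thesis using nb_closure_mono[of C'' "E w"] E(2)[OF w] by blast
    qed
    then have "P (Suc n) C'' \<and> Q n C' C''" using C'' C' unfolding P_def Q_def by auto
    then show "\<exists>C''. P (Suc n) C'' \<and> Q n C' C''" ..
  qed
  then obtain f where f: "\<And>n. P n (f n)" "\<And>n. Q n (f n) (f (Suc n))" by blast
  have t: "tight (f n)" "region (f n)" "?\<Delta> \<inter> f n = {}" "?\<Delta> \<subseteq> nb (f n)" for n
    using f(1)[of n] dom[of "f n"] by (auto simp: P_def tight_def)
  have q: "f (Suc n) \<subseteq> f n" "(nb (f n) - ?\<Delta>) \<inter> (f (Suc n) \<union> nb (f (Suc n))) = {}" for n
    using f(2)[of n] by (auto simp: Q_def)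
  have f0: "f 0 = C0" using f(1)[of 0] by (simp add: P_def)
  define A where "A n = nb (f n) - ?\<Delta>" for n
  define \<Phi> where "\<Phi> n D s \<longleftrightarrow> finite D \<and> A n \<subseteq> D \<and> D \<subseteq> (f n \<union> nb (f n)) - f (Suc n) - ?\<Delta> - A (Suc n) \<and>
    inj_on s D \<and> s ` D \<subseteq> (D - A n) \<union> A (Suc n) \<and> (\<forall>x\<in>D. adj x (s x))" for n D s
  have "\<exists>D s. \<Phi> n D s" for n
    unfolding \<Phi>_def A_def by (rule tight_linkage[OF t(1) t(2) q(1) t(3,4) q(2)])
  then obtain D s where \<Phi>: "\<And>n. \<Phi> n (D n) (s n)" by metis
  have Ds: "A n \<subseteq> D n \<and> D n \<subseteq> (f n \<union> nb (f n)) - f (Suc n) - ?\<Delta> - A (Suc n) \<and> inj_on (s n) (D n) \<and>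
    s n ` D n \<subseteq> (D n - A n) \<union> A (Suc n) \<and> (\<forall>x\<in>D n. adj x (s n x))" for n
    using \<Phi>[of n] unfolding \<Phi>_def by blast
  have less: "D m \<inter> D n = {}" if "m < n" for m n
  proof -
    have "f n \<subseteq> f (Suc m)" using that by (intro lift_Suc_antimono_le[of f, OF q(1)]) auto
    then have "f n \<union> nb (f n) \<subseteq> f (Suc m) \<union> nb (f (Suc m))" by (rule nb_closure_mono)
    moreover have D: "D i \<subseteq> (f i \<union> nb (f i)) - f (Suc i) - ?\<Delta> - A (Suc i)" for i
      using Ds[of i] by (elim conjE)
    have "D m \<subseteq> - f (Suc m) - (nb (f (Suc m)) - ?\<Delta>)" using D[of m] unfolding A_def by auto
    ultimately show ?thesis using D[of n] by auto
  qed
  have disj: "D m \<inter> D n = {}" if "m \<noteq> n" for m n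
    using that less[of m n] less[of n m] Int_commute[of "D m" "D n"] by (metis linorder_neqE_nat)
  have Ds': "A n \<subseteq> D n" "inj_on (s n) (D n)" "s n ` D n \<subseteq> (D n - A n) \<union> A (Suc n)" for n
    using Ds[of n] by simp_all
  have adj: "adj x (s n x)" if "x \<in> D n" for x n using Ds[of n] that by blast
  obtain r where r: "\<forall>a\<in>A 0. is_ray (r a)" "\<forall>a\<in>A 0. \<forall>b\<in>A 0. \<forall>m n. r a m = r b n \<longrightarrow> a = b"
    using chain_rays[of D A s, OF disj Ds' adj] by blast
  then have "card (A 0) \<le> k" using card_disjoint_rays[of "A 0" r] by blast
  moreover have "card (nb C0) \<le> card (A 0) + card ?\<Delta>"
    using card_Un_le[of "A 0" ?\<Delta>] t(4)[of 0] by (simp add: A_def f0 Un_absorb2)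
  moreover have "card (nb C) \<le> card (nb C0)" using assms C0 by (auto simp: tight_def)
  ultimately show ?thesis by linarith
qed

text \<open>\<open>c\<close> is the largest boundary size of a tight region, attained by
  \<open>C0\<close>, and \<open>X = nb C0\<close>. If a region \<open>C\<close> avoids
  \<open>nb C0\<close>, then \<open>nb (C \<inter> C0) \<subseteq> nb C\<close>, and tightness of
  \<open>C0\<close> gives the lower bound.\<close>

lemma ex_base:
  "\<exists>c X. finite X \<and> (\<forall>C. region C \<longrightarrow> C \<inter> X = {} \<longrightarrow> c \<le> card (nb C)) \<and>
    (\<forall>E. region E \<longrightarrow> (\<exists>C\<subseteq>E. region C \<and> card (nb C) \<le> c))"
proof -
  obtain C where "tight C" using ex_tight[OF region_UNIV] by blast
  then obtain C0 where C0: "tight C0" "\<And>C. tight C \<Longrightarrow> card (nb C) \<le> card (nb C0)"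
    using ex_has_greatest_nat[of tight C "\<lambda>C. card (nb C)" "Suc (k + card dominators)"] tight_bound
    by (auto simp: less_Suc_eq_le)
  have reg: "region C0" using C0(1) by (simp add: tight_def)
  have "card (nb C0) \<le> card (nb C)" if C: "region C" "C \<inter> nb C0 = {}" for C
  proof -
    have "card (nb C0) \<le> card (nb (C \<inter> C0))"
      using C0(1) region_Int[OF C(1) reg] by (auto simp: tight_def)
    also have "\<dots> \<le> card (nb C)"
      using nb_Int[of C C0] C by (intro card_mono region_finite) auto
    finally show ?thesis .
  qed
  moreover have "\<exists>C\<subseteq>E. region C \<and> card (nb C) \<le> card (nb C0)" if "region E" for E
    using ex_tight[OF that] C0(2) by (auto simp: tight_def)
  ultimately show ?thesis using region_finite[OF reg] by (intro exI[of _ "card (nb C0)"] exI[of _ "nb C0"]) auto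
qed

end

section \<open>Regions of minimal boundary size\<close>

locale based_end = thin_one_ended adj V k for adj :: "'a \<Rightarrow> 'a \<Rightarrow> bool" and V k +
  fixes c :: nat and X0 :: "'a set"
  assumes finite_X0: "finite X0"
    and X0_ge: "region C \<Longrightarrow> C \<inter> X0 = {} \<Longrightarrow> c \<le> card (nb C)"
    and ex_le: "region E \<Longrightarrow> \<exists>C\<subseteq>E. region C \<and> card (nb C) \<le> c"
begin

text \<open>Kept general because \<open>X0\<close> need not be invariant under automorphisms: its
  images and finite supersets are bases as well.\<close>

definition base :: "'a set \<Rightarrow> bool" where
  "base X \<longleftrightarrow> finite X \<and> (\<forall>C. region C \<longrightarrow> C \<inter> X = {} \<longrightarrow> c \<le> card (nb C))"

definition min_regions :: "'a set \<Rightarrow> 'a set set" where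
  "min_regions X = {C. region C \<and> C \<inter> X = {} \<and> card (nb C) = c}"

text \<open>The largest member of \<open>min_regions X\<close>, if \<open>X\<close> is a base. It is canonical, hence equivariant, but may contain
  rayless components, which \<open>core\<close> discards.\<close>

definition outer :: "'a set \<Rightarrow> 'a set" where
  "outer X = \<Union>(min_regions X)"

definition core :: "'a set \<Rightarrow> 'a set" where
  "core D = \<Union>{K. conn K \<and> region K \<and> K \<subseteq> D}"

section \<open>The lattice of minimal regions\<close>

lemma base_X0: "base X0"
  using finite_X0 X0_ge by (simp add: base_def)

lemma base_mono: "base X \<Longrightarrow> X \<subseteq> Y \<Longrightarrow> finite Y \<Longrightarrow> base Y"
  unfolding base_def by blast

lemma min_regionsD: "C \<in> min_regions X \<Longrightarrow> region C" "C \<in> min_regions X \<Longrightarrow> C \<inter> X = {}" "C \<in> min_regions X \<Longrightarrow> card (nb C) = c"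
  "C \<in> min_regions X \<Longrightarrow> finite (nb C)"
  using region_finite by (auto simp: min_regions_def)

lemma min_regions_anti: "X \<subseteq> Y \<Longrightarrow> min_regions Y \<subseteq> min_regions X"
  unfolding min_regions_def by blast

lemma min_regionsI: "base X \<Longrightarrow> region C \<Longrightarrow> C \<inter> X = {} \<Longrightarrow> card (nb C) \<le> c \<Longrightarrow> C \<in> min_regions X"
  unfolding min_regions_def base_def by (simp add: le_antisym)

lemma min_regions_image:
  assumes "g \<in> autos" "C \<in> min_regions X" shows "g ` C \<in> min_regions (g ` X)"
  using assms region_image card_nb_image image_Int_autos[OF assms(1), of C X] by (simp add: min_regions_def)

lemma ex_min_regions_below:
  assumes X: "base X" and E: "region E" shows "\<exists>C\<in>min_regions X. C \<subseteq> E"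
proof -
  have "finite X" using X by (simp add: base_def)
  then have "region (E - X)" using E region_Diff_finite by blast
  then obtain C where C: "C \<subseteq> E - X" "region C" "card (nb C) \<le> c" using ex_le by blast
  then have "C \<in> min_regions X" by (intro min_regionsI[OF X]) auto
  then show ?thesis using C by blast
qed

text \<open>Both sets avoid \<open>X\<close>, so both boundaries have at least \<open>c\<close>
  vertices, and submodularity leaves no slack.\<close>

lemma min_regions_lattice:
  assumes X: "base X" and C: "C \<in> min_regions X" "D \<in> min_regions X"
  shows "C \<inter> D \<in> min_regions X" "C \<union> D \<in> min_regions X"
    and "nb (C \<inter> D) = (nb C \<inter> D) \<union> (nb C \<inter> nb D) \<union> (C \<inter> nb D)"
proof -
  have r: "region (C \<inter> D)" "region (C \<union> D)" using min_regionsD(1)[OF C(1)] min_regionsD(1)[OF C(2)] region_Int region_Un by auto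
  have d: "(C \<inter> D) \<inter> X = {}" "(C \<union> D) \<inter> X = {}" using min_regionsD(2)[OF C(1)] min_regionsD(2)[OF C(2)] by auto
  have ge: "c \<le> card (nb (C \<inter> D))" "c \<le> card (nb (C \<union> D))" using X r d by (auto simp: base_def)
  note e = nb_Int_eq[OF min_regionsD(4)[OF C(1)] min_regionsD(4)[OF C(2)] min_regionsD(3)[OF C(1)] min_regionsD(3)[OF C(2)] ge]
  show "C \<inter> D \<in> min_regions X" "C \<union> D \<in> min_regions X" using r d e(1,2) by (simp_all add: min_regions_def)
  show "nb (C \<inter> D) = (nb C \<inter> D) \<union> (nb C \<inter> nb D) \<union> (C \<inter> nb D)" by (rule e(3))
qed

lemma min_regions_Union:
  assumes "base X" "finite \<C>" "\<C> \<noteq> {}" "\<C> \<subseteq> min_regions X" shows "\<Union>\<C> \<in> min_regions X"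
  using assms(2-4) by (induction \<C> rule: finite_ne_induct) (auto intro: min_regions_lattice(2)[OF assms(1)])

text \<open>The second conjunct iterates the exact formula for \<open>nb (C \<inter> D)\<close>. It
  serves to collect many vertices on one boundary of size \<open>c\<close>.\<close>

lemma min_regions_Inter:
  assumes X: "base X" and "finite I" "I \<noteq> {}" "\<And>i. i \<in> I \<Longrightarrow> Q i \<in> min_regions X"
  shows "(\<Inter>i\<in>I. Q i) \<in> min_regions X \<and>
    (\<forall>w. (\<forall>i\<in>I. w \<in> Q i \<union> nb (Q i)) \<longrightarrow> (\<exists>i\<in>I. w \<in> nb (Q i)) \<longrightarrow> w \<in> nb (\<Inter>i\<in>I. Q i))"
  using assms(2-4)
proof (induction I rule: finite_ne_induct)
  case (singleton i)
  then show ?case by simp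
next
  case (insert i I)
  let ?R = "\<Inter>i\<in>I. Q i"
  have R: "?R \<in> min_regions X" and w: "\<And>w. \<forall>i\<in>I. w \<in> Q i \<union> nb (Q i) \<Longrightarrow> \<exists>i\<in>I. w \<in> nb (Q i) \<Longrightarrow> w \<in> nb ?R"
    using insert by blast+
  have Qi: "Q i \<in> min_regions X" using insert by blast
  note l = min_regions_lattice[OF X Qi R]
  have "w \<in> nb (Q i \<inter> ?R)" if 1: "\<forall>j\<in>insert i I. w \<in> Q j \<union> nb (Q j)" and 2: "\<exists>j\<in>insert i I. w \<in> nb (Q j)" for w
  proof (cases "\<exists>j\<in>I. w \<in> nb (Q j)")
    case True
    then have "w \<in> nb ?R" using w 1 by blast
    then show ?thesis unfolding l(3) using 1 by blast
  next
    case False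
    then have "w \<in> ?R" "w \<in> nb (Q i)" using 1 2 by blast+
    then show ?thesis unfolding l(3) by blast
  qed
  then show ?case using l(1) by simp
qed

text \<open>Finitely many boundary vertices of the union already lie on the boundary of a finite
  union of members, which has size \<open>c\<close>.\<close>

lemma outer_min_regions:
  assumes X: "base X" shows "outer X \<in> min_regions X"
proof -
  obtain C0 where C0: "C0 \<in> min_regions X" using ex_min_regions_below[OF X region_UNIV] by blast
  have sub: "C0 \<subseteq> outer X" using C0 by (auto simp: outer_def)
  have "finite (nb (outer X)) \<and> card (nb (outer X)) \<le> c"
  proof (rule finite_if_finite_subsets_card_bdd)
    fix S assume S: "S \<subseteq> nb (outer X)" "finite S"
    have "\<exists>C\<in>min_regions X. \<exists>y\<in>C. adj w y" if "w \<in> S" for w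
      using that S(1) unfolding nb_def outer_def by blast
    then obtain C where C: "\<And>w. w \<in> S \<Longrightarrow> C w \<in> min_regions X" "\<And>w. w \<in> S \<Longrightarrow> \<exists>y\<in>C w. adj w y" by metis
    \<comment> \<open>\<open>C0\<close> keeps the union nonempty when \<open>S\<close> is
      empty.\<close>
    let ?U = "\<Union>(insert C0 (C ` S))"
    have U: "?U \<in> min_regions X" using S(2) C(1) C0 by (intro min_regions_Union[OF X]) auto
    have "S \<subseteq> nb ?U"
    proof
      fix w assume w: "w \<in> S"
      have "?U \<subseteq> outer X" using C(1) C0 by (auto simp: outer_def)
      then have "w \<notin> ?U" using w S(1) nb_disjoint[of "outer X"] by blast
      then show "w \<in> nb ?U" using C(2)[OF w] w unfolding nb_def by blast
    qed
    then have "card S \<le> card (nb ?U)" using min_regionsD(4)[OF U] by (rule card_mono[rotated])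
    then show "card S \<le> c" using min_regionsD(3)[OF U] by simp
  qed
  moreover from this have "region (outer X)" using region_mono[OF min_regionsD(1)[OF C0] sub] by blast
  moreover have "outer X \<inter> X = {}" using min_regionsD(2) by (auto simp: outer_def)
  ultimately show ?thesis by (intro min_regionsI[OF X]) auto
qed

lemma outer_greatest: "C \<in> min_regions X \<Longrightarrow> C \<subseteq> outer X"
  by (auto simp: outer_def)

lemma outer_anti: "X \<subseteq> Y \<Longrightarrow> outer Y \<subseteq> outer X"
  unfolding outer_def using min_regions_anti by blast

lemma outer_image:
  assumes g: "g \<in> autos" shows "outer (g ` X) = g ` outer X"
proof
  show "g ` outer X \<subseteq> outer (g ` X)"
    unfolding outer_def using min_regions_image[OF g] by blast
  have "inv g ` C \<in> min_regions X" if "C \<in> min_regions (g ` X)" for C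
    using min_regions_image[OF inv_autos[OF g] that] image_inv_autos(2)[OF g, of X] by simp
  then have "C \<subseteq> g ` outer X" if "C \<in> min_regions (g ` X)" for C
    using that image_inv_autos(1)[OF g, of C] unfolding outer_def by blast
  then show "outer (g ` X) \<subseteq> g ` outer X" by (auto simp: outer_def)
qed

text \<open>The component of \<open>D\<close> that contains a tail of one ray is a region. Every
  connected region inside \<open>D\<close> meets it and so lies in it; hence the union is this
  component.\<close>

lemma core_region:
  assumes D: "region D"
  shows "conn (core D)" "region (core D)" "core D \<subseteq> D" "nb (core D) \<subseteq> nb D"
proof -
  obtain r where r: "is_ray r" using ex_ray by blast
  obtain m where m: "\<And>n. n \<ge> m \<Longrightarrow> r n \<in> D" using region_ray[OF D r] by (auto simp: MOST_nat_le)
  let ?K = "component D (r m)"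
  have rD: "r m \<in> D" using m by simp
  have K: "conn ?K" "?K \<subseteq> D" "nb ?K \<inter> D = {}" using rD conn_component component_subset nb_component by auto
  have nK: "nb ?K \<subseteq> nb D" using K(2,3) unfolding nb_def by blast
  have "r n \<in> ?K" if "n \<ge> m" for n
    using that
  proof (induction rule: dec_induct)
    case (step n)
    have "adj (r (Suc n)) (r n)" using r adj_sym by (auto simp: is_ray_def)
    moreover have "r (Suc n) \<in> D" using m step by simp
    ultimately show ?case using step K(3) nbI[of "r (Suc n)" ?K "r n"] by blast
  qed (rule component_self)
  then have "MOST n. r n \<in> ?K" by (auto simp: MOST_nat_le)
  then have reg: "region ?K" using finite_subset[OF nK region_finite[OF D]] r by (intro regionI_ray)
  have "K' \<subseteq> ?K" if "conn K'" "region K'" "K' \<subseteq> D" for K'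
  proof -
    have "nb ?K \<inter> K' = {}" using K(3) that(3) by blast
    then show ?thesis using region_meets[OF that(2) reg] that(1) unfolding conn_def by blast
  qed
  then have "core D = ?K" unfolding core_def using K reg by blast
  then show "conn (core D)" "region (core D)" "core D \<subseteq> D" "nb (core D) \<subseteq> nb D" using K reg nK by simp_all
qed

lemma core_greatest: "conn K \<Longrightarrow> region K \<Longrightarrow> K \<subseteq> D \<Longrightarrow> K \<subseteq> core D"
  by (auto simp: core_def)

lemma core_mono: "C \<subseteq> D \<Longrightarrow> core C \<subseteq> core D"
  unfolding core_def by blast

lemma core_min_regions:
  assumes X: "base X" and C: "C \<in> min_regions X" shows "core C \<in> min_regions X"
proof (rule min_regionsI[OF X])
  note k = core_region[OF min_regionsD(1)[OF C]]
  show "region (core C)" by (rule k)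
  show "core C \<inter> X = {}" using k(3) min_regionsD(2)[OF C] by blast
  show "card (nb (core C)) \<le> c" using card_mono[OF min_regionsD(4)[OF C] k(4)] min_regionsD(3)[OF C] by simp
qed

text \<open>\<open>D n\<close> omits ever longer initial segments of a ray. The intersection
  \<open>I\<close> has a finite boundary and contains no tail of a ray, so it can be
  subtracted.\<close>

lemma ex_exhaustion:
  "\<exists>C. (\<forall>n. C n \<in> min_regions X0 \<and> conn (C n) \<and> C (Suc n) \<subseteq> C n) \<and> (\<Inter>n. C n) = {}"
proof -
  obtain r where r: "is_ray r" using ex_ray by blast
  define D where "D n = outer (X0 \<union> r ` {..n})" for n
  have base: "base (X0 \<union> r ` {..n})" for n by (rule base_mono[OF base_X0]) (auto simp: finite_X0)
  have Df: "D n \<in> min_regions (X0 \<union> r ` {..n})" for n unfolding D_def by (rule outer_min_regions[OF base])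
  have anti: "D n \<subseteq> D m" if "m \<le> n" for m n
    unfolding D_def using that by (intro outer_anti) auto
  have rD: "r n \<notin> D n" for n using min_regionsD(2)[OF Df[of n]] by auto
  define I where "I = (\<Inter>n. D n)"
  have far: "\<exists>n. S \<inter> D n = {}" if "finite S" "S \<inter> I = {}" for S
    using that
  proof (induction S)
    case (insert w S)
    then obtain n where n: "S \<inter> D n = {}" by auto
    obtain m where m: "w \<notin> D m" using insert by (auto simp: I_def)
    have "insert w S \<inter> D (max m n) = {}" using n m anti[of m "max m n"] anti[of n "max m n"] by auto
    then show ?case ..
  qed simp
  have "finite (nb I) \<and> card (nb I) \<le> c"
  proof (rule finite_if_finite_subsets_card_bdd)
    fix S assume S: "S \<subseteq> nb I" "finite S"
    then obtain n where n: "S \<inter> D n = {}" using far[of S] nb_disjoint[of I] by blast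
    have "S \<subseteq> nb (D n)" using S(1) n unfolding nb_def I_def by blast
    then have "card S \<le> card (nb (D n))" by (rule card_mono[OF min_regionsD(4)[OF Df]])
    then show "card S \<le> c" unfolding min_regionsD(3)[OF Df] .
  qed
  then have finI: "finite (nb I)" by blast
  have "\<not> region I"
  proof
    assume "region I"
    then have "MOST n. r n \<in> I" using r region_ray by blast
    then show False using rD by (auto simp: MOST_nat_le I_def)
  qed
  then have outI: "MOST n. s n \<notin> I" if "is_ray s" for s
    using ray_tail_dichotomy[OF that finI] regionI_ray[OF finI that] by blast
  \<comment> \<open>From \<open>n0\<close> on no vertex of \<open>D n\<close> outside
    \<open>I\<close> is adjacent to \<open>I\<close>, so deleting \<open>I\<close> creates no new
    boundary vertices.\<close>
  obtain n0 where n0: "nb I \<inter> D n0 = {}" using far[OF finI] nb_disjoint[of I] by blast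
  define E where "E n = D (n0 + n) - I" for n
  have nE: "nb (E n) \<subseteq> nb (D (n0 + n))" for n
  proof
    fix z assume "z \<in> nb (E n)"
    then obtain e where e: "z \<notin> E n" "e \<in> D (n0 + n)" "e \<notin> I" "adj z e" unfolding nb_def E_def by blast
    have "e \<in> D n0" using e(2) anti[of n0 "n0 + n"] by auto
    then have "z \<notin> I" using n0 e(3) nbI[OF e(3) _ adj_sym[OF e(4)]] by blast
    then show "z \<in> nb (D (n0 + n))" using e by (intro nbI[of _ _ e]) (auto simp: E_def)
  qed
  have Ef: "E n \<in> min_regions X0" for n
  proof (rule min_regionsI[OF base_X0])
    show "region (E n)"
      unfolding region_def
    proof (intro conjI allI impI)
      show "finite (nb (E n))" using nE min_regionsD(4)[OF Df] by (rule finite_subset)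
      show "MOST j. s j \<in> E n" if "is_ray s" for s
        using MOST_conjI[OF region_ray[OF min_regionsD(1)[OF Df[of "n0 + n"]] that] outI[OF that]] by (simp add: E_def)
    qed
    show "E n \<inter> X0 = {}" using min_regionsD(2)[OF Df[of "n0 + n"]] by (auto simp: E_def)
    show "card (nb (E n)) \<le> c" using card_mono[OF min_regionsD(4)[OF Df] nE] unfolding min_regionsD(3)[OF Df] .
  qed
  have "core (E n) \<in> min_regions X0 \<and> conn (core (E n)) \<and> core (E (Suc n)) \<subseteq> core (E n)" for n
  proof -
    have "E (Suc n) \<subseteq> E n" using anti[of "n0 + n" "n0 + Suc n"] by (auto simp: E_def)
    then show ?thesis using core_min_regions[OF base_X0 Ef] core_region(1)[OF min_regionsD(1)[OF Ef]] core_mono by blast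
  qed
  moreover have "(\<Inter>n. core (E n)) = {}"
  proof -
    have s1: "(\<Inter>n. core (E n)) \<subseteq> (\<Inter>n. D (n0 + n)) - I"
      using core_region(3)[OF min_regionsD(1)[OF Ef]] by (auto simp: E_def)
    have s2: "(\<Inter>n. D (n0 + n)) \<subseteq> I"
    proof -
      have "(\<Inter>n. D (n0 + n)) \<subseteq> D m" for m using anti[of m "n0 + m"] by auto
      then show ?thesis unfolding I_def by (intro INT_greatest)
    qed
    show ?thesis using s1 unfolding Diff_eq_empty_iff[THEN iffD2, OF s2] by (rule subset_empty[THEN iffD1])
  qed
  ultimately show ?thesis by (intro exI[of _ "\<lambda>n. core (E n)"]) simp
qed

text \<open>Otherwise the sets \<open>(inv h)^j P\<close> form a strictly increasing chain, and the vertices leaving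
  their boundaries all lie in the rayless complement of \<open>P\<close>, contradicting \<open>ranked_star\<close>.\<close>

lemma min_regions_no_translation:
  assumes P: "P \<in> min_regions X0" "conn P" and h: "h \<in> autos" and sub: "h ` P \<subseteq> P"
  shows "h ` P = P"
proof -
  define f where "f j = (inv h) ^^ j" for j :: nat
  have f: "f j \<in> autos" for j
    unfolding f_def
  proof (induction j)
    case 0
    show ?case unfolding funpow.simps by (rule id_autos)
  next
    case (Suc j)
    then show ?case unfolding funpow.simps by (intro comp_autos inv_autos h)
  qed
  define C where "C j = f j ` P" for j
  have fSuc: "f (Suc j) ` P = f j ` (inv h ` P)" for j
    unfolding f_def by (simp add: image_comp funpow_Suc_right del: funpow.simps)
  have "P \<subseteq> inv h ` P" using image_mono[OF sub, of "inv h"] image_inv_autos(2)[OF h] by simp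
  then have "C j \<subseteq> C (Suc j)" for j unfolding C_def fSuc by (rule image_mono)
  then have asc: "C i \<subseteq> C j" if "i \<le> j" for i j using that by (rule lift_Suc_mono_le)
  have C0: "C 0 = P" by (simp add: C_def f_def)
  have reg: "region (C j)" "card (nb (C j)) = c" for j
    unfolding C_def using region_image[OF f] card_nb_image[OF f] min_regionsD[OF P(1)] by auto
  have low: "c \<le> card (nb E)" if E: "region E" "E \<subseteq> C j" for E j
  proof -
    have "inv (f j) ` E \<subseteq> P" using image_mono[OF E(2), of "inv (f j)"] image_inv_autos(2)[OF f] by (simp add: C_def)
    then have "inv (f j) ` E \<inter> X0 = {}" using min_regionsD(2)[OF P(1)] by blast
    then have "c \<le> card (nb (inv (f j) ` E))" by (rule X0_ge[OF region_image[OF inv_autos[OF f] E(1)]])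
    then show ?thesis unfolding card_nb_image[OF inv_autos[OF f]] .
  qed
  define U where "U = (\<Union>j. C j)"
  \<comment> \<open>Every vertex of \<open>Z\<close> has a neighbour in some \<open>C j\<close>, so
    it lies on the boundary from then on.\<close>
  define Z where "Z = nb U"
  have absorb: "\<exists>j. S \<subseteq> C j" if "finite S" "S \<subseteq> U" for S
    using that
  proof (induction S)
    case (insert w S)
    then obtain i where i: "S \<subseteq> C i" by auto
    obtain j where j: "w \<in> C j" using insert by (auto simp: U_def)
    have "insert w S \<subseteq> C (max i j)" using i j asc[of i "max i j"] asc[of j "max i j"] by auto
    then show ?case ..
  qed simp
  have stay: "\<exists>j. \<forall>i\<ge>j. S \<subseteq> nb (C i)" if S: "finite S" "S \<subseteq> Z" for S
  proof -
    have "\<exists>u\<in>U. adj w u" if "w \<in> S" for w using that S(2) unfolding Z_def nb_def by blast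
    then obtain u where u: "\<And>w. w \<in> S \<Longrightarrow> u w \<in> U \<and> adj w (u w)" by metis
    then obtain j where j: "u ` S \<subseteq> C j" using absorb[of "u ` S"] S(1) by blast
    have "S \<subseteq> nb (C i)" if "i \<ge> j" for i
    proof
      fix w assume w: "w \<in> S"
      have "w \<notin> C i" using w S(2) nb_disjoint[of U] unfolding Z_def U_def by blast
      moreover have "u w \<in> C i" using asc[OF that] j w by blast
      ultimately show "w \<in> nb (C i)" using u[OF w] nbI by blast
    qed
    then show ?thesis by blast
  qed
  have Z: "finite Z \<and> card Z \<le> c"
  proof (rule finite_if_finite_subsets_card_bdd)
    fix S assume S: "S \<subseteq> Z" "finite S"
    obtain j where "\<forall>i\<ge>j. S \<subseteq> nb (C i)" using stay[OF S(2,1)] ..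
    then have "S \<subseteq> nb (C j)" by simp
    then have "card S \<le> card (nb (C j))" by (rule card_mono[OF region_finite[OF reg(1)]])
    then show "card S \<le> c" unfolding reg(2) .
  qed
  have "card Z = c"
  proof (rule ccontr)
    assume "card Z \<noteq> c"
    then have less: "card Z < c" using Z by simp
    define A where "A = (\<Union>j. nb (C j) - Z)"
    have AU: "A \<subseteq> U"
    proof
      fix v assume "v \<in> A"
      then obtain j where "v \<in> nb (C j)" "v \<notin> nb U" unfolding A_def Z_def by blast
      then show "v \<in> U" unfolding nb_def U_def by blast
    qed
    have "infinite A"
    proof
      assume "finite A"
      then obtain J where "A \<subseteq> C J" using absorb AU by blast
      then have "nb (C J) - Z \<subseteq> C J" unfolding A_def by blast
      then have "nb (C J) \<subseteq> Z" using nb_disjoint[of "C J"] by blast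
      then have "c \<le> card Z" using card_mono[of Z "nb (C J)"] Z reg(2) by simp
      then show False using less by simp
    qed
    define X where "X = - (P \<union> nb P)"
    have "ranked X"
    proof (rule rayless_ranked)
      fix r assume r: "is_ray r" "range r \<subseteq> X"
      then have "MOST n. r n \<in> P" using region_ray min_regionsD(1)[OF P(1)] by blast
      then obtain n where "r n \<in> P" by (auto simp: MOST_nat_le)
      then show False using r(2) by (auto simp: X_def)
    qed
    moreover have "finite (nb X)"
      unfolding X_def using nb_Compl_closure min_regionsD(4)[OF P(1)] by (rule finite_subset)
    moreover have "infinite (X \<inter> A)"
    proof
      assume fin: "finite (X \<inter> A)"
      have "P \<inter> A = {}"
      proof (rule ccontr)
        assume "P \<inter> A \<noteq> {}"
        then obtain v j where "v \<in> P" "v \<in> nb (C j)" unfolding A_def by blast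
        then show False using asc[of 0 j] C0 nb_disjoint[of "C j"] by blast
      qed
      then have "A \<subseteq> (X \<inter> A) \<union> nb P" unfolding X_def by blast
      then show False using fin min_regionsD(4)[OF P(1)] \<open>infinite A\<close> by (meson finite_UnI finite_subset)
    qed
    ultimately obtain T \<D> where T: "finite T" and inf: "infinite \<D>"
      and \<D>: "\<And>D. D \<in> \<D> \<Longrightarrow> conn D \<and> nb D = T \<and> D \<subseteq> X \<and> finite (D \<inter> A) \<and> D \<inter> A \<noteq> {}"
      using ranked_star[of X A] by auto
    have disj: "D \<inter> E = {}" if "D \<in> \<D>" "E \<in> \<D>" "D \<noteq> E" for D E
      using same_nb_disjoint[of D E T] \<D>[OF that(1)] \<D>[OF that(2)] that(3) by blast
    \<comment> \<open>All vertices of \<open>T\<close> that ever enter the chain lie in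
      \<open>C J\<close>. A member \<open>D\<close> off the boundaries up to stage \<open>J\<close>
      is disjoint from \<open>C J\<close>, and its vertex in \<open>A\<close> comes from a later
      boundary.\<close>
    obtain J where J: "T \<inter> U \<subseteq> C J" using absorb[of "T \<inter> U"] T by blast
    define S where "S = (\<Union>j\<le>J. nb (C j))"
    have "finite S" unfolding S_def using region_finite[OF reg(1)] by blast
    then have "infinite {D\<in>\<D>. D \<inter> S = {}}" using infinite_disjoint_avoid[OF inf disj] by blast
    then obtain D where D: "D \<in> \<D>" "D \<inter> S = {}" by (metis (mono_tags, lifting) finite.emptyI mem_Collect_eq ex_in_conv)
    obtain v j where v: "v \<in> D" "v \<in> nb (C j)" "v \<notin> Z" using \<D>[OF D(1)] unfolding A_def by blast
    have "J < j"
    proof (rule ccontr)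
      assume "\<not> J < j"
      then have "v \<in> S" using v unfolding S_def by auto
      then show False using D v by blast
    qed
    have nJ: "nb (C J) \<inter> D = {}" using D(2) unfolding S_def by blast
    moreover have "v \<notin> C J" using v(2) asc[of J j] \<open>J < j\<close> nb_disjoint[of "C j"] by auto
    ultimately have DJ: "D \<inter> C J = {}" using \<D>[OF D(1)] v(1) unfolding conn_def by blast
    \<comment> \<open>Deleting \<open>D\<close> loses the boundary vertex \<open>v\<close>. A new
      boundary vertex in \<open>D\<close> would have a neighbour in \<open>T \<inter> U\<close>,
      hence in \<open>C J\<close>, and would lie on \<open>nb (C J)\<close>, which \<open>D\<close>
      avoids.\<close>
    have "nb (C j - D) \<subseteq> nb (C j) - {v}"
    proof
      fix z assume "z \<in> nb (C j - D)"
      then obtain y where y: "z \<notin> C j - D" "y \<in> C j" "y \<notin> D" "adj z y" unfolding nb_def by blast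
      have "z \<notin> D"
      proof
        assume zD: "z \<in> D"
        then have "y \<in> nb D" using y adj_sym nbI by blast
        then have "y \<in> T" using \<D>[OF D(1)] by simp
        moreover have "y \<in> U" using y(2) by (auto simp: U_def)
        ultimately have "y \<in> C J" using J by blast
        then have "z \<in> nb (C J)" using y(4) zD DJ nbI[of z "C J" y] by blast
        then show False using nJ zD by blast
      qed
      then show "z \<in> nb (C j) - {v}" using y v(1) nbI[of z "C j" y] by blast
    qed
    moreover have fin: "finite (nb (C j))" using region_finite[OF reg(1)] .
    ultimately have "card (nb (C j - D)) \<le> card (nb (C j) - {v})" and finE: "finite (nb (C j - D))"
      by (auto intro: card_mono finite_subset)
    moreover have "card (nb (C j) - {v}) < card (nb (C j))" using fin v(2) by (rule card_Diff1_less)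
    moreover have "region (C j - D)"
      using asc[of J j] \<open>J < j\<close> DJ finE by (intro region_mono[OF reg(1)[of J]]) auto
    then have "c \<le> card (nb (C j - D))" by (rule low) blast
    ultimately show False using reg(2)[of j] by simp
  qed
  \<comment> \<open>By cardinality \<open>Z\<close> is the whole boundary of both sets. Pulled back
    by \<open>f j\<close>, this says that \<open>P\<close> and its image under \<open>inv h\<close>
    have the same boundary.\<close>
  then obtain j where j: "Z \<subseteq> nb (C j)" "Z \<subseteq> nb (C (Suc j))" using stay[of Z] Z by (meson le_SucI order_refl)
  have "Z = nb (C i)" if "Z \<subseteq> nb (C i)" for i
    using card_subset_eq[OF region_finite[OF reg(1)] that] reg(2) \<open>card Z = c\<close> by simp
  then have "nb (C j) = nb (C (Suc j))" using j by blast
  then have "f j ` nb P = f j ` nb (inv h ` P)" unfolding C_def fSuc nb_image[OF f] .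
  then have "nb P = nb (inv h ` P)" using image_inv_autos(2)[OF f[of j]] by metis
  then have "h ` nb P = nb P" using nb_image[OF inv_autos[OF h], of P] image_inv_autos(1)[OF h, of "nb P"] by simp
  then have nhP: "nb (h ` P) \<inter> P = {}" using nb_image[OF h] nb_disjoint[of P] by simp
  have "P \<inter> h ` P \<noteq> {}" using region_meets[OF min_regionsD(1)[OF P(1)] region_image[OF h min_regionsD(1)[OF P(1)]]] .
  then have "P \<subseteq> h ` P" using P(2) nhP unfolding conn_def by blast
  then show ?thesis using sub by blast
qed

end

section \<open>Exhaustions and the Baire category argument\<close>

locale exhausted_end = based_end adj V k c X0 for adj :: "'a \<Rightarrow> 'a \<Rightarrow> bool" and V k c X0 +
  fixes C :: "nat \<Rightarrow> 'a set"
  assumes C_min_regions: "C n \<in> min_regions X0" and C_conn: "conn (C n)" and C_Suc: "C (Suc n) \<subseteq> C n"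
    and C_Inter: "(\<Inter>n. C n) = {}"
begin

lemma C_anti: "m \<le> n \<Longrightarrow> C n \<subseteq> C m"
  using C_Suc by (rule lift_Suc_antimono_le)

lemma C_avoids:
  assumes "finite S" shows "MOST n. C n \<inter> S = {}"
proof -
  have "MOST n. x \<notin> C n" for x
  proof -
    obtain m where "x \<notin> C m" using C_Inter by blast
    then show ?thesis using C_anti[of m] by (auto simp: MOST_nat_le)
  qed
  then have "MOST n. \<forall>x\<in>S. x \<notin> C n" using assms by (simp add: MOST_finite_Ball_distrib)
  then show ?thesis by (rule MOST_mono) blast
qed

lemma C_below:
  assumes D: "region D" shows "MOST n. C n \<subseteq> D"
  using C_avoids[OF region_finite[OF D]]
proof (rule MOST_mono)
  fix n assume "C n \<inter> nb D = {}"
  then show "C n \<subseteq> D" using C_conn[of n] region_meets[OF min_regionsD(1)[OF C_min_regions[of n]] D] unfolding conn_def by blast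
qed

lemma MOST_nat_ex:
  assumes "MOST n::nat. P n" shows "\<exists>n\<ge>N. P n"
proof -
  obtain m where "\<forall>n\<ge>m. P n" using assms by (auto simp: MOST_nat_le)
  then show ?thesis by (intro exI[of _ "max m N"]) simp
qed

text \<open>A Baire category argument for the topology with the stabilisers of the sets \<open>- C n\<close> as
  neighbourhoods of the identity.\<close>

lemma trivial_stabiliser:
  assumes few: "\<not> (UNIV :: nat set set) \<lesssim> autos"
  shows "\<exists>n. \<forall>g\<in>autos. (\<forall>x. x \<notin> C n \<longrightarrow> g x = x) \<longrightarrow> g = id"
proof (rule ccontr)
  assume "\<not> ?thesis"
  then have "\<exists>g. g \<in> autos \<and> (\<forall>x. x \<notin> C n \<longrightarrow> g x = x) \<and> g \<noteq> id" for n by blast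
  then obtain u where u: "\<And>n. u n \<in> autos" "\<And>n x. x \<notin> C n \<Longrightarrow> u n x = x" "\<And>n. u n \<noteq> id" by metis
  \<comment> \<open>\<open>fst p\<close> will contain all products of the factors chosen so far;
    their inverses map the complement of \<open>C n\<close> into that of \<open>C (snd p)\<close>,
    as \<open>pull\<close> demands. The next factor is \<open>u (snd p)\<close>, and
    \<open>nxt\<close> lets the index grow until a vertex moved by it is exposed.\<close>
  define good where "good n p \<longleftrightarrow> finite (fst p) \<and> fst p \<subseteq> autos \<and> snd p \<ge> n \<and> (n = 0 \<longrightarrow> id \<in> fst p) \<and>
    (\<forall>h\<in>fst p. \<forall>x. x \<notin> C n \<longrightarrow> inv h x \<notin> C (snd p))" for n and p :: "('a \<Rightarrow> 'a) set \<times> nat"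
  define nxt where "nxt n p q \<longleftrightarrow> snd p \<le> snd q \<and> (\<exists>x. x \<notin> C (snd q) \<and> u (snd p) x \<noteq> x) \<and>
    fst q = fst p \<union> (\<lambda>h. h \<circ> u (snd p)) ` fst p" for n :: nat and p q :: "('a \<Rightarrow> 'a) set \<times> nat"
  have "\<exists>f. \<forall>n. good n (f n) \<and> nxt n (f n) (f (Suc n))"
  proof (rule dependent_nat_choice)
    show "\<exists>p. good 0 p" by (rule exI[of _ "({id}, 0)"]) (simp add: good_def id_autos)
  next
    fix p n assume p: "good n p"
    define H where "H = fst p \<union> (\<lambda>h. h \<circ> u (snd p)) ` fst p"
    have H: "finite H" "H \<subseteq> autos" using p comp_autos u(1) by (auto simp: H_def good_def)
    have "MOST m. C m \<subseteq> inv h ` C (Suc n)" if "h \<in> H" for h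
      using H(2) that by (intro C_below region_image inv_autos min_regionsD(1)[OF C_min_regions]) auto
    then have 1: "MOST m. \<forall>h\<in>H. C m \<subseteq> inv h ` C (Suc n)" using H(1) by (simp add: MOST_finite_Ball_distrib)
    obtain x where x: "u (snd p) x \<noteq> x" using u(3)[of "snd p"] by (auto simp: fun_eq_iff)
    have 2: "MOST m. C m \<inter> {x} = {}" by (rule C_avoids) simp
    obtain m where m: "m \<ge> max (snd p) (Suc n)" "\<forall>h\<in>H. C m \<subseteq> inv h ` C (Suc n)" "C m \<inter> {x} = {}"
      using MOST_nat_ex[OF MOST_conjI[OF 1 2], of "max (snd p) (Suc n)"] by auto
    have "inv h y \<notin> C m" if "h \<in> H" "y \<notin> C (Suc n)" for h y
    proof
      assume "inv h y \<in> C m"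
      then have "inv h y \<in> inv h ` C (Suc n)" using m(2) that(1) by blast
      moreover have "inv h \<in> autos" using that(1) H(2) inv_autos by blast
      ultimately show False using that(2) mem_image_autos by blast
    qed
    then have "good (Suc n) (H, m)" using H m(1) by (simp add: good_def)
    moreover have "nxt n p (H, m)" using m x by (auto simp: nxt_def H_def)
    ultimately show "\<exists>q. good (Suc n) q \<and> nxt n p q" by blast
  qed
  then obtain f where f: "\<And>n. good n (f n)" "\<And>n. nxt n (f n) (f (Suc n))" by blast
  define v where "v n = u (snd (f n))" for n
  have pp: "pprod v I n \<in> fst (f n)" for I n
  proof (induction n)
    case 0
    have "id \<in> fst (f 0)" using f(1)[of 0] unfolding good_def by blast
    then show ?case unfolding pprod.simps .
  next
    case (Suc n)
    have "fst (f (Suc n)) = fst (f n) \<union> (\<lambda>h. h \<circ> v n) ` fst (f n)" using f(2)[of n] by (simp add: nxt_def v_def)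
    then show ?case unfolding pprod.simps using Suc by (cases "n \<in> I") (auto simp del: comp_apply)
  qed
  have "(UNIV :: nat set set) \<lesssim> autos"
  proof (rule continuum_many_autos[where u = v and W = "\<lambda>n. - C (snd (f n))" and B = "\<lambda>n. - C n"])
    show "v n \<in> autos" for n unfolding v_def by (rule u(1))
    have le: "snd (f n) \<le> snd (f (Suc n))" for n using f(2)[of n] by (simp add: nxt_def)
    show "- C (snd (f n)) \<subseteq> - C (snd (f (Suc n)))" for n using C_anti[OF le] by blast
    show "\<exists>n. x \<in> - C n" for x using C_Inter by blast
    show "\<exists>n. x \<in> - C (snd (f n))" for x
    proof -
      obtain n where "x \<notin> C n" using C_Inter by blast
      moreover have "n \<le> snd (f n)" using f(1)[of n] by (simp add: good_def)
      ultimately show ?thesis using C_anti by blast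
    qed
    show "v n x = x" if "x \<in> - C (snd (f n))" for n x unfolding v_def using that u(2) by blast
    show "\<exists>x\<in>- C (snd (f (Suc n))). v n x \<noteq> x" for n using f(2)[of n] by (auto simp: nxt_def v_def)
    show "inv (pprod v I n) x \<in> - C (snd (f n))" if "x \<in> - C n" for I n x
      using f(1)[of n] pp[of I n] that by (auto simp: good_def)
  qed
  then show False using few by blast
qed

section \<open>A finite set with trivial pointwise stabiliser\<close>

lemma rayless_complement:
  assumes "region P" shows "ranked (- (P \<union> nb P))" "finite (nb (- (P \<union> nb P)))"
proof -
  show "finite (nb (- (P \<union> nb P)))" using nb_Compl_closure region_finite[OF assms] by (rule finite_subset)
  show "ranked (- (P \<union> nb P))"
  proof (rule rayless_ranked)
    fix r assume r: "is_ray r" "range r \<subseteq> - (P \<union> nb P)"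
    obtain n where "r n \<in> P" using region_ray[OF assms r(1)] by (auto simp: MOST_nat_le)
    then show False using r(2) by auto
  qed
qed

lemma image_eq_of_fixed_boundary:
  assumes P: "conn P" "region P" and g: "g \<in> autos" "\<And>x. x \<in> nb P \<Longrightarrow> g x = x"
  shows "g ` P = P"
proof -
  have "nb (g ` P) = nb P" unfolding nb_image[OF g(1)] using g(2) by auto
  moreover obtain x where "x \<in> P" "x \<in> g ` P" using region_meets[OF P(2) region_image[OF g(1) P(2)]] by blast
  moreover have "nb (g ` P) \<inter> P = {}" "nb P \<inter> g ` P = {}"
    using \<open>nb (g ` P) = nb P\<close> nb_disjoint[of P] nb_disjoint[of "g ` P"] by simp_all
  ultimately show ?thesis using conn_eqI[OF conn_image[OF g(1) P(1)] P(1)] by blast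
qed

text \<open>Fixing \<open>nb (C n)\<close> pointwise makes \<open>g\<close> preserve
  \<open>C n\<close> and its rayless complement. \<open>F\<close> makes \<open>g\<close> trivial on
  the complement, and \<open>trivial_stabiliser\<close> settles the rest.\<close>

lemma finite_base:
  assumes few: "\<not> (UNIV :: nat set set) \<lesssim> autos"
  shows "\<exists>F. finite F \<and> (\<forall>g\<in>autos. (\<forall>x\<in>F. g x = x) \<longrightarrow> g = id)"
proof -
  obtain n where n: "\<forall>g\<in>autos. (\<forall>x. x \<notin> C n \<longrightarrow> g x = x) \<longrightarrow> g = id" using trivial_stabiliser[OF few] ..
  let ?P = "C n"
  note reg = min_regionsD(1)[OF C_min_regions[of n]]
  define X where "X = - (?P \<union> nb ?P)"
  have X: "ranked X" "finite (nb X)" "nb X \<subseteq> nb ?P"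
    unfolding X_def using rayless_complement[OF reg] nb_Compl_closure by auto
  obtain F where F: "finite F" "\<forall>g\<in>autos. (\<forall>x. x \<notin> X \<longrightarrow> g x = x) \<longrightarrow> (\<forall>x\<in>F. g x = x) \<longrightarrow> g = id"
    using ranked_base[OF few X(1,2)] by auto
  have "g = id" if g: "g \<in> autos" "\<forall>x\<in>nb ?P \<union> F. g x = x" for g
  proof -
    have gP: "g ` ?P = ?P" using g by (intro image_eq_of_fixed_boundary C_conn reg) auto
    have gX: "g ` X = X"
      unfolding X_def bij_image_Compl_eq[OF autos_bij[OF g(1)]] image_Un using gP nb_image[OF g(1), of ?P] by simp
    let ?r = "\<lambda>x. if x \<in> X then g x else x"
    have "?r \<in> autos" using g X(3) by (intro restrict_autos gX) auto
    then have r: "?r = id" using F(2) g(2) by auto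
    have "g x = x" if "x \<notin> ?P" for x
    proof (cases "x \<in> X")
      case True
      then show ?thesis using fun_cong[OF r, of x] by simp
    next
      case False
      then show ?thesis using that g(2) by (auto simp: X_def)
    qed
    then show ?thesis using n g(1) by blast
  qed
  then show ?thesis using F(1) region_finite[OF reg] by (intro exI[of _ "nb ?P \<union> F"]) auto
qed

section \<open>Canonical regions far out\<close>

text \<open>A vertex that occurs infinitely often as \<open>v m\<close> lies on almost all
  boundaries, that is, in \<open>Z\<close>. No \<open>nb (C n)\<close> is contained in
  \<open>Z\<close>: otherwise the boundaries would be eventually constant, and by connectedness some
  \<open>C N\<close> would lie in every \<open>C m\<close>.\<close>

lemma ex_boundary_sequence: "\<exists>v. \<forall>n. v n \<in> nb (C n) \<and> (\<forall>w. finite {m. v m = w})"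
proof -
  define Z where "Z = {w. MOST n. w \<in> nb (C n)}"
  have "\<not> nb (C n) \<subseteq> Z" for n
  proof
    assume "nb (C n) \<subseteq> Z"
    then have "MOST m. \<forall>w\<in>nb (C n). w \<in> nb (C m)"
      using min_regionsD(4)[OF C_min_regions[of n]] by (subst MOST_finite_Ball_distrib) (auto simp: Z_def)
    then obtain N where N: "\<And>m. m \<ge> N \<Longrightarrow> nb (C n) \<subseteq> nb (C m)" by (auto simp: MOST_nat_le)
    have eq: "nb (C m) = nb (C n)" if "m \<ge> N" for m
      using card_subset_eq[OF min_regionsD(4)[OF C_min_regions] N[OF that]] min_regionsD(3)[OF C_min_regions] by simp
    have "C N \<subseteq> C m" for m
    proof (cases "m \<ge> N")
      case True
      have "nb (C m) \<inter> C N = {}" using eq[OF True] eq[of N] nb_disjoint[of "C N"] by simp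
      then show ?thesis using C_conn[of N] region_meets[OF min_regionsD(1)[OF C_min_regions[of N]] min_regionsD(1)[OF C_min_regions[of m]]] unfolding conn_def by blast
    next
      case False
      then show ?thesis using C_anti by simp
    qed
    then have "C N = {}" using C_Inter by blast
    then show False using region_meets[OF min_regionsD(1)[OF C_min_regions[of N]] region_UNIV] by simp
  qed
  then have "\<forall>n. \<exists>w. w \<in> nb (C n) - Z" by blast
  then obtain v where "\<forall>n. v n \<in> nb (C n) - Z" unfolding choice_iff ..
  then have v: "v n \<in> nb (C n)" "v n \<notin> Z" for n by blast+
  have "finite {m. v m = w}" for w
  proof (rule ccontr)
    assume inf: "infinite {m. v m = w}"
    obtain N where N: "\<And>n. n \<ge> N \<Longrightarrow> C n \<inter> {w} = {}" using C_avoids[of "{w}"] by (auto simp: MOST_nat_le)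
    have "w \<in> nb (C n)" if n: "n \<ge> N" for n
    proof -
      obtain m where m: "m > n" "v m = w" using inf unfolding infinite_nat_iff_unbounded by blast
      then have "w \<in> nb (C m)" using v(1) by blast
      moreover have "C m \<subseteq> C n" using m by (intro C_anti) simp
      ultimately show ?thesis using N[OF n] unfolding nb_def by blast
    qed
    then have "w \<in> Z" unfolding Z_def MOST_nat_le by blast
    moreover obtain m where "v m = w" using infinite_imp_nonempty[OF inf] by blast
    ultimately show False using v(2) by blast
  qed
  then show ?thesis using v(1) by blast
qed

context
  fixes v :: "nat \<Rightarrow> 'a"
  assumes v: "v n \<in> nb (C n)" and v_finite: "finite {m. v m = w}"
begin

text \<open>Unlike \<open>C n\<close> it is determined by \<open>v n\<close> and \<open>X0\<close>.
  It contains \<open>C n\<close> but not \<open>v n\<close>, which keeps \<open>v n\<close> on its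
  boundary.\<close>

definition far_region where "far_region n = core (outer (insert (v n) X0))"

lemma base_insert: "base X \<Longrightarrow> base (insert x X)"
  using base_mono[of X "insert x X"] by (auto simp: base_def)

lemma base_image:
  assumes g: "g \<in> autos" and X: "base X" shows "base (g ` X)"
  unfolding base_def
proof (intro conjI allI impI)
  show "finite (g ` X)" using X by (simp add: base_def)
  fix D assume D: "region D" "D \<inter> g ` X = {}"
  have "inv g ` D \<inter> X = {}"
    using D(2) image_Int_autos[OF inv_autos[OF g], of D "g ` X"] image_inv_autos(2)[OF g, of X] by simp
  then show "c \<le> card (nb D)"
    using X region_image[OF inv_autos[OF g] D(1)] card_nb_image[OF inv_autos[OF g], of D] unfolding base_def by metis
qed

lemma far_region_min_regions: "far_region n \<in> min_regions (insert (v n) X0)"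
  unfolding far_region_def by (intro core_min_regions outer_min_regions base_insert base_X0)

lemma far_region_facts: "far_region n \<in> min_regions X0" "conn (far_region n)" "v n \<in> nb (far_region n)"
proof -
  show "far_region n \<in> min_regions X0" using far_region_min_regions min_regions_anti[of X0 "insert (v n) X0"] by blast
  show "conn (far_region n)" unfolding far_region_def by (rule core_region(1)) (rule min_regionsD(1), rule outer_min_regions, intro base_insert base_X0)
  have "v n \<notin> C n" using v nb_disjoint by blast
  then have "C n \<in> min_regions (insert (v n) X0)" using min_regionsD[OF C_min_regions[of n]] by (simp add: min_regions_def)
  then have "C n \<subseteq> far_region n" unfolding far_region_def by (intro core_greatest C_conn outer_greatest min_regionsD(1)[OF C_min_regions])
  moreover have "v n \<notin> far_region n" using min_regionsD(2)[OF far_region_min_regions] by blast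
  ultimately show "v n \<in> nb (far_region n)" using v[of n] unfolding nb_def by blast
qed

text \<open>If \<open>x \<in> far_region n\<close> for infinitely many \<open>n\<close>, pass to a subsequence along which the boundaries are a constant
  set \<open>B\<close> plus vertices that are never repeated infinitely often. The limit of the \<open>far_region n\<close> is then either
  a region bounded by a proper subset of a boundary, or misses \<open>x\<close>.\<close>

lemma far_region_avoids_point: "finite {n. x \<in> far_region n}"
proof (rule ccontr)
  assume inf0: "infinite {n. x \<in> far_region n}"
  have bound: "card B \<le> c" if B: "infinite {n. x \<in> far_region n \<and> B \<subseteq> nb (far_region n)}" for B
  proof -
    obtain n where "B \<subseteq> nb (far_region n)" using infinite_imp_nonempty[OF B] by blast
    then show ?thesis using card_mono[OF min_regionsD(4)[OF far_region_facts(1)]] min_regionsD(3)[OF far_region_facts(1)] by metis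
  qed
  \<comment> \<open>By maximality of \<open>B\<close>, every other vertex lies on only finitely many
    of the boundaries indexed by \<open>J\<close>.\<close>
  have "\<exists>B. infinite {n. x \<in> far_region n \<and> B \<subseteq> nb (far_region n)} \<and>
    (\<forall>B'. infinite {n. x \<in> far_region n \<and> B' \<subseteq> nb (far_region n)} \<longrightarrow> card B' \<le> card B)"
    by (rule ex_has_greatest_nat[of _ "{}" card "Suc c"]) (use inf0 bound in \<open>auto simp: less_Suc_eq_le\<close>)
  then obtain B where B: "infinite {n. x \<in> far_region n \<and> B \<subseteq> nb (far_region n)}"
    and max: "\<And>B'. infinite {n. x \<in> far_region n \<and> B' \<subseteq> nb (far_region n)} \<Longrightarrow> card B' \<le> card B" by blast
  define J where "J = {n. x \<in> far_region n \<and> B \<subseteq> nb (far_region n)}"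
  obtain n1 where "n1 \<in> J" using infinite_imp_nonempty[OF B] unfolding J_def by blast
  then have finB: "finite B" unfolding J_def using min_regionsD(4)[OF far_region_facts(1)] finite_subset by blast
  have few: "finite {n\<in>J. w \<in> nb (far_region n)}" if "w \<notin> B" for w
  proof (rule ccontr)
    assume "infinite {n\<in>J. w \<in> nb (far_region n)}"
    then have "infinite {n. x \<in> far_region n \<and> insert w B \<subseteq> nb (far_region n)}"
      by (rule contrapos_nn) (rule finite_subset[rotated], assumption, auto simp: J_def)
    then have "card (insert w B) \<le> card B" by (rule max)
    then show False using that finB by simp
  qed
  \<comment> \<open>Otherwise \<open>B\<close> would be the whole boundary for every
    \<open>n\<close> in \<open>J\<close> and contain infinitely many of the
    \<open>v n\<close>.\<close>
  have "card B \<noteq> c"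
  proof
    assume c: "card B = c"
    have "v n \<in> B" if "n \<in> J" for n
    proof -
      have "B = nb (far_region n)" using that card_subset_eq[OF min_regionsD(4)[OF far_region_facts(1)]] min_regionsD(3)[OF far_region_facts(1)] c
        unfolding J_def by simp
      then show ?thesis using far_region_facts(3) by blast
    qed
    then have "J \<subseteq> (\<Union>w\<in>B. {m. v m = w})" by blast
    moreover have "finite (\<Union>w\<in>B. {m. v m = w})" using finB v_finite by blast
    ultimately show False using B unfolding J_def by (meson finite_subset)
  qed
  then have less: "card B < c" using bound[OF B] by simp
  obtain m where m: "C m \<inter> B = {}" using MOST_nat_ex[OF C_avoids[OF finB]] by auto
  \<comment> \<open>The test vertex \<open>y\<close> decides which limit to take: a set with
    boundary in \<open>B\<close> that contains \<open>y\<close> contains \<open>C m\<close>, hence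
    is a region.\<close>
  obtain y where y: "y \<in> C m" using region_meets[OF min_regionsD(1)[OF C_min_regions[of m]] region_UNIV] by blast
  have split: "J = {n\<in>J. y \<in> far_region n} \<union> {n\<in>J. y \<notin> far_region n}" by blast
  consider "infinite {n\<in>J. y \<in> far_region n}" | "infinite {n\<in>J. y \<notin> far_region n}"
    using B split unfolding J_def[symmetric] by (metis finite_UnI)
  then show False
  proof cases
    case 1
    define J1 where "J1 = {n\<in>J. y \<in> far_region n}"
    have J1: "infinite J1" "J1 \<subseteq> J" using 1 unfolding J1_def by auto
    \<comment> \<open>The limit inferior along \<open>J1\<close>: a boundary vertex outside
      \<open>B\<close> would lie on infinitely many of the boundaries. It is a region off
      \<open>X0\<close> with fewer than \<open>c\<close> boundary vertices.\<close>
    define D where "D = {z. finite {n\<in>J1. z \<notin> far_region n}}"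
    have nD: "nb D \<subseteq> B"
    proof (rule subsetI, rule ccontr)
      fix z assume z: "z \<in> nb D" "z \<notin> B"
      then obtain d where d: "infinite {n\<in>J1. z \<notin> far_region n}" "finite {n\<in>J1. d \<notin> far_region n}" "adj z d"
        unfolding nb_def D_def by blast
      have "{n\<in>J1. z \<notin> far_region n} \<subseteq> {n\<in>J1. d \<notin> far_region n} \<union> {n\<in>J. z \<in> nb (far_region n)}"
        using J1(2) d(3) nbI by blast
      then show False using d few[OF z(2)] by (meson finite_UnI finite_subset)
    qed
    have "y \<in> D" unfolding D_def J1_def by simp
    moreover have "nb D \<inter> C m = {}" using nD m by blast
    ultimately have CD: "C m \<subseteq> D" using C_conn y connD by blast
    have finD: "finite (nb D)" using nD finB by (rule finite_subset)
    then have "region D" using region_mono[OF min_regionsD(1)[OF C_min_regions] CD] by blast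
    moreover have "D \<inter> X0 = {}"
    proof (rule ccontr)
      assume "D \<inter> X0 \<noteq> {}"
      then obtain z where z: "z \<in> X0" "finite {n\<in>J1. z \<notin> far_region n}" unfolding D_def by blast
      have "{n\<in>J1. z \<notin> far_region n} = J1" using min_regionsD(2)[OF far_region_facts(1)] z(1) by blast
      then show False using z(2) J1(1) by simp
    qed
    ultimately have "c \<le> card (nb D)" by (rule X0_ge)
    also have "\<dots> \<le> card B" using nD finB by (rule card_mono[rotated])
    finally show False using less by simp
  next
    case 2
    define J2 where "J2 = {n\<in>J. y \<notin> far_region n}"
    have J2: "infinite J2" "J2 \<subseteq> J" using 2 unfolding J2_def by auto
    \<comment> \<open>The vertices off \<open>B\<close> that are eventually left by the regions.
      This is a region too, so it contains the connected sets \<open>far_region n\<close> with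
      \<open>n\<close> in \<open>J2\<close>, and with them \<open>x\<close>.\<close>
    define D where "D = {z. z \<notin> B \<and> finite {n\<in>J2. z \<in> far_region n}}"
    have nD: "nb D \<subseteq> B"
    proof (rule subsetI, rule ccontr)
      fix z assume z: "z \<in> nb D" "z \<notin> B"
      then obtain d where d: "infinite {n\<in>J2. z \<in> far_region n}" "d \<notin> B" "finite {n\<in>J2. d \<in> far_region n}" "adj z d"
        unfolding nb_def D_def by blast
      have "{n\<in>J2. z \<in> far_region n} \<subseteq> {n\<in>J2. d \<in> far_region n} \<union> {n\<in>J. d \<in> nb (far_region n)}"
        using J2(2) adj_sym[OF d(4)] nbI by blast
      then show False using d few[OF d(2)] by (meson finite_UnI finite_subset)
    qed
    have "y \<in> D" unfolding D_def J2_def using y m by auto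
    moreover have "nb D \<inter> C m = {}" using nD m by blast
    ultimately have CD: "C m \<subseteq> D" using C_conn y connD by blast
    have finD: "finite (nb D)" using nD finB by (rule finite_subset)
    then have D: "region D" using region_mono[OF min_regionsD(1)[OF C_min_regions] CD] by blast
    obtain n where n: "n \<in> J2" using infinite_imp_nonempty[OF J2(1)] by blast
    have xR: "x \<in> far_region n" "B \<subseteq> nb (far_region n)" if "n \<in> J2" for n using J2(2) that unfolding J_def by blast+
    have "nb D \<inter> far_region n = {}" using nD xR(2)[OF n] nb_disjoint[of "far_region n"] by blast
    then have "far_region n \<subseteq> D" using far_region_facts(2)[of n] region_meets[OF min_regionsD(1)[OF far_region_facts(1)[of n]] D] unfolding conn_def by blast
    then have "finite {n\<in>J2. x \<in> far_region n}" using xR(1)[OF n] unfolding D_def by blast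
    moreover have "{n\<in>J2. x \<in> far_region n} = J2" using xR(1) by blast
    ultimately show False using J2(1) by simp
  qed
qed

lemma far_region_avoids:
  assumes "finite S" shows "MOST n. far_region n \<inter> S = {}"
proof -
  have "MOST n. \<forall>x\<in>S. x \<notin> far_region n"
    using assms far_region_avoids_point by (simp add: MOST_finite_Ball_distrib MOST_iff_cofinite)
  then show ?thesis by (rule MOST_mono) blast
qed

text \<open>If more than \<open>c\<close> translates were distinct, then the \<open>g (v n)\<close> would all lie on the boundary of
  an intersection of regions which still has boundary size \<open>c\<close>.\<close>

lemma card_translates:
  assumes G: "finite \<G>" "\<G> \<subseteq> autos"
    and far: "far_region n \<inter> (\<Union>g\<in>\<G>. inv g ` (\<Union>h\<in>\<G>. h ` X0)) = {}"
  shows "card ((\<lambda>g. g ` far_region n) ` \<G>) \<le> c"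
proof (rule ccontr)
  assume "\<not> ?thesis"
  then have more: "c < card ((\<lambda>g. g ` far_region n) ` \<G>)" by simp
  obtain \<H> where H: "\<H> \<subseteq> \<G>" "inj_on (\<lambda>g. g ` far_region n) \<H>" "(\<lambda>g. g ` far_region n) ` \<G> = (\<lambda>g. g ` far_region n) ` \<H>"
    using subset_image_inj[of "(\<lambda>g. g ` far_region n) ` \<G>" "\<lambda>g. g ` far_region n" \<G>] by auto
  have cardH: "c < card \<H>" using more H(2,3) by (simp add: card_image)
  have finH: "finite \<H>" using H(1) G(1) by (rule finite_subset)
  have Ha: "g \<in> autos" if "g \<in> \<H>" for g using that H(1) G(2) by blast
  obtain h0 where h0: "h0 \<in> \<G>" using more by fastforce
  \<comment> \<open>A base common to all translates, so that the sets \<open>Q g\<close> belong to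
    one lattice \<open>min_regions Y\<close>.\<close>
  define Y where "Y = (\<Union>h\<in>\<G>. h ` X0)"
  have Y: "base Y"
  proof (rule base_mono)
    show "base (h0 ` X0)" using h0 G(2) by (intro base_image base_X0) auto
  qed (use h0 finite_X0 G(1) in \<open>auto simp: Y_def\<close>)
  define Q where "Q g = outer (insert (g (v n)) Y)" for g
  have Q: "Q g \<in> min_regions (insert (g (v n)) Y)" for g unfolding Q_def by (intro outer_min_regions base_insert Y)
  have QY: "Q g \<in> min_regions Y" for g using Q min_regions_anti[of Y "insert (g (v n)) Y"] by blast
  have gR: "conn (g ` far_region n)" "region (g ` far_region n)" "card (nb (g ` far_region n)) = c" "g (v n) \<in> nb (g ` far_region n)" if "g \<in> \<H>" for g
    using conn_image[OF Ha[OF that] far_region_facts(2)] region_image[OF Ha[OF that] min_regionsD(1)[OF far_region_facts(1)]]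
      card_nb_image[OF Ha[OF that]] min_regionsD(3)[OF far_region_facts(1)] nb_image[OF Ha[OF that]] far_region_facts(3) by auto
  have RQ: "g ` far_region n \<subseteq> Q g" if g: "g \<in> \<H>" for g
  proof -
    have "far_region n \<inter> inv g ` Y = {}" using far H(1) g unfolding Y_def by blast
    then have "g ` far_region n \<inter> g ` (inv g ` Y) = {}" using image_Int_autos[OF Ha[OF g], of "far_region n" "inv g ` Y"] by simp
    then have "g ` far_region n \<inter> Y = {}" unfolding image_inv_autos(1)[OF Ha[OF g]] .
    moreover have "g (v n) \<notin> g ` far_region n" using gR(4)[OF g] nb_disjoint by blast
    ultimately have "g ` far_region n \<in> min_regions (insert (g (v n)) Y)" using gR[OF g] by (simp add: min_regions_def)
    then show ?thesis unfolding Q_def by (rule outer_greatest)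
  qed
  have vQ: "g (v n) \<notin> Q g" for g using min_regionsD(2)[OF Q[of g]] by blast
  have vnb: "g (v n) \<in> nb (Q g)" if g: "g \<in> \<H>" for g
    using gR(4)[OF g] RQ[OF g] vQ[of g] unfolding nb_def by blast
  \<comment> \<open>Otherwise every \<open>g (v n)\<close> would lie on the boundary of the
    intersection of all \<open>Q h\<close>, and these vertices are distinct because
    \<open>h (v n)\<close> is not in \<open>Q h\<close>.\<close>
  have "\<exists>g\<in>\<H>. \<exists>h\<in>\<H>. g \<noteq> h \<and> g (v n) \<notin> Q h"
  proof (rule ccontr)
    assume "\<not> ?thesis"
    then have all: "g (v n) \<in> Q h" if "g \<in> \<H>" "h \<in> \<H>" "g \<noteq> h" for g h using that by blast
    have ne: "\<H> \<noteq> {}" using cardH by auto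
    define I where "I = (\<Inter>h\<in>\<H>. Q h)"
    have I: "I \<in> min_regions Y" and nI: "\<And>w. \<forall>h\<in>\<H>. w \<in> Q h \<union> nb (Q h) \<Longrightarrow> \<exists>h\<in>\<H>. w \<in> nb (Q h) \<Longrightarrow> w \<in> nb I"
      using min_regions_Inter[of Y \<H> Q, OF Y finH ne QY] unfolding I_def by blast+
    have "(\<lambda>g. g (v n)) ` \<H> \<subseteq> nb I"
    proof (rule image_subsetI)
      fix g assume g: "g \<in> \<H>"
      show "g (v n) \<in> nb I"
      proof (rule nI)
        show "\<forall>h\<in>\<H>. g (v n) \<in> Q h \<union> nb (Q h)" using all[OF g] vnb[OF g] by blast
        show "\<exists>h\<in>\<H>. g (v n) \<in> nb (Q h)" using vnb[OF g] g by blast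
      qed
    qed
    then have "card ((\<lambda>g. g (v n)) ` \<H>) \<le> c" using card_mono[OF min_regionsD(4)[OF I]] min_regionsD(3)[OF I] by metis
    moreover have "inj_on (\<lambda>g. g (v n)) \<H>"
    proof (rule inj_onI, rule ccontr)
      fix g h assume "g \<in> \<H>" "h \<in> \<H>" "g (v n) = h (v n)" "g \<noteq> h"
      then show False using all[of g h] vQ[of h] by simp
    qed
    ultimately show False using cardH by (simp add: card_image)
  qed
  then obtain g h where gh: "g \<in> \<H>" "h \<in> \<H>" "g \<noteq> h" "g (v n) \<notin> Q h" by blast
  note ga = Ha[OF gh(1)] and ha = Ha[OF gh(2)]
  \<comment> \<open>So \<open>Q h\<close> lies in the image under \<open>g\<close> of
    \<open>outer (insert (v n) X0)\<close>. Hence \<open>inv g \<circ> h\<close> maps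
    \<open>far_region n\<close> into itself, therefore onto itself, and the two translates
    coincide.\<close>
  have "Q h \<inter> insert (g (v n)) Y = {}" using min_regionsD(2)[OF QY[of h]] gh(4) by blast
  then have "Q h \<in> min_regions (insert (g (v n)) Y)" using min_regionsD[OF QY[of h]] by (simp add: min_regions_def)
  then have "Q h \<subseteq> outer (insert (g (v n)) Y)" by (rule outer_greatest)
  also have "\<dots> \<subseteq> outer (g ` insert (v n) X0)" using gh(1) H(1) unfolding Y_def by (intro outer_anti) auto
  also have "\<dots> = g ` outer (insert (v n) X0)" by (rule outer_image[OF ga])
  finally have "h ` far_region n \<subseteq> g ` outer (insert (v n) X0)" using RQ[OF gh(2)] by blast
  then have "inv g ` (h ` far_region n) \<subseteq> inv g ` (g ` outer (insert (v n) X0))" by (rule image_mono)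
  then have "inv g ` (h ` far_region n) \<subseteq> outer (insert (v n) X0)" unfolding image_inv_autos(2)[OF ga] .
  then have "inv g ` (h ` far_region n) \<subseteq> far_region n"
    unfolding far_region_def[of n] using conn_image[OF inv_autos[OF ga] gR(1)[OF gh(2)]] region_image[OF inv_autos[OF ga] gR(2)[OF gh(2)]]
    unfolding far_region_def[of n] by (intro core_greatest)
  then have "(inv g \<circ> h) ` far_region n = far_region n"
    unfolding image_comp_autos[symmetric] by (intro min_regions_no_translation far_region_facts comp_autos inv_autos ga ha)
  then have "g ` far_region n = h ` far_region n" using image_inv_autos(1)[OF ga, of "h ` far_region n"] by (simp add: image_comp)
  then show False using H(2) gh unfolding inj_on_def by blast
qed

end

section \<open>Pigeonhole and the final contradiction\<close>

lemma ex_agreeing_pair: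
  assumes L: "infinite L" "L \<subseteq> autos" and F: "finite F"
  shows "\<exists>g\<in>L. \<exists>h\<in>L. g \<noteq> h \<and> (\<exists>P. conn P \<and> region P \<and> P \<inter> F = {} \<and> g ` P = h ` P \<and> (\<forall>x\<in>nb P. g x = h x))"
proof -
  obtain v where v: "\<And>n. v n \<in> nb (C n)" "\<And>w. finite {m. v m = w}" using ex_boundary_sequence by blast
  \<comment> \<open>One more than the number of pairs of a translate (at most \<open>c\<close>) and
    a map from \<open>nb P\<close> to its boundary (\<open>c ^ c\<close> for each).\<close>
  obtain \<G> where G: "finite \<G>" "card \<G> = Suc (c * c ^ c)" "\<G> \<subseteq> L" using infinite_arbitrarily_large[OF L(1)] by blast
  have Ga: "\<G> \<subseteq> autos" using G(3) L(2) by blast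
  have "finite (F \<union> (\<Union>g\<in>\<G>. inv g ` (\<Union>h\<in>\<G>. h ` X0)))" using F G(1) finite_X0 by blast
  then obtain n where n: "far_region v n \<inter> (F \<union> (\<Union>g\<in>\<G>. inv g ` (\<Union>h\<in>\<G>. h ` X0))) = {}"
    using MOST_nat_ex[OF far_region_avoids[OF v]] by blast
  define P where "P = far_region v n"
  note P = far_region_facts[OF v, of n, folded P_def]
  define \<Q> where "\<Q> = (\<lambda>g. g ` P) ` \<G>"
  have far: "far_region v n \<inter> (\<Union>g\<in>\<G>. inv g ` (\<Union>h\<in>\<G>. h ` X0)) = {}" using n by blast
  have Q: "finite \<Q>" "card \<Q> \<le> c"
    unfolding \<Q>_def P_def using G(1) card_translates[OF v G(1) Ga far] by simp_all
  have Qnb: "finite (nb Q)" "card (nb Q) = c" if QQ: "Q \<in> \<Q>" for Q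
  proof -
    obtain g where g: "g \<in> autos" "Q = g ` P" using QQ Ga unfolding \<Q>_def by blast
    show "card (nb Q) = c" unfolding g(2) card_nb_image[OF g(1)] by (rule min_regionsD(3)[OF P(1)])
    show "finite (nb Q)" unfolding g(2) nb_image[OF g(1)] using min_regionsD(4)[OF P(1)] by simp
  qed
  define S where "S = (SIGMA Q:\<Q>. nb P \<rightarrow>\<^sub>E nb Q)"
  have "finite S" unfolding S_def using Q(1) Qnb(1) min_regionsD(4)[OF P(1)] by (auto intro!: finite_SigmaI finite_PiE)
  have "card S = (\<Sum>Q\<in>\<Q>. card (nb P \<rightarrow>\<^sub>E nb Q))"
    unfolding S_def using Q(1) Qnb(1) min_regionsD(4)[OF P(1)] by (intro card_SigmaI) (auto intro!: finite_PiE)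
  also have "\<dots> = (\<Sum>Q\<in>\<Q>. c ^ c)"
    using min_regionsD(3,4)[OF P(1)] Qnb(2) by (intro sum.cong) (auto simp: card_funcsetE)
  also have "\<dots> \<le> c * c ^ c" using Q(2) by simp
  finally have "card S \<le> c * c ^ c" .
  moreover have "(\<lambda>g. (g ` P, restrict g (nb P))) ` \<G> \<subseteq> S"
  proof (rule image_subsetI)
    fix g assume g: "g \<in> \<G>"
    have "nb (g ` P) = g ` nb P" using nb_image g Ga by blast
    then have "restrict g (nb P) \<in> nb P \<rightarrow>\<^sub>E nb (g ` P)" by auto
    then show "(g ` P, restrict g (nb P)) \<in> S" using g unfolding S_def \<Q>_def by blast
  qed
  ultimately have "\<not> inj_on (\<lambda>g. (g ` P, restrict g (nb P))) \<G>"
    using card_inj_on_le[OF _ _ \<open>finite S\<close>] G(2) by (metis Suc_n_not_le_n le_trans)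
  then obtain g h where gh: "g \<in> \<G>" "h \<in> \<G>" "g \<noteq> h" "g ` P = h ` P" "restrict g (nb P) = restrict h (nb P)"
    unfolding inj_on_def by blast
  have "g x = h x" if "x \<in> nb P" for x using fun_cong[OF gh(5), of x] that by simp
  moreover have "P \<inter> F = {}" using n unfolding P_def by blast
  ultimately show ?thesis using gh G(3) P(2) min_regionsD(1)[OF P(1)] by blast
qed

lemma finite_autos:
  assumes few: "\<not> (UNIV :: nat set set) \<lesssim> autos"
  shows "finite autos"
proof (rule ccontr)
  assume inf: "infinite autos"
  obtain F where F: "finite F" and F0: "\<forall>g\<in>autos. (\<forall>x\<in>F. g x = x) \<longrightarrow> g = id"
    using finite_base[OF few] by (elim exE conjE)
  have F_id: "g = id" if "g \<in> autos" "\<And>x. x \<in> F \<Longrightarrow> g x = x" for g using F0 that by blast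
  define stab where "stab S = {g\<in>autos. \<forall>x\<in>S. g x = x}" for S
  have "\<exists>S. (S \<subseteq> F \<and> infinite (stab S)) \<and> (\<forall>S'. S' \<subseteq> F \<and> infinite (stab S') \<longrightarrow> card S' \<le> card S)"
    by (rule ex_has_greatest_nat[of _ "{}" card "Suc (card F)"])
      (use inf F in \<open>auto simp: stab_def less_Suc_eq_le intro: card_mono\<close>)
  then obtain F' where F': "F' \<subseteq> F" "infinite (stab F')"
    and max0: "\<forall>S. S \<subseteq> F \<and> infinite (stab S) \<longrightarrow> card S \<le> card F'" by (elim exE conjE)
  have max: "card S \<le> card F'" if "S \<subseteq> F" "infinite (stab S)" for S using max0 that by blast
  define L where "L = stab F'"
  have La: "L \<subseteq> autos" by (auto simp: L_def stab_def)
  have Lc: "g \<circ> h \<in> L" if "g \<in> L" "h \<in> L" for g h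
    using that comp_autos unfolding L_def stab_def by auto
  have Li: "inv g \<in> L" if "g \<in> L" for g
    using that inv_autos inv_eqI unfolding L_def stab_def by auto
  have fin_stab: "finite (stab (insert x F'))" if "x \<in> F - F'" for x
  proof (rule ccontr)
    assume "infinite (stab (insert x F'))"
    then have "card (insert x F') \<le> card F'" using that F'(1) by (intro max) auto
    then show False using that finite_subset[OF F'(1) F] by simp
  qed
  obtain g h P where gh: "g \<in> L" "h \<in> L" "g \<noteq> h" and P0: "conn P" "region P" "P \<inter> F = {}" "g ` P = h ` P"
    "\<forall>x\<in>nb P. g x = h x"
    using ex_agreeing_pair[OF F'(2)[folded L_def] La F] by (elim bexE conjE exE)
  note P = P0(1-4) P0(5)[rule_format]
  define u where "u = inv g \<circ> h"
  have ga: "g \<in> autos" using gh(1) La by blast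
  have uL: "u \<in> L" unfolding u_def using Lc Li gh by blast
  then have ua: "u \<in> autos" using La by blast
  have "u \<noteq> id"
  proof
    assume "u = id"
    have "g x = h x" for x
    proof -
      have "inv g (h x) = x" using fun_cong[OF \<open>u = id\<close>, of x] by (simp add: u_def)
      then show ?thesis using autos_inv(1)[OF ga, of "h x"] by simp
    qed
    then show False using gh(3) by blast
  qed
  have unb: "u x = x" if "x \<in> nb P" for x
    using P(5)[OF that] autos_inv(2)[OF ga, of x] by (simp add: u_def)
  have uP: "u ` P = P"
    unfolding u_def image_comp_autos P(4)[symmetric] by (rule image_inv_autos(2)[OF ga])
  \<comment> \<open>\<open>P\<close> avoids \<open>F\<close>, so the restriction of \<open>u\<close>
    to \<open>P\<close> fixes \<open>F\<close>.\<close>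
  have u_id: "u x = x" if "x \<in> P" for x
  proof -
    let ?r = "\<lambda>x. if x \<in> P then u x else x"
    have "?r = id" using P(3) by (intro F_id restrict_autos ua uP unb) auto
    from fun_cong[OF this, of x] show ?thesis using that by simp
  qed
  have "finite {g\<in>L. g x \<notin> P}" if x: "x \<in> F - F'" for x
  proof -
    \<comment> \<open>A nonempty fibre lies in a translate of \<open>stab (insert x F')\<close>,
      which is finite by maximality of \<open>F'\<close>.\<close>
    have fibre: "finite {g\<in>L. g x = y}" for y
    proof (cases "\<exists>g\<in>L. g x = y")
      case True
      then obtain g1 where g1: "g1 \<in> L" "g1 x = y" by blast
      then have g1a: "g1 \<in> autos" using La by blast
      have "{g\<in>L. g x = y} \<subseteq> (\<lambda>s. g1 \<circ> s) ` stab (insert x F')"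
      proof
        fix g2 assume g2: "g2 \<in> {g\<in>L. g x = y}"
        then have "inv g1 \<circ> g2 \<in> L" using Lc Li g1 by blast
        moreover have "(inv g1 \<circ> g2) x = x" using g2 g1 inv_eqI[OF g1a, of x y] by simp
        ultimately have "inv g1 \<circ> g2 \<in> stab (insert x F')" unfolding L_def stab_def by simp
        moreover have "g2 = g1 \<circ> (inv g1 \<circ> g2)" using autos_inv(1)[OF g1a] by (simp add: fun_eq_iff)
        ultimately show "g2 \<in> (\<lambda>s. g1 \<circ> s) ` stab (insert x F')" by blast
      qed
      then show ?thesis using fin_stab[OF x] by (meson finite_imageI finite_subset)
    next
      case False
      then have "{g\<in>L. g x = y} = {}" by blast
      then show ?thesis by (simp only: finite.emptyI)
    qed
    define A where "A = (\<lambda>g. g x) ` L"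
    have "finite (- (P \<union> nb P) \<inter> A)"
      unfolding A_def by (rule finite_orbit_in_ranked[OF F F_id La Lc Li rayless_complement[OF P(2)]])
    then have "finite ((- (P \<union> nb P) \<inter> A) \<union> nb P)" using region_finite[OF P(2)] by blast
    then have "finite (\<Union>y\<in>(- (P \<union> nb P) \<inter> A) \<union> nb P. {g\<in>L. g x = y})" using fibre by blast
    moreover have "{g\<in>L. g x \<notin> P} \<subseteq> (\<Union>y\<in>(- (P \<union> nb P) \<inter> A) \<union> nb P. {g\<in>L. g x = y})"
      unfolding A_def by blast
    ultimately show ?thesis by (rule finite_subset[rotated])
  qed
  then have "finite (\<Union>x\<in>F - F'. {g\<in>L. g x \<notin> P})" using F by blast
  then have "\<not> L \<subseteq> (\<Union>x\<in>F - F'. {g\<in>L. g x \<notin> P})" using F'(2) finite_subset unfolding L_def by blast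
  then obtain f where f0: "f \<in> L" "f \<notin> (\<Union>x\<in>F - F'. {g\<in>L. g x \<notin> P})" by blast
  then have f: "f \<in> L" "f x \<in> P" if "x \<in> F - F'" for x using that by blast+
  have fa: "f \<in> autos" using f0(1) La by blast
  \<comment> \<open>Both \<open>u\<close> and \<open>f\<close> fix \<open>F'\<close>, and
    \<open>f\<close> sends the rest of \<open>F\<close> into \<open>P\<close>, where
    \<open>u\<close> is trivial.\<close>
  have "inv f \<circ> (u \<circ> f) = id"
  proof (rule F_id)
    show "inv f \<circ> (u \<circ> f) \<in> autos" by (intro comp_autos inv_autos fa ua)
    fix x assume x: "x \<in> F"
    have "u (f x) = f x"
    proof (cases "x \<in> F'")
      case True
      then show ?thesis using f0(1) uL unfolding L_def stab_def by simp
    next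
      case False
      then show ?thesis using x f(2) u_id by blast
    qed
    then show "(inv f \<circ> (u \<circ> f)) x = x" using autos_inv(2)[OF fa] by simp
  qed
  have "u y = y" for y
  proof -
    have "inv f (u (f (inv f y))) = inv f y" using fun_cong[OF \<open>inv f \<circ> (u \<circ> f) = id\<close>, of "inv f y"] by simp
    then show ?thesis using autos_inv(1)[OF fa] by metis
  qed
  then show False using \<open>u \<noteq> id\<close> id_eq by blast
qed

end

section \<open>Graphs with one end of finite degree\<close>

lemma (in thin_one_ended) finite_or_continuum_many_autos:
  "finite autos \<or> (UNIV :: nat set set) \<lesssim> autos"
proof -
  obtain c X where "finite X" "\<forall>C. region C \<longrightarrow> C \<inter> X = {} \<longrightarrow> c \<le> card (nb C)"
    "\<forall>E. region E \<longrightarrow> (\<exists>C\<subseteq>E. region C \<and> card (nb C) \<le> c)"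
    using ex_base by (elim exE conjE)
  then interpret based_end adj V k c X by unfold_locales auto
  obtain C where "\<forall>n. C n \<in> min_regions X \<and> conn (C n) \<and> C (Suc n) \<subseteq> C n" "(\<Inter>n. C n) = {}"
    using ex_exhaustion by (elim exE conjE)
  then interpret exhausted_end adj V k c X C by unfold_locales auto
  show ?thesis using finite_autos by blast
qed

definition adjacent :: "'a ugraph \<Rightarrow> 'a \<Rightarrow> 'a \<Rightarrow> bool" where
  "adjacent G x y \<longleftrightarrow> {x, y} \<in> edges G"

lemma adjacent_verts:
  assumes "simple_graph G" "adjacent G x y" shows "x \<in> verts G" "y \<in> verts G"
  using assms unfolding simple_graph_def adjacent_def by blast+

interpretation adjacent: sym_rel "adjacent G" "verts G" for G
  by unfold_locales (simp add: adjacent_def insert_commute)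

lemma adjacent_is_ray_iff:
  assumes "simple_graph G" shows "adjacent.is_ray G r \<longleftrightarrow> ray G r"
proof -
  have "r n \<in> verts G" if "\<forall>n. adjacent G (r n) (r (Suc n))" for n
    using adjacent_verts(1)[OF assms] that by blast
  then show ?thesis
    unfolding adjacent.is_ray_def ray_def by (auto simp: adjacent_def)
qed

lemma component_within:
  assumes K: "K \<in> components_of_graph (del_verts G (adjacent.nb G C))" and x: "x \<in> K" "x \<in> C"
  shows "K \<subseteq> C"
proof
  fix y assume "y \<in> K"
  let ?H = "del_verts G (adjacent.nb G C)"
  have "(x, y) \<in> connected_rel ?H"
    using quotient_eq_iff[OF equiv_connected_rel] K x(1) \<open>y \<in> K\<close> unfolding components_of_graph_def by metis
  then have "(x, y) \<in> {(x, y). {x, y} \<in> edges ?H}\<^sup>*" by (simp add: connected_rel_def)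
  then show "y \<in> C"
  proof (induction rule: rtrancl_induct)
    case base
    then show ?case using x by simp
  next
    case (step y z)
    then have "{y, z} \<in> edges G" "z \<notin> adjacent.nb G C" by (auto simp: del_verts_def)
    then show ?case using step.IH adjacent.nbI[of z C y G] by (auto simp: adjacent_def insert_commute)
  qed
qed

text \<open>The two encodings differ off \<open>verts G\<close>, where one has
  \<open>undefined\<close> and the other the identity; restriction and extension by the identity
  translate between them.\<close>

lemma automorphisms_lepoll:
  "adjacent.autos G \<lesssim> automorphisms G" "automorphisms G \<lesssim> adjacent.autos G" if G: "simple_graph G"
proof -
  let ?V = "verts G" and ?A = "adjacent.autos G"
  define ext where "ext f x = (if x \<in> verts G then f x else x)" for f x
  have inV: "f x \<in> ?V \<longleftrightarrow> x \<in> ?V" if "f \<in> ?A" for f x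
    using adjacent.autos_outside[OF that] adjacent.autos_inj[OF that] by metis
  have imgV: "f ` ?V = ?V" if f: "f \<in> ?A" for f
  proof (intro equalityI subsetI)
    fix x assume "x \<in> ?V"
    then have "inv_into UNIV f x \<in> ?V" using inV[OF f, of "inv_into UNIV f x"] adjacent.autos_inv(1)[OF f, of x] by simp
    then show "x \<in> f ` ?V" using adjacent.autos_inv(1)[OF f, of x] by (metis imageI)
  qed (use inV[OF f] in auto)
  have res: "restrict f ?V \<in> automorphisms G" if f: "f \<in> ?A" for f
    unfolding automorphisms_def
  proof (intro CollectI conjI ballI)
    have "bij_betw f ?V ?V" unfolding bij_betw_def using imgV[OF f] adjacent.autos_inj[OF f] by (auto simp: inj_on_def)
    then show "restrict f ?V \<in> Bij ?V" by (simp add: Bij_def bij_betw_restrict_eq)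
    show "{u, v} \<in> edges G \<longleftrightarrow> {restrict f ?V u, restrict f ?V v} \<in> edges G" if "u \<in> ?V" "v \<in> ?V" for u v
      using that adjacent.autos_adj[OF f, of u v] by (simp add: adjacent_def)
  qed
  have "inj_on (\<lambda>f. restrict f ?V) ?A"
  proof (rule inj_onI, rule ext)
    fix f g x assume fg: "f \<in> ?A" "g \<in> ?A" "restrict f ?V = restrict g ?V"
    show "f x = g x"
      using fun_cong[OF fg(3), of x] adjacent.autos_outside[OF fg(1), of x] adjacent.autos_outside[OF fg(2), of x]
      by (cases "x \<in> ?V") auto
  qed
  then show "?A \<lesssim> automorphisms G" using res unfolding lepoll_def by blast
  have ext: "ext f \<in> ?A" if f: "f \<in> automorphisms G" for f
    unfolding adjacent.autos_def
  proof (intro CollectI conjI allI impI)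
    have b: "bij_betw f ?V ?V" using f by (simp add: automorphisms_def Bij_def)
    then have "bij_betw (ext f) (?V \<union> - ?V) (?V \<union> - ?V)"
    proof (intro bij_betw_combine)
      show "bij_betw (ext f) ?V ?V" using b by (rule bij_betw_cong[THEN iffD1, rotated]) (simp add: ext_def)
      show "bij_betw (ext f) (- ?V) (- ?V)" by (rule bij_betw_cong[THEN iffD1, OF _ bij_betw_id]) (simp add: ext_def)
    qed auto
    then show "bij (ext f)" by (simp add: Un_commute)
    have fV: "f x \<in> ?V" if "x \<in> ?V" for x using b that by (auto simp: bij_betw_def)
    show "adjacent G (ext f x) (ext f y) \<longleftrightarrow> adjacent G x y" for x y
    proof (cases "x \<in> ?V \<and> y \<in> ?V")
      case True
      then show ?thesis using f by (auto simp: automorphisms_def adjacent_def ext_def)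
    next
      case False
      then have "\<not> (ext f x \<in> ?V \<and> ext f y \<in> ?V)" by (auto simp: ext_def)
      then show ?thesis using False adjacent_verts[OF G] by blast
    qed
    show "ext f x = x" if "x \<notin> ?V" for x using that by (simp add: ext_def)
  qed
  have "inj_on ext (automorphisms G)"
  proof (rule inj_onI, rule extensionalityI[of _ ?V])
    fix f g assume fg: "f \<in> automorphisms G" "g \<in> automorphisms G" "ext f = ext g"
    then show "f \<in> extensional ?V" "g \<in> extensional ?V" by (simp_all add: automorphisms_def Bij_def)
    show "f x = g x" if "x \<in> ?V" for x using fun_cong[OF fg(3), of x] that by (simp add: ext_def)
  qed
  then show "automorphisms G \<lesssim> ?A" using ext unfolding lepoll_def by blast
qed

theorem theorem1p2:
  fixes G :: "'a ugraph"
  assumes "simple_graph G"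
    and "ends G = {\<omega>}"
    and "finite_vertex_degree \<omega>"
  shows "finite (carrier (Aut G)) \<or> (UNIV :: nat set set) \<lesssim> carrier (Aut G)"
proof -
  note ray_iff = adjacent_is_ray_iff[OF assms(1)]
  have "ends G \<noteq> {}" using assms(2) by simp
  then have "{r. ray G r} \<noteq> {}" unfolding ends_def by (auto simp: quotient_def)
  have cls: "end_rel G `` {r} = \<omega>" if "ray G r" for r
    using quotientI[of r "{r. ray G r}" "end_rel G"] assms(2) that unfolding ends_def by simp
  have same: "(r, s) \<in> end_rel G" if "ray G r" "ray G s" for r s
    using cls[OF that(1)] cls[OF that(2)] that eq_equiv_class_iff[OF equiv_end_rel, of r G s] by simp
  have in_omega: "r \<in> \<omega>" if "ray G r" for r
    using cls[OF that] same[OF that that] by blast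
  obtain k :: nat where k: "has_vertex_degree \<omega> {..<k}" using assms(3) by (auto simp: finite_vertex_degree_def)
  interpret thin_one_ended "adjacent G" "verts G" k
  proof unfold_locales
    \<comment> \<open>Tails of both rays share a component \<open>K\<close> after deletion of
      \<open>nb C\<close>. It meets \<open>C\<close> and cannot leave it.\<close>
    fix r s C assume r: "adjacent.is_ray G r" and s: "adjacent.is_ray G s" and fin: "finite (adjacent.nb G C)"
      and tail: "MOST n. r n \<in> C"
    have "adjacent.nb G C \<subseteq> verts G" using adjacent_verts(1)[OF assms(1)] by (auto simp: adjacent.nb_def)
    moreover have "same_end G r s" using same[of r s] r s by (simp add: ray_iff end_rel_def)
    ultimately obtain K m n where K: "K \<in> components_of_graph (del_verts G (adjacent.nb G C))"
      "r ` {m..} \<subseteq> K" "s ` {n..} \<subseteq> K"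
      unfolding same_end_def using fin by meson
    obtain j where "\<forall>i\<ge>j. r i \<in> C" using tail by (auto simp: MOST_nat_le)
    then have "r (max m j) \<in> K" "r (max m j) \<in> C" using K(2) by auto
    then have "K \<subseteq> C" by (rule component_within[OF K(1)])
    then show "MOST n. s n \<in> C" using K(3) unfolding MOST_nat_le by (intro exI[of _ n]) auto
  next
    show "\<exists>r. adjacent.is_ray G r" using \<open>{r. ray G r} \<noteq> {}\<close> by (auto simp: ray_iff)
  next
    fix F assume F: "F \<subseteq> Collect (adjacent.is_ray G)"
      and disj: "\<And>r s. r \<in> F \<Longrightarrow> s \<in> F \<Longrightarrow> r \<noteq> s \<Longrightarrow> range r \<inter> range s = {}"
    have "F \<subseteq> \<omega>" using F in_omega by (auto simp: ray_iff)
    moreover have "disjoint_rays F" using disj by (auto simp: disjoint_rays_def pairwise_def disjnt_def)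
    ultimately have "F \<lesssim> {..<k}" using k by (simp add: has_vertex_degree_def)
    then show "finite F \<and> card F \<le> k" by (simp add: lepoll_iff_finite_card)
  qed
  have "finite (automorphisms G) \<or> (UNIV :: nat set set) \<lesssim> automorphisms G"
    using finite_or_continuum_many_autos
  proof
    assume "finite (adjacent.autos G)"
    then have "finite (automorphisms G)"
      using automorphisms_lepoll(2)[OF assms(1)] unfolding lepoll_def by (auto intro: inj_on_finite)
    then show ?thesis ..
  next
    assume "(UNIV :: nat set set) \<lesssim> adjacent.autos G"
    from lepoll_trans[OF this automorphisms_lepoll(1)[OF assms(1)]] show ?thesis ..
  qed
  then show ?thesis by (simp add: Aut_def)
qed

end
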